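(* Let $\mathcal{L}'$ be a first-order language, $\mathcal{C}$ a class of finite $\mathcal{L}'$-structures, and $\mathcal{N}$ an infinite, locally finite $\mathcal{L}'$-structure such that $\mathrm{Age}(\mathcal{N})=\mathcal{C}$. Then the following are equivalent: (1) $\mathcal{C}$ is a Ramsey class. (2) $\mathcal{N}$-indexed indiscernibles have the modelling property.
   Context: Ramsey notions. $\mathrm{Age}(\mathcal{N})$ is the class of (isomorphism types of) finitely generated substructures of $\mathcal{N}$; it is treated as an isomorphism-closed class. $\mathcal{N}$ is locally finite if every finite subset generates a finite substructure. For structures $A,C$, $\binom{C}{A}$ is the set of embeddings $A\to C$. For $A\subseteq B$, write $C\to(B)^A_2$ if for every colouring $\chi:\binom{C}{A}\to\{0,1\}$ there is an embedding $e:B\to C$ such that $\chi$ is constant on $\{e\circ f: f\in\binom{B}{A}\}$. A class $\mathcal{C}$ has HP if it is closed under substructures; JEP if any two members embed in a common member; ERP (embedding Ramsey property) if for all $A\subseteq B$ in $\mathcal{C}$ there is $C\in\mathcal{C}$ with $C\to(B)^A_2$. A Ramsey class is an isomorphism-closed class of finite structures with HP, JEP and ERP. Indiscernibles. All types are over $\emptyset$; $\mathrm{qftp}_{\mathcal{N}}(\bar i)$ is the complete quantifier-free type of $\bar i$ in $\mathcal{N}$; for a set $\Delta$ of formulas, $\mathrm{tp}^\Delta(\bar a)$ is the restriction of $\mathrm{tp}(\bar a)$ to formulas and negations of formulas in $\Delta$. Let $T$ be a complete theory with infinite models in a language $\mathcal{L}$ and let $\mathbb{M}\models T$ be $\kappa$-saturated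 and $\kappa$-homogeneous for a large cardinal $\kappa$ (in particular larger than $|\mathcal{L}|$, $|\mathcal{N}|$ and the length of the tuples considered). All sequences consist of tuples of the same length. A sequence $(\bar a_i:i\in\mathcal{N})$ of tuples from $\mathbb{M}$ is $\mathcal{N}$-indiscernible if for all $n$ and $i_1,\dots,i_n,j_1,\dots,j_n\in\mathcal{N}$, $\mathrm{qftp}_{\mathcal{N}}(i_1,\dots,i_n)=\mathrm{qftp}_{\mathcal{N}}(j_1,\dots,j_n)$ implies $\mathrm{tp}_{\mathbb{M}}(\bar a_{i_1},\dots,\bar a_{i_n})=\mathrm{tp}_{\mathbb{M}}(\bar a_{j_1},\dots,\bar a_{j_n})$. A sequence $(\bar b_i:i\in\mathcal{N})$ is (locally) based on $(\bar a_i:i\in\mathcal{N})$ if for every finite set $\Delta$ of $\mathcal{L}$-formulas, every $n$ and all $i_1,\dots,i_n\in\mathcal{N}$ there are $j_1,\dots,j_n\in\mathcal{N}$ with $\mathrm{qftp}_{\mathcal{N}}(\bar i)=\mathrm{qftp}_{\mathcal{N}}(\bar j)$ and $\mathrm{tp}^\Delta_{\mathbb{M}}(\bar b_{i_1},\dots,\bar b_{i_n})=\mathrm{tp}^\Delta_{\mathbb{M}}(\bar a_{j_1},\dots,\bar a_{j_n})$. $\mathcal{N}$-indiscernibles have the modelling property if for every such $T$ (in any language) and every $\mathcal{N}$-indexed sequence of tuples from $\mathbb{M}\models T$ there is an $\mathcal{N}$-indiscernible sequence in $\mathbb{M}$ based on it. *)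

theory Defs
  imports Main "HOL-Library.FuncSet" "HOL-Library.Infinite_Typeclass"
begin

unbundle cardinal_syntax

section \<open>First-order structures\<close>

text \<open>Symbols are drawn from types, but a language uses only the symbols in \<open>funs\<close> and
  \<open>rels\<close>, so either set may be empty. Constants are function symbols of arity 0.\<close>

record ('f, 'r) language =
  funs :: "'f set"
  rels :: "'r set"
  farity :: "'f \<Rightarrow> nat"
  rarity :: "'r \<Rightarrow> nat"

text \<open>Interpretations are total on lists. Only their values on symbols of the language and on
  lists over \<open>univ\<close> of the correct length are meaningful, and no definition below looks at
  other values.\<close>

record ('f, 'r, 'a) struct =
  univ :: "'a set"
  fint :: "'f \<Rightarrow> 'a list \<Rightarrow> 'a"
  rint :: "'r \<Rightarrow> 'a list \<Rightarrow> bool"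

definition is_struct :: "('f, 'r) language \<Rightarrow> ('f, 'r, 'a) struct \<Rightarrow> bool" where
  "is_struct L M \<longleftrightarrow> univ M \<noteq> {} \<and>
     (\<forall>f\<in>funs L. \<forall>xs. set xs \<subseteq> univ M \<and> length xs = farity L f \<longrightarrow> fint M f xs \<in> univ M)"

definition substructure ::
  "('f, 'r) language \<Rightarrow> ('f, 'r, 'a) struct \<Rightarrow> ('f, 'r, 'a) struct \<Rightarrow> bool" where
  "substructure L A B \<longleftrightarrow> is_struct L A \<and> is_struct L B \<and> univ A \<subseteq> univ B \<and>
     (\<forall>f\<in>funs L. \<forall>xs. set xs \<subseteq> univ A \<and> length xs = farity L f \<longrightarrow> fint A f xs = fint B f xs) \<and>
     (\<forall>r\<in>rels L. \<forall>xs. set xs \<subseteq> univ A \<and> length xs = rarity L r \<longrightarrow> rint A r xs = rint B r xs)"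

definition embedding ::
  "('f, 'r) language \<Rightarrow> ('f, 'r, 'a) struct \<Rightarrow> ('f, 'r, 'b) struct \<Rightarrow> ('a \<Rightarrow> 'b) \<Rightarrow> bool" where
  "embedding L A B h \<longleftrightarrow> h ` univ A \<subseteq> univ B \<and> inj_on h (univ A) \<and>
     (\<forall>f\<in>funs L. \<forall>xs. set xs \<subseteq> univ A \<and> length xs = farity L f \<longrightarrow>
        h (fint A f xs) = fint B f (map h xs)) \<and>
     (\<forall>r\<in>rels L. \<forall>xs. set xs \<subseteq> univ A \<and> length xs = rarity L r \<longrightarrow>
        rint A r xs = rint B r (map h xs))"

definition isomorphic ::
  "('f, 'r) language \<Rightarrow> ('f, 'r, 'a) struct \<Rightarrow> ('f, 'r, 'b) struct \<Rightarrow> bool" where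
  "isomorphic L A B \<longleftrightarrow> (\<exists>h. embedding L A B h \<and> h ` univ A = univ B)"

inductive_set generated :: "('f, 'r) language \<Rightarrow> ('f, 'r, 'a) struct \<Rightarrow> 'a set \<Rightarrow> 'a set"
  for L :: "('f, 'r) language" and M :: "('f, 'r, 'a) struct" and S :: "'a set" where
  base: "x \<in> S \<Longrightarrow> x \<in> generated L M S"
| step: "f \<in> funs L \<Longrightarrow> length xs = farity L f \<Longrightarrow> \<forall>x\<in>set xs. x \<in> generated L M S \<Longrightarrow>
    fint M f xs \<in> generated L M S"

definition finitely_generated :: "('f, 'r) language \<Rightarrow> ('f, 'r, 'a) struct \<Rightarrow> bool" where
  "finitely_generated L M \<longleftrightarrow> (\<exists>S. finite S \<and> S \<subseteq> univ M \<and> generated L M S = univ M)"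

definition locally_finite :: "('f, 'r) language \<Rightarrow> ('f, 'r, 'a) struct \<Rightarrow> bool" where
  "locally_finite L M \<longleftrightarrow> (\<forall>S. finite S \<and> S \<subseteq> univ M \<longrightarrow> finite (generated L M S))"

section \<open>Ages and Ramsey classes\<close>

text \<open>Members of the age live on subsets of a type \<open>'c\<close>. If \<open>'c\<close> is
  infinite, it contains a copy of every finite structure, so nothing is lost for locally
  finite structures.\<close>

definition Age :: "('f, 'r) language \<Rightarrow> ('f, 'r, 'a) struct \<Rightarrow> ('f, 'r, 'c) struct set" where
  "Age L N = {A. is_struct L A \<and>
     (\<exists>B. substructure L B N \<and> finitely_generated L B \<and> isomorphic L A B)}"

text \<open>Extensionality makes each embedding a single element of \<open>embs L A C\<close>; otherwise a
  colouring could distinguish functions that agree on \<open>univ A\<close>. For the same reason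
  composites are formed with \<^const>\<open>compose\<close>.\<close>

definition embs ::
  "('f, 'r) language \<Rightarrow> ('f, 'r, 'a) struct \<Rightarrow> ('f, 'r, 'b) struct \<Rightarrow> ('a \<Rightarrow> 'b) set" where
  "embs L A C = {h \<in> extensional (univ A). embedding L A C h}"

definition ramsey_arrow ::
  "('f, 'r) language \<Rightarrow> ('f, 'r, 'c) struct \<Rightarrow> ('f, 'r, 'b) struct \<Rightarrow> ('f, 'r, 'a) struct \<Rightarrow> bool" where
  "ramsey_arrow L C B A \<longleftrightarrow>
     (\<forall>\<chi> :: ('a \<Rightarrow> 'c) \<Rightarrow> nat. \<chi> ` embs L A C \<subseteq> {0, 1} \<longrightarrow>
        (\<exists>e\<in>embs L B C. \<exists>c. \<forall>f\<in>embs L A B. \<chi> (compose (univ A) e f) = c))"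

definition iso_closed :: "('f, 'r) language \<Rightarrow> ('f, 'r, 'c) struct set \<Rightarrow> bool" where
  "iso_closed L \<C> \<longleftrightarrow> (\<forall>A\<in>\<C>. \<forall>B. is_struct L B \<and> isomorphic L A B \<longrightarrow> B \<in> \<C>)"

definition HP :: "('f, 'r) language \<Rightarrow> ('f, 'r, 'c) struct set \<Rightarrow> bool" where
  "HP L \<C> \<longleftrightarrow> (\<forall>B\<in>\<C>. \<forall>A. substructure L A B \<longrightarrow> A \<in> \<C>)"

definition JEP :: "('f, 'r) language \<Rightarrow> ('f, 'r, 'c) struct set \<Rightarrow> bool" where
  "JEP L \<C> \<longleftrightarrow> (\<forall>A\<in>\<C>. \<forall>B\<in>\<C>. \<exists>C\<in>\<C>. (\<exists>g. embedding L A C g) \<and> (\<exists>h. embedding L B C h))"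

definition ERP :: "('f, 'r) language \<Rightarrow> ('f, 'r, 'c) struct set \<Rightarrow> bool" where
  "ERP L \<C> \<longleftrightarrow> (\<forall>A\<in>\<C>. \<forall>B\<in>\<C>. substructure L A B \<longrightarrow> (\<exists>C\<in>\<C>. ramsey_arrow L C B A))"

definition ramsey_class :: "('f, 'r) language \<Rightarrow> ('f, 'r, 'c) struct set \<Rightarrow> bool" where
  "ramsey_class L \<C> \<longleftrightarrow> (\<forall>A\<in>\<C>. is_struct L A \<and> finite (univ A)) \<and>
     iso_closed L \<C> \<and> HP L \<C> \<and> JEP L \<C> \<and> ERP L \<C>"

section \<open>Formulas and types\<close>

datatype ('f, 'v) tm = Var 'v | Fn 'f "('f, 'v) tm list"

datatype ('f, 'r, 'v) fm =
    Eq "('f, 'v) tm" "('f, 'v) tm"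
  | Rel 'r "('f, 'v) tm list"
  | Neg "('f, 'r, 'v) fm"
  | Conj "('f, 'r, 'v) fm" "('f, 'r, 'v) fm"
  | Ex 'v "('f, 'r, 'v) fm"

fun wf_tm :: "('f, 'r) language \<Rightarrow> ('f, 'v) tm \<Rightarrow> bool" where
  "wf_tm L (Var v) \<longleftrightarrow> True"
| "wf_tm L (Fn f ts) \<longleftrightarrow> f \<in> funs L \<and> length ts = farity L f \<and> (\<forall>t\<in>set ts. wf_tm L t)"

fun wf_fm :: "('f, 'r) language \<Rightarrow> ('f, 'r, 'v) fm \<Rightarrow> bool" where
  "wf_fm L (Eq s t) \<longleftrightarrow> wf_tm L s \<and> wf_tm L t"
| "wf_fm L (Rel r ts) \<longleftrightarrow> r \<in> rels L \<and> length ts = rarity L r \<and> (\<forall>t\<in>set ts. wf_tm L t)"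
| "wf_fm L (Neg \<phi>) \<longleftrightarrow> wf_fm L \<phi>"
| "wf_fm L (Conj \<phi> \<psi>) \<longleftrightarrow> wf_fm L \<phi> \<and> wf_fm L \<psi>"
| "wf_fm L (Ex v \<phi>) \<longleftrightarrow> wf_fm L \<phi>"

fun fv_tm :: "('f, 'v) tm \<Rightarrow> 'v set" where
  "fv_tm (Var v) = {v}"
| "fv_tm (Fn f ts) = (\<Union>t\<in>set ts. fv_tm t)"

fun fv :: "('f, 'r, 'v) fm \<Rightarrow> 'v set" where
  "fv (Eq s t) = fv_tm s \<union> fv_tm t"
| "fv (Rel r ts) = (\<Union>t\<in>set ts. fv_tm t)"
| "fv (Neg \<phi>) = fv \<phi>"
| "fv (Conj \<phi> \<psi>) = fv \<phi> \<union> fv \<psi>"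
| "fv (Ex v \<phi>) = fv \<phi> - {v}"

fun qfree :: "('f, 'r, 'v) fm \<Rightarrow> bool" where
  "qfree (Eq s t) \<longleftrightarrow> True"
| "qfree (Rel r ts) \<longleftrightarrow> True"
| "qfree (Neg \<phi>) \<longleftrightarrow> qfree \<phi>"
| "qfree (Conj \<phi> \<psi>) \<longleftrightarrow> qfree \<phi> \<and> qfree \<psi>"
| "qfree (Ex v \<phi>) \<longleftrightarrow> False"

fun eval_tm :: "('f, 'r, 'a) struct \<Rightarrow> ('v \<Rightarrow> 'a) \<Rightarrow> ('f, 'v) tm \<Rightarrow> 'a" where
  "eval_tm M e (Var v) = e v"
| "eval_tm M e (Fn f ts) = fint M f (map (eval_tm M e) ts)"

fun sat :: "('f, 'r, 'a) struct \<Rightarrow> ('v \<Rightarrow> 'a) \<Rightarrow> ('f, 'r, 'v) fm \<Rightarrow> bool" where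
  "sat M e (Eq s t) \<longleftrightarrow> eval_tm M e s = eval_tm M e t"
| "sat M e (Rel r ts) \<longleftrightarrow> rint M r (map (eval_tm M e) ts)"
| "sat M e (Neg \<phi>) \<longleftrightarrow> \<not> sat M e \<phi>"
| "sat M e (Conj \<phi> \<psi>) \<longleftrightarrow> sat M e \<phi> \<and> sat M e \<psi>"
| "sat M e (Ex v \<phi>) \<longleftrightarrow> (\<exists>x\<in>univ M. sat M (e(v := x)) \<phi>)"

definition formulas :: "('f, 'r) language \<Rightarrow> ('f, 'r, 'v) fm set" where
  "formulas L = {\<phi>. wf_fm L \<phi>}"

definition sentences :: "('f, 'r) language \<Rightarrow> ('f, 'r, 'v) fm set" where
  "sentences L = {\<phi> \<in> formulas L. fv \<phi> = {}}"

text \<open>\<open>tp L M V e\<close> is the complete type over \<open>\<emptyset>\<close> of the tuple \<open>(e v : v \<in> V)\<close>, in the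
  variables \<open>V\<close>. The index set \<open>V\<close> may be infinite.\<close>

definition tp ::
  "('f, 'r) language \<Rightarrow> ('f, 'r, 'a) struct \<Rightarrow> 'v set \<Rightarrow> ('v \<Rightarrow> 'a) \<Rightarrow> ('f, 'r, 'v) fm set" where
  "tp L M V e = {\<phi> \<in> formulas L. fv \<phi> \<subseteq> V \<and> sat M e \<phi>}"

definition tp_restrict ::
  "('f, 'r, 'v) fm set \<Rightarrow> ('f, 'r) language \<Rightarrow> ('f, 'r, 'a) struct \<Rightarrow> 'v set \<Rightarrow> ('v \<Rightarrow> 'a)
     \<Rightarrow> ('f, 'r, 'v) fm set" where
  "tp_restrict \<Delta> L M V e = tp L M V e \<inter> (\<Delta> \<union> Neg ` \<Delta>)"

definition qftp :: "('f, 'r) language \<Rightarrow> ('f, 'r, 'a) struct \<Rightarrow> 'a list \<Rightarrow> ('f, 'r, nat) fm set" where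
  "qftp L N is = {\<phi> \<in> tp L N {..<length is} (\<lambda>k. is ! k). qfree \<phi>}"

section \<open>Complete theories and monster models\<close>

definition models :: "('f, 'r) language \<Rightarrow> ('f, 'r, 'a) struct \<Rightarrow> ('f, 'r, nat) fm set \<Rightarrow> bool" where
  "models L M T \<longleftrightarrow> is_struct L M \<and> (\<forall>\<phi>\<in>T. \<forall>e. sat M e \<phi>)"

text \<open>Completeness and the existence of an infinite model are tested on structures living on
  \<open>'m\<close>. The notion is used only when \<open>'m\<close> is infinite and larger than the language; then
  every infinite structure has an elementarily equivalent copy on \<open>'m\<close> by
  Loewenheim-Skolem.\<close>

definition complete_theory ::
  "'m itself \<Rightarrow> ('f, 'r) language \<Rightarrow> ('f, 'r, nat) fm set \<Rightarrow> bool" where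
  "complete_theory _ L T \<longleftrightarrow> T \<subseteq> sentences L \<and>
     (\<exists>M :: ('f, 'r, 'm) struct. models L M T) \<and>
     (\<forall>\<phi>\<in>sentences L.
        (\<forall>M :: ('f, 'r, 'm) struct. models L M T \<longrightarrow> models L M {\<phi>}) \<or>
        (\<forall>M :: ('f, 'r, 'm) struct. models L M T \<longrightarrow> models L M {Neg \<phi>}))"

definition has_infinite_models ::
  "'m itself \<Rightarrow> ('f, 'r) language \<Rightarrow> ('f, 'r, nat) fm set \<Rightarrow> bool" where
  "has_infinite_models _ L T \<longleftrightarrow> (\<exists>M :: ('f, 'r, 'm) struct. models L M T \<and> infinite (univ M))"

text \<open>A pair \<open>(\<phi>, e)\<close> stands for the formula over \<open>A\<close> obtained from \<open>\<phi>\<close> by keeping the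
  variable 0 and replacing every other free variable \<open>v\<close> by the parameter \<open>e v\<close>.
  One-types are not required to be complete, which does not affect saturation.\<close>

definition one_type_over ::
  "('f, 'r) language \<Rightarrow> ('f, 'r, 'a) struct \<Rightarrow> 'a set \<Rightarrow> (('f, 'r, nat) fm \<times> (nat \<Rightarrow> 'a)) set \<Rightarrow> bool"
where
  "one_type_over L M A p \<longleftrightarrow>
     (\<forall>(\<phi>, e)\<in>p. \<phi> \<in> formulas L \<and> e ` (fv \<phi> - {0}) \<subseteq> A) \<and>
     (\<forall>q. finite q \<and> q \<subseteq> p \<longrightarrow> (\<exists>x\<in>univ M. \<forall>(\<phi>, e)\<in>q. sat M (e(0 := x)) \<phi>))"

definition saturated ::
  "'k rel \<Rightarrow> ('f, 'r) language \<Rightarrow> ('f, 'r, 'a) struct \<Rightarrow> bool" where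
  "saturated \<kappa> L M \<longleftrightarrow>
     (\<forall>A p. A \<subseteq> univ M \<and> |A| <o \<kappa> \<and> one_type_over L M A p \<longrightarrow>
        (\<exists>x\<in>univ M. \<forall>(\<phi>, e)\<in>p. sat M (e(0 := x)) \<phi>))"

definition partial_elementary ::
  "('f, 'r) language \<Rightarrow> ('f, 'r, 'a) struct \<Rightarrow> 'a set \<Rightarrow> ('a \<Rightarrow> 'a) \<Rightarrow> bool" where
  "partial_elementary L M A g \<longleftrightarrow> g ` A \<subseteq> univ M \<and>
     (\<forall>\<phi> \<in> formulas L. \<forall>e :: nat \<Rightarrow> 'a. e ` fv \<phi> \<subseteq> A \<longrightarrow> (sat M e \<phi> \<longleftrightarrow> sat M (g \<circ> e) \<phi>))"

definition homogeneous ::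
  "'k rel \<Rightarrow> ('f, 'r) language \<Rightarrow> ('f, 'r, 'a) struct \<Rightarrow> bool" where
  "homogeneous \<kappa> L M \<longleftrightarrow>
     (\<forall>A g. A \<subseteq> univ M \<and> |A| <o \<kappa> \<and> partial_elementary L M A g \<longrightarrow>
        (\<forall>x\<in>univ M. \<exists>y. partial_elementary L M (insert x A) (g(x := y))
            \<and> (\<forall>a\<in>A. (g(x := y)) a = g a)))"

section \<open>Indiscernibles and the modelling property\<close>

text \<open>All tuples of a sequence are indexed by the same set \<open>X\<close>. In a type of
  \<open>(a\<^bsub>is ! 0\<^esub>, \<dots>, a\<^bsub>is ! (n - 1)\<^esub>)\<close>, the variable \<open>(k, \<xi>)\<close> stands for entry \<open>\<xi>\<close> of the tuple
  with index \<open>is ! k\<close>.\<close>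

definition seq_vars :: "nat \<Rightarrow> 'x set \<Rightarrow> (nat \<times> 'x) set" where
  "seq_vars n X = {..<n} \<times> X"

definition seq_val :: "('i \<Rightarrow> 'x \<Rightarrow> 'm) \<Rightarrow> 'i list \<Rightarrow> nat \<times> 'x \<Rightarrow> 'm" where
  "seq_val a is = (\<lambda>(k, \<xi>). a (is ! k) \<xi>)"

definition indiscernible ::
  "('f, 'r) language \<Rightarrow> ('f, 'r, 'i) struct \<Rightarrow> ('g, 's) language \<Rightarrow> ('g, 's, 'm) struct
     \<Rightarrow> 'x set \<Rightarrow> ('i \<Rightarrow> 'x \<Rightarrow> 'm) \<Rightarrow> bool" where
  "indiscernible L N L\<^sub>T M X a \<longleftrightarrow>
     (\<forall>n is js. is \<in> lists (univ N) \<and> js \<in> lists (univ N) \<and> length is = n \<and> length js = n \<and>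
        qftp L N is = qftp L N js \<longrightarrow>
        tp L\<^sub>T M (seq_vars n X) (seq_val a is) = tp L\<^sub>T M (seq_vars n X) (seq_val a js))"

definition based_on ::
  "('f, 'r) language \<Rightarrow> ('f, 'r, 'i) struct \<Rightarrow> ('g, 's) language \<Rightarrow> ('g, 's, 'm) struct
     \<Rightarrow> 'x set \<Rightarrow> ('i \<Rightarrow> 'x \<Rightarrow> 'm) \<Rightarrow> ('i \<Rightarrow> 'x \<Rightarrow> 'm) \<Rightarrow> bool" where
  "based_on L N L\<^sub>T M X b a \<longleftrightarrow>
     (\<forall>\<Delta> n is. finite \<Delta> \<and> \<Delta> \<subseteq> formulas L\<^sub>T \<and> is \<in> lists (univ N) \<and> length is = n \<longrightarrow>
        (\<exists>js \<in> lists (univ N). length js = n \<and> qftp L N is = qftp L N js \<and>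
           tp_restrict \<Delta> L\<^sub>T M (seq_vars n X) (seq_val b is) =
           tp_restrict \<Delta> L\<^sub>T M (seq_vars n X) (seq_val a js)))"

text \<open>The type parameter fixes where the function and relation symbols of the languages, the
  index sets of the tuples and the models live. Since an infinite \<open>\<kappa>\<close>-saturated model has at
  least \<open>\<kappa>\<close> elements, it is no restriction to take \<open>\<kappa>\<close> to be a cardinal on subsets of \<open>'m\<close>.
  As \<open>\<kappa>\<close> exceeds the size of the infinite structure \<open>N\<close>, bounding the number of symbols by \<open>\<kappa>\<close> also
  bounds the number of formulas. If \<open>'m\<close> is too small, it carries no such model and the property
  is vacuous; \<open>2\<^bsup>|N|\<^esup>\<close> elements suffice for \<open>|N|\<^sup>+\<close>-saturated models of every complete theory
  with infinite models in a language of size at most \<open>|N|\<close>.\<close>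

definition modelling_property ::
  "('g \<times> 's \<times> 'x \<times> 'm) itself \<Rightarrow> ('f, 'r) language \<Rightarrow> ('f, 'r, 'i) struct \<Rightarrow> bool" where
  "modelling_property _ L N \<longleftrightarrow>
     (\<forall>(L\<^sub>T :: ('g, 's) language) T (\<kappa> :: 'm rel) (M :: ('g, 's, 'm) struct) (X :: 'x set) a.
        complete_theory TYPE('m) L\<^sub>T T \<and> has_infinite_models TYPE('m) L\<^sub>T T \<and>
        Card_order \<kappa> \<and> |funs L\<^sub>T <+> rels L\<^sub>T| <o \<kappa> \<and> |univ N| <o \<kappa> \<and> |X| <o \<kappa> \<and>
        models L\<^sub>T M T \<and> saturated \<kappa> L\<^sub>T M \<and> homogeneous \<kappa> L\<^sub>T M \<and>
        (\<forall>i\<in>univ N. \<forall>\<xi>\<in>X. a i \<xi> \<in> univ M) \<longrightarrow>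
        (\<exists>b. (\<forall>i\<in>univ N. \<forall>\<xi>\<in>X. b i \<xi> \<in> univ M) \<and>
           indiscernible L N L\<^sub>T M X b \<and> based_on L N L\<^sub>T M X b a))"

end

theory Submission
  imports Defs
begin

text \<open>From the Ramsey property to the modelling property: the conditions on an indiscernible
  sequence based on \<open>a\<close> form a set of formulas in the variables \<open>univ N \<times> X\<close>. A finite part of it
  concerns only a finite substructure \<open>B\<close> of \<open>N\<close>; iterating the Ramsey property gives a copy of \<open>B\<close>
  in \<open>N\<close> along which \<open>a\<close> satisfies that part, and saturation realises the whole set.

  Conversely, if \<open>C \<rightarrow> (B)\<^sup>A\<close> fails for all finite \<open>C\<close> in \<open>N\<close>, compactness yields a colouring of the
  embeddings of \<open>A\<close> into \<open>N\<close> without a homogeneous copy of \<open>B\<close>. With \<open>n = |A|\<close>, this colouring is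
  placed inside a generic \<open>n\<close>-ary relation that is saturated and homogeneous for \<open>|N|\<^sup>+\<close> and has
  \<open>2\<^bsup>|N|\<^esup>\<close> elements. A sequence of indiscernibles based on the copy of \<open>N\<close> in it gives all
  embeddings of \<open>A\<close> into a fixed copy of \<open>B\<close> the same colour, and basing transports this to a
  homogeneous copy of \<open>B\<close> for the original colouring, a contradiction.\<close>


section \<open>Formulas\<close>

text \<open>Being based on \<open>a\<close> is an existential demand and cannot be put into a type
  as it stands. It is replaced by a universal one: \<open>b\<close> at \<open>is\<close> satisfies
  every formula that \<open>a\<close> satisfies at all tuples with the quantifier-free type of
  \<open>is\<close>. Applied to the negated conjunction of the literals true of \<open>b\<close>,
  this returns the required \<open>js\<close>.

  Conversely, expanding \<open>N\<close> by the colouring is not enough: the modelling property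
  speaks of saturated homogeneous models only, and the universe \<open>'m\<close> is only assumed to
  have room for 2^|N| points. So a relation is built by hand on a set of that size: every
  quantifier-free type of a new point over at most |N| points is realised, and the colouring is
  prescribed on a copy of \<open>N\<close>. The arity is |A| because an embedding of
  \<open>A\<close> is the tuple of its values along an enumeration. Extension over small sets gives
  quantifier elimination, so saturation and homogeneity reduce to the choice of one point.\<close>

lemma finite_fv_tm: "finite (fv_tm t)"
  by (induction t) auto

lemma finite_fv: "finite (fv \<phi>)"
  by (induction \<phi>) (auto simp: finite_fv_tm)

lemma eval_tm_cong: "(\<And>v. v \<in> fv_tm t \<Longrightarrow> e v = e' v) \<Longrightarrow> eval_tm M e t = eval_tm M e' t"
proof (induction t)
  case (Fn f ts)
  then have "map (eval_tm M e) ts = map (eval_tm M e') ts"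
    by (intro map_cong) auto
  then show ?case by (simp only: eval_tm.simps)
qed simp

lemma sat_cong: "(\<And>v. v \<in> fv \<phi> \<Longrightarrow> e v = e' v) \<Longrightarrow> sat M e \<phi> \<longleftrightarrow> sat M e' \<phi>"
proof (induction \<phi> arbitrary: e e')
  case (Eq s t)
  then show ?case using eval_tm_cong[of s e e' M] eval_tm_cong[of t e e' M] by simp
next
  case (Rel r ts)
  then have "map (eval_tm M e) ts = map (eval_tm M e') ts"
    by (intro map_cong refl eval_tm_cong) auto
  then show ?case by (simp only: sat.simps)
next
  case (Neg \<phi>)
  have "sat M e \<phi> \<longleftrightarrow> sat M e' \<phi>"
    using Neg.prems by (intro Neg.IH) simp
  then show ?case by simp
next
  case (Conj \<phi> \<psi>)
  have "sat M e \<phi> \<longleftrightarrow> sat M e' \<phi>" "sat M e \<psi> \<longleftrightarrow> sat M e' \<psi>"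
    using Conj.prems by (auto intro!: Conj.IH)
  then show ?case by simp
next
  case (Ex v \<phi>)
  have "sat M (e(v := x)) \<phi> \<longleftrightarrow> sat M (e'(v := x)) \<phi>" for x
    using Ex by (intro Ex.IH) auto
  then show ?case by simp
qed

fun ren_tm :: "('v \<Rightarrow> 'w) \<Rightarrow> ('f, 'v) tm \<Rightarrow> ('f, 'w) tm" where
  "ren_tm \<sigma> (Var v) = Var (\<sigma> v)"
| "ren_tm \<sigma> (Fn f ts) = Fn f (map (ren_tm \<sigma>) ts)"

text \<open>Capture-avoiding renaming along a map that need not be injective; the fresh name exists
  only if the target type is infinite.\<close>

fun ren :: "('v \<Rightarrow> 'w) \<Rightarrow> ('f, 'r, 'v) fm \<Rightarrow> ('f, 'r, 'w) fm" where
  "ren \<sigma> (Eq s t) = Eq (ren_tm \<sigma> s) (ren_tm \<sigma> t)"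
| "ren \<sigma> (Rel r ts) = Rel r (map (ren_tm \<sigma>) ts)"
| "ren \<sigma> (Neg \<phi>) = Neg (ren \<sigma> \<phi>)"
| "ren \<sigma> (Conj \<phi> \<psi>) = Conj (ren \<sigma> \<phi>) (ren \<sigma> \<psi>)"
| "ren \<sigma> (Ex v \<phi>) = (let w = (SOME w. w \<notin> \<sigma> ` (fv \<phi> - {v})) in Ex w (ren (\<sigma>(v := w)) \<phi>))"

lemma wf_ren_tm: "wf_tm L (ren_tm \<sigma> t) \<longleftrightarrow> wf_tm L t"
  by (induction t) auto

lemma wf_ren: "wf_fm L (ren \<sigma> \<phi>) \<longleftrightarrow> wf_fm L \<phi>"
  by (induction \<phi> arbitrary: \<sigma>) (auto simp: wf_ren_tm Let_def)

lemma fv_ren_tm: "fv_tm (ren_tm \<sigma> t) = \<sigma> ` fv_tm t"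
  by (induction t) auto

lemma fresh_image:
  assumes "infinite (UNIV :: 'w set)"
  shows "(SOME w. w \<notin> (\<sigma> :: 'v \<Rightarrow> 'w) ` (fv \<phi> - {v})) \<notin> \<sigma> ` (fv \<phi> - {v})"
  by (rule someI_ex, rule ex_new_if_finite) (simp_all add: assms finite_fv)

lemma fv_ren:
  assumes "infinite (UNIV :: 'w set)"
  shows "fv (ren (\<sigma> :: 'v \<Rightarrow> 'w) \<phi>) = \<sigma> ` fv \<phi>"
proof (induction \<phi> arbitrary: \<sigma>)
  case (Ex v \<phi>)
  define w where "w = (SOME w. w \<notin> \<sigma> ` (fv \<phi> - {v}))"
  have "w \<notin> \<sigma> ` (fv \<phi> - {v})"
    unfolding w_def by (rule fresh_image[OF assms])
  moreover have "ren \<sigma> (Ex v \<phi>) = Ex w (ren (\<sigma>(v := w)) \<phi>)"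
    by (simp add: w_def Let_def)
  ultimately show ?case
    using Ex by (auto simp: image_iff)
qed (auto simp: fv_ren_tm)

lemma eval_ren_tm: "eval_tm M e (ren_tm \<sigma> t) = eval_tm M (e \<circ> \<sigma>) t"
proof (induction t)
  case (Fn f ts)
  then have "map (eval_tm M e \<circ> ren_tm \<sigma>) ts = map (eval_tm M (e \<circ> \<sigma>)) ts"
    by (intro map_cong) (auto simp: comp_def)
  then show ?case by (simp only: ren_tm.simps eval_tm.simps map_map)
qed simp

lemma sat_ren:
  assumes "infinite (UNIV :: 'w set)"
  shows "sat M e (ren (\<sigma> :: 'v \<Rightarrow> 'w) \<phi>) \<longleftrightarrow> sat M (e \<circ> \<sigma>) \<phi>"
proof (induction \<phi> arbitrary: \<sigma> e)
  case (Rel r ts)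
  have "map (eval_tm M e \<circ> ren_tm \<sigma>) ts = map (eval_tm M (e \<circ> \<sigma>)) ts"
    by (simp add: eval_ren_tm)
  then show ?case by (simp only: ren.simps sat.simps map_map)
next
  case (Ex v \<phi>)
  define w where "w = (SOME w. w \<notin> \<sigma> ` (fv \<phi> - {v}))"
  have w: "w \<notin> \<sigma> ` (fv \<phi> - {v})"
    unfolding w_def by (rule fresh_image[OF assms])
  \<comment> \<open>The update at \<open>w\<close> is invisible to the other free variables, since
    none of them is sent to \<open>w\<close>.\<close>
  have "sat M (e(w := x) \<circ> \<sigma>(v := w)) \<phi> \<longleftrightarrow> sat M ((e \<circ> \<sigma>)(v := x)) \<phi>" for x
    using w by (intro sat_cong) auto
  moreover have "ren \<sigma> (Ex v \<phi>) = Ex w (ren (\<sigma>(v := w)) \<phi>)"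
    by (simp add: w_def Let_def)
  ultimately show ?case
    by (simp only: sat.simps Ex.IH)
qed (auto simp: eval_ren_tm)

text \<open>The empty conjunction must be a true formula. \<open>Ex v (Eq (Var v) (Var v))\<close>
  has no free variable, which keeps \<open>fv_conjs\<close> exact; it is true in nonempty
  structures, hence the assumption of \<open>sat_conjs\<close>.\<close>

fun conjs :: "'v \<Rightarrow> ('f, 'r, 'v) fm list \<Rightarrow> ('f, 'r, 'v) fm" where
  "conjs v [] = Ex v (Eq (Var v) (Var v))"
| "conjs v (\<phi> # \<phi>s) = Conj \<phi> (conjs v \<phi>s)"

lemma wf_conjs: "wf_fm L (conjs v \<phi>s) \<longleftrightarrow> (\<forall>\<phi>\<in>set \<phi>s. wf_fm L \<phi>)"
  by (induction \<phi>s) auto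

lemma fv_conjs: "fv (conjs v \<phi>s) = (\<Union>\<phi>\<in>set \<phi>s. fv \<phi>)"
  by (induction \<phi>s) auto

lemma sat_conjs: "univ M \<noteq> {} \<Longrightarrow> sat M e (conjs v \<phi>s) \<longleftrightarrow> (\<forall>\<phi>\<in>set \<phi>s. sat M e \<phi>)"
  by (induction \<phi>s) auto

fun exs :: "'v list \<Rightarrow> ('f, 'r, 'v) fm \<Rightarrow> ('f, 'r, 'v) fm" where
  "exs [] \<phi> = \<phi>"
| "exs (v # vs) \<phi> = Ex v (exs vs \<phi>)"

lemma wf_exs: "wf_fm L (exs vs \<phi>) \<longleftrightarrow> wf_fm L \<phi>"
  by (induction vs) auto

lemma fv_exs: "fv (exs vs \<phi>) = fv \<phi> - set vs"
  by (induction vs) auto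

lemma sat_exs:
  "sat M e (exs vs \<phi>) \<longleftrightarrow>
    (\<exists>e'. (\<forall>v\<in>set vs. e' v \<in> univ M) \<and> (\<forall>v. v \<notin> set vs \<longrightarrow> e' v = e v) \<and> sat M e' \<phi>)"
proof (induction vs arbitrary: e)
  case Nil
  have "(\<forall>v. e' v = e v) \<longleftrightarrow> e' = e" for e' by (simp add: fun_eq_iff)
  then show ?case by simp
next
  case (Cons u vs)
  show ?case
  proof
    assume "sat M e (exs (u # vs) \<phi>)"
    then obtain x e' where x: "x \<in> univ M" and e': "\<forall>v\<in>set vs. e' v \<in> univ M"
      "\<forall>v. v \<notin> set vs \<longrightarrow> e' v = (e(u := x)) v" "sat M e' \<phi>"
      using Cons.IH by auto
    \<comment> \<open>If \<open>u\<close> occurs again in \<open>vs\<close>, the inner quantifier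
      overrides \<open>x\<close>, so \<open>e' u\<close> may differ from \<open>x\<close>.\<close>
    have "e' u \<in> univ M" using x e' by (cases "u \<in> set vs") auto
    then show "\<exists>e'. (\<forall>v\<in>set (u # vs). e' v \<in> univ M) \<and> (\<forall>v. v \<notin> set (u # vs) \<longrightarrow> e' v = e v) \<and> sat M e' \<phi>"
      using e' by (intro exI[of _ e']) auto
  next
    assume "\<exists>e'. (\<forall>v\<in>set (u # vs). e' v \<in> univ M) \<and> (\<forall>v. v \<notin> set (u # vs) \<longrightarrow> e' v = e v) \<and> sat M e' \<phi>"
    then obtain e' where e': "\<forall>v\<in>set (u # vs). e' v \<in> univ M"
      "\<forall>v. v \<notin> set (u # vs) \<longrightarrow> e' v = e v" "sat M e' \<phi>" by blast
    then have "sat M (e(u := e' u)) (exs vs \<phi>)"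
      unfolding Cons.IH by (intro exI[of _ e']) auto
    then show "sat M e (exs (u # vs) \<phi>)" using e' by auto
  qed
qed

section \<open>Types in many variables in saturated models\<close>

text \<open>\<open>saturated\<close> accepts formulas in one variable with parameters. That a finite
  \<open>\<Gamma>0\<close> be solvable with \<open>w\<close> at \<open>x\<close> is one such
  formula: variables already in \<open>V\<close> become parameters, the others are quantified away.
  These formulas form a one-type because the union of finitely many finite parts is again a finite
  part.\<close>

lemma saturated_realises_one:
  fixes M :: "('g, 's, 'm) struct" and \<Gamma> :: "('g, 's, 'v) fm set"
  assumes M: "univ M \<noteq> {}" and sat: "saturated \<kappa> L M"
    and wf: "\<Gamma> \<subseteq> formulas L"
    and small: "|V| <o \<kappa>" and eV: "e ` V \<subseteq> univ M"
    and fin: "\<And>\<Gamma>0. finite \<Gamma>0 \<Longrightarrow> \<Gamma>0 \<subseteq> \<Gamma> \<Longrightarrow>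
      \<exists>e'. range e' \<subseteq> univ M \<and> (\<forall>v\<in>V. e' v = e v) \<and> (\<forall>\<phi>\<in>\<Gamma>0. sat M e' \<phi>)"
  shows "\<exists>x\<in>univ M. \<forall>\<Gamma>0. finite \<Gamma>0 \<and> \<Gamma>0 \<subseteq> \<Gamma> \<longrightarrow>
      (\<exists>e'. range e' \<subseteq> univ M \<and> e' w = x \<and> (\<forall>v\<in>V-{w}. e' v = e v) \<and> (\<forall>\<phi>\<in>\<Gamma>0. sat M e' \<phi>))"
proof -
  define good where "good \<Gamma>0 x \<longleftrightarrow> (\<exists>e'. range e' \<subseteq> univ M \<and> e' w = x \<and> (\<forall>v\<in>V-{w}. e' v = e v) \<and> (\<forall>\<phi>\<in>\<Gamma>0. sat M e' \<phi>))"
    for \<Gamma>0 x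
  obtain d where d: "d \<in> univ M" using M by blast
  have ex: "\<exists>(\<psi> :: ('g, 's, nat) fm) g. \<psi> \<in> formulas L \<and> g ` (fv \<psi> - {0}) \<subseteq> e ` V \<and>
     (\<forall>x\<in>univ M. sat M (g(0 := x)) \<psi> \<longleftrightarrow> good \<Gamma>0 x)" if G0: "finite \<Gamma>0" "\<Gamma>0 \<subseteq> \<Gamma>" for \<Gamma>0
  proof -
    obtain \<phi>s where \<phi>s: "set \<phi>s = \<Gamma>0" using G0(1) finite_list by blast
    define F where "F = (\<Union>\<phi>\<in>\<Gamma>0. fv \<phi>) - {w}"
    have fvF: "v \<in> insert w F" if "\<phi> \<in> \<Gamma>0" "v \<in> fv \<phi>" for \<phi> v
      using that by (auto simp: F_def)
    have finF: "finite F" using G0 by (auto simp: F_def finite_fv)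
    then obtain h0 :: "'v \<Rightarrow> nat" where h0: "inj_on h0 F"
      using finite_imp_inj_to_nat_seg by metis
    \<comment> \<open>\<open>one_type_over\<close> reserves the variable 0, so \<open>w\<close> is
      sent there and every other variable to a successor.\<close>
    define h where "h v = (if v = w then 0 else Suc (h0 v))" for v
    have h_inj: "inj_on h (insert w F)"
      using h0 by (auto simp: h_def inj_on_def F_def)
    define \<theta> where "\<theta> = conjs 0 (map (ren h) \<phi>s)"
    have fv\<theta>: "fv \<theta> \<subseteq> h ` (insert w F)"
      by (auto simp: \<theta>_def fv_conjs fv_ren \<phi>s F_def)
    obtain us where us: "set us = h ` (F - V)" using finF by (meson finite_Diff finite_imageI finite_list)
    define \<psi> where "\<psi> = exs us \<theta>"
    define hi where "hi = the_inv_into (insert w F) h"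
    have hi: "hi (h v) = v" if "v \<in> insert w F" for v
      unfolding hi_def using that by (intro the_inv_into_f_f[OF h_inj])
    define g where "g k = e (hi k)" for k
    have sat\<theta>: "sat M e' \<theta> \<longleftrightarrow> (\<forall>\<phi>\<in>\<Gamma>0. sat M (e' \<circ> h) \<phi>)" for e'
      using M by (simp add: \<theta>_def sat_conjs \<phi>s sat_ren)
    have "\<psi> \<in> formulas L"
      using wf G0 by (auto simp: formulas_def \<psi>_def \<theta>_def wf_exs wf_conjs wf_ren \<phi>s)
    moreover have "g ` (fv \<psi> - {0}) \<subseteq> e ` V"
    proof -
      have "fv \<psi> - {0} \<subseteq> h ` (F \<inter> V)"
      proof
        fix k assume k: "k \<in> fv \<psi> - {0}"
        then obtain v where v: "v \<in> insert w F" "k = h v" "k \<notin> h ` (F - V)" "k \<noteq> 0"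
          using fv\<theta> by (auto simp: \<psi>_def fv_exs us)
        have "v \<noteq> w" using v(2,4) by (auto simp: h_def)
        then have "v \<in> F \<inter> V" using v by blast
        then show "k \<in> h ` (F \<inter> V)" using v by blast
      qed
      then have "g ` (fv \<psi> - {0}) \<subseteq> g ` h ` (F \<inter> V)" by (rule image_mono)
      also have "\<dots> \<subseteq> e ` V" using hi by (auto simp: g_def)
      finally show ?thesis .
    qed
    moreover have "sat M (g(0 := x)) \<psi> \<longleftrightarrow> good \<Gamma>0 x" if x: "x \<in> univ M" for x
    proof
      assume "sat M (g(0 := x)) \<psi>"
      then obtain e1 where e1: "\<forall>v\<in>set us. e1 v \<in> univ M"
        "\<forall>v. v \<notin> set us \<longrightarrow> e1 v = (g(0 := x)) v" "sat M e1 \<theta>"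
        unfolding \<psi>_def sat_exs by blast
      \<comment> \<open>Values chosen by the quantifiers are copied back along \<open>h\<close>;
        variables foreign to \<open>\<Gamma>0\<close> and \<open>V\<close> get the default
        \<open>d\<close>.\<close>
      define e' where "e' v = (if v = w then x else if v \<in> V then e v else if v \<in> F then e1 (h v) else d)" for v
      have e'h: "e' v = e1 (h v)" if "v \<in> insert w F" for v
      proof (cases "v = w")
        case True
        have "h w \<notin> set us" unfolding us by (auto simp: h_def F_def)
        then show ?thesis using True e1(2) by (simp add: e'_def h_def)
      next
        case False
        show ?thesis
        proof (cases "v \<in> V")
          case True
          have "h v \<notin> set us"
            using True False that h_inj unfolding us inj_on_def by blast
          moreover have "h v \<noteq> 0" using False by (simp add: h_def)
          ultimately have "e1 (h v) = e v" using e1(2) hi that by (simp add: g_def)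
          then show ?thesis using False True by (simp add: e'_def)
        next
          case nV: False
          then show ?thesis using False that by (simp add: e'_def)
        qed
      qed
      have "range e' \<subseteq> univ M"
      proof clarify
        fix v show "e' v \<in> univ M"
          using eV e1(1) x d by (auto simp: e'_def us)
      qed
      moreover have "sat M e' \<phi>" if "\<phi> \<in> \<Gamma>0" for \<phi>
      proof -
        have "sat M (e1 \<circ> h) \<phi>" using e1(3) that sat\<theta> by blast
        moreover have "sat M e' \<phi> \<longleftrightarrow> sat M (e1 \<circ> h) \<phi>"
          using e'h fvF[OF that] by (intro sat_cong) simp
        ultimately show ?thesis by blast
      qed
      ultimately show "good \<Gamma>0 x"
        unfolding good_def by (intro exI[of _ e'] conjI) (simp_all add: e'_def)
    next
      assume "good \<Gamma>0 x"
      then obtain e' where e': "range e' \<subseteq> univ M" "e' w = x" "\<forall>v\<in>V-{w}. e' v = e v"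
        "\<forall>\<phi>\<in>\<Gamma>0. sat M e' \<phi>" unfolding good_def by blast
      define e1 where "e1 k = (if k \<in> h ` (insert w F) then e' (hi k) else (g(0 := x)) k)" for k
      have e1h: "e1 (h v) = e' v" if "v \<in> insert w F" for v
        using imageI[OF that, of h] by (simp only: e1_def if_True hi[OF that])
      have "\<forall>\<phi>\<in>\<Gamma>0. sat M (e1 \<circ> h) \<phi>"
      proof
        fix \<phi> assume \<phi>: "\<phi> \<in> \<Gamma>0"
        have "sat M (e1 \<circ> h) \<phi> \<longleftrightarrow> sat M e' \<phi>"
          using e1h fvF[OF \<phi>] by (intro sat_cong) simp
        then show "sat M (e1 \<circ> h) \<phi>" using e'(4) \<phi> by blast
      qed
      then have "sat M e1 \<theta>" by (simp add: sat\<theta>)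
      moreover have "\<forall>v\<in>set us. e1 v \<in> univ M"
      proof
        fix k assume "k \<in> set us"
        then obtain v where "v \<in> insert w F" "k = h v" by (auto simp: us)
        then show "e1 k \<in> univ M" using e'(1) e1h by auto
      qed
      moreover have "e1 k = (g(0 := x)) k" if "k \<notin> set us" for k
      proof (cases "k \<in> h ` (insert w F)")
        case True
        then obtain v where v: "v \<in> insert w F" "k = h v" by blast
        show ?thesis
        proof (cases "v = w")
          case True
          have "k = 0" using True v by (simp add: h_def)
          then show ?thesis using True v e'(2) e1h[OF v(1)] by simp
        next
          case False
          then have "v \<in> V" using v that unfolding us by blast
          then have "e' v = e v" using False e'(3) by blast
          moreover have "k \<noteq> 0" using v(2) False by (simp add: h_def)
          ultimately show ?thesis using v hi[OF v(1)] e1h[OF v(1)] by (simp add: g_def)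
        qed
      qed (simp add: e1_def)
      ultimately show "sat M (g(0 := x)) \<psi>"
        unfolding \<psi>_def sat_exs by blast
    qed
    ultimately show ?thesis
      by blast
  qed
  define I where "I = {\<Gamma>0. finite \<Gamma>0 \<and> \<Gamma>0 \<subseteq> \<Gamma>}"
  obtain \<psi> :: "('g, 's, 'v) fm set \<Rightarrow> ('g, 's, nat) fm" and g where \<psi>g: "\<And>\<Gamma>0. \<Gamma>0 \<in> I \<Longrightarrow> \<psi> \<Gamma>0 \<in> formulas L \<and> g \<Gamma>0 ` (fv (\<psi> \<Gamma>0) - {0}) \<subseteq> e ` V \<and>
     (\<forall>x\<in>univ M. sat M ((g \<Gamma>0)(0 := x)) (\<psi> \<Gamma>0) \<longleftrightarrow> good \<Gamma>0 x)"
  proof -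
    have "\<forall>\<Gamma>0\<in>I. \<exists>\<psi>g :: ('g, 's, nat) fm \<times> (nat \<Rightarrow> 'm). fst \<psi>g \<in> formulas L \<and> snd \<psi>g ` (fv (fst \<psi>g) - {0}) \<subseteq> e ` V \<and>
     (\<forall>x\<in>univ M. sat M ((snd \<psi>g)(0 := x)) (fst \<psi>g) \<longleftrightarrow> good \<Gamma>0 x)"
    proof
      fix \<Gamma>0 assume "\<Gamma>0 \<in> I"
      then have "finite \<Gamma>0" "\<Gamma>0 \<subseteq> \<Gamma>" by (simp_all add: I_def)
      from ex[OF this] obtain \<psi> :: "('g, 's, nat) fm" and g where "\<psi> \<in> formulas L \<and> g ` (fv \<psi> - {0}) \<subseteq> e ` V \<and>
        (\<forall>x\<in>univ M. sat M (g(0 := x)) \<psi> \<longleftrightarrow> good \<Gamma>0 x)"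
        by (elim exE)
      then show "\<exists>\<psi>g :: ('g, 's, nat) fm \<times> (nat \<Rightarrow> 'm). fst \<psi>g \<in> formulas L \<and> snd \<psi>g ` (fv (fst \<psi>g) - {0}) \<subseteq> e ` V \<and>
        (\<forall>x\<in>univ M. sat M ((snd \<psi>g)(0 := x)) (fst \<psi>g) \<longleftrightarrow> good \<Gamma>0 x)"
        by (intro exI[of _ "(\<psi>, g)"]) simp
    qed
    from bchoice[OF this] obtain f :: "('g, 's, 'v) fm set \<Rightarrow> ('g, 's, nat) fm \<times> (nat \<Rightarrow> 'm)"
      where "\<forall>\<Gamma>0\<in>I. fst (f \<Gamma>0) \<in> formulas L \<and>
      snd (f \<Gamma>0) ` (fv (fst (f \<Gamma>0)) - {0}) \<subseteq> e ` V \<and>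
     (\<forall>x\<in>univ M. sat M ((snd (f \<Gamma>0))(0 := x)) (fst (f \<Gamma>0)) \<longleftrightarrow> good \<Gamma>0 x)" ..
    then show thesis using that[of "\<lambda>G. fst (f G)" "\<lambda>G. snd (f G)"] by blast
  qed
  define p where "p = (\<lambda>\<Gamma>0. (\<psi> \<Gamma>0, g \<Gamma>0)) ` I"
  have "one_type_over L M (e ` V) p"
    unfolding one_type_over_def
  proof (intro conjI allI impI)
    show "\<forall>(\<phi>, ea)\<in>p. \<phi> \<in> formulas L \<and> ea ` (fv \<phi> - {0}) \<subseteq> e ` V"
      using \<psi>g by (auto simp: p_def)
    fix q assume "finite q \<and> q \<subseteq> p"
    then obtain J where J: "finite J" "J \<subseteq> I" "q = (\<lambda>\<Gamma>0. (\<psi> \<Gamma>0, g \<Gamma>0)) ` J"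
      unfolding p_def by (meson finite_subset_image)
    then have "finite (\<Union>J)" "\<Union>J \<subseteq> \<Gamma>" by (auto simp: I_def)
    from fin[OF this] obtain e' where e': "range e' \<subseteq> univ M" "\<forall>v\<in>V. e' v = e v"
      "\<forall>\<phi>\<in>\<Union>J. sat M e' \<phi>" by (elim exE conjE)
    have "good \<Gamma>0 (e' w)" if "\<Gamma>0 \<in> J" for \<Gamma>0
      unfolding good_def using e' that by (intro exI[of _ e']) auto
    moreover have w: "e' w \<in> univ M" using e'(1) by blast
    ultimately have "sat M ((g \<Gamma>0)(0 := e' w)) (\<psi> \<Gamma>0)" if "\<Gamma>0 \<in> J" for \<Gamma>0
      using \<psi>g[of \<Gamma>0] J(2) that by auto
    then show "\<exists>x\<in>univ M. \<forall>(\<phi>, ea)\<in>q. sat M (ea(0 := x)) \<phi>"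
      using w J(3) by (intro bexI[of _ "e' w"]) auto
  qed
  moreover have "|e ` V| <o \<kappa>"
    using small card_of_image ordLeq_ordLess_trans by blast
  ultimately obtain x where x: "x \<in> univ M" "\<forall>(\<phi>, ea)\<in>p. sat M (ea(0 := x)) \<phi>"
    using sat eV unfolding saturated_def by meson
  then have "good \<Gamma>0 x" if "\<Gamma>0 \<in> I" for \<Gamma>0
    using that \<psi>g by (auto simp: p_def)
  then have "\<forall>\<Gamma>0. finite \<Gamma>0 \<and> \<Gamma>0 \<subseteq> \<Gamma> \<longrightarrow> good \<Gamma>0 x" by (simp add: I_def)
  then show ?thesis
    using x(1) unfolding good_def by (intro bexI[of _ x])
qed

text \<open>Saturation speaks about one-types only; here a maximal partial assignment that keeps
  \<open>\<Gamma>\<close> finitely satisfiable is shown to be total.\<close>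

lemma saturated_realises:
  fixes M :: "('g, 's, 'm) struct" and \<Gamma> :: "('g, 's, 'v) fm set"
  assumes M: "univ M \<noteq> {}" and sat: "saturated \<kappa> L M"
    and wf: "\<Gamma> \<subseteq> formulas L" and fvV: "\<And>\<phi>. \<phi> \<in> \<Gamma> \<Longrightarrow> fv \<phi> \<subseteq> V"
    and small: "|V| <o \<kappa>"
    and fin: "\<And>\<Gamma>0. finite \<Gamma>0 \<Longrightarrow> \<Gamma>0 \<subseteq> \<Gamma> \<Longrightarrow> \<exists>e. range e \<subseteq> univ M \<and> (\<forall>\<phi>\<in>\<Gamma>0. sat M e \<phi>)"
  shows "\<exists>e. range e \<subseteq> univ M \<and> (\<forall>\<phi>\<in>\<Gamma>. sat M e \<phi>)"
proof -
  \<comment> \<open>Partial assignments are sets of pairs, ordered by inclusion for Zorn. At the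
    empty \<open>\<Gamma>0\<close>, \<open>fs\<close> already makes \<open>G\<close> single-valued
    with values in \<open>univ M\<close>.\<close>
  define fs where "fs G \<longleftrightarrow> (\<forall>\<Gamma>0. finite \<Gamma>0 \<and> \<Gamma>0 \<subseteq> \<Gamma> \<longrightarrow>
     (\<exists>e. range e \<subseteq> univ M \<and> (\<forall>v x. (v, x) \<in> G \<longrightarrow> e v = x) \<and> (\<forall>\<phi>\<in>\<Gamma>0. sat M e \<phi>)))" for G :: "('v \<times> 'm) set"
  have fsD: "\<exists>e. range e \<subseteq> univ M \<and> (\<forall>v x. (v, x) \<in> G \<longrightarrow> e v = x) \<and> (\<forall>\<phi>\<in>\<Gamma>0. sat M e \<phi>)"
    if "fs G" "finite \<Gamma>0" "\<Gamma>0 \<subseteq> \<Gamma>" for G \<Gamma>0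
    using that unfolding fs_def by simp
  define P where "P = {G. fs G \<and> Domain G \<subseteq> V}"
  have "\<exists>G\<in>P. \<forall>X\<in>P. G \<subseteq> X \<longrightarrow> X = G"
  proof (rule subset_Zorn_nonempty)
    have "{} \<in> P" using fin by (auto simp: P_def fs_def)
    then show "P \<noteq> {}" by blast
  next
    fix C assume C: "C \<noteq> {}" "subset.chain P C"
    have CP: "C \<subseteq> P" using C by (simp add: subset.chain_def)
    have dom: "Domain (\<Union>C) \<subseteq> V" using CP by (auto simp: P_def)
    have fun_C: "x = y" if xy: "(v, x) \<in> \<Union>C" "(v, y) \<in> \<Union>C" for v x y
    proof -
      obtain X Y where XY: "X \<in> C" "(v, x) \<in> X" "Y \<in> C" "(v, y) \<in> Y"
        using xy by blast
      then have "X \<subseteq> Y \<or> Y \<subseteq> X" using C(2) by (auto simp: subset.chain_def)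
      then obtain G where "G \<in> C" "(v, x) \<in> G" "(v, y) \<in> G"
        using XY by blast
      moreover have "fs G" using \<open>G \<in> C\<close> CP by (auto simp: P_def)
      from fsD[OF this finite.emptyI empty_subsetI] obtain e where "\<forall>v x. (v, x) \<in> G \<longrightarrow> e v = x"
        by (elim exE conjE)
      ultimately show ?thesis by auto
    qed
    have val_C: "x \<in> univ M" if vx: "(v, x) \<in> \<Union>C" for v x
    proof -
      obtain G where "G \<in> C" "(v, x) \<in> G" using vx by blast
      moreover have "fs G" using \<open>G \<in> C\<close> CP by (auto simp: P_def)
      from fsD[OF this finite.emptyI empty_subsetI] obtain e
        where "range e \<subseteq> univ M" "\<forall>v x. (v, x) \<in> G \<longrightarrow> e v = x" by (elim exE conjE)
      ultimately show ?thesis by auto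
    qed
    have "fs (\<Union>C)"
      unfolding fs_def
    proof (intro allI impI)
      fix \<Gamma>0 assume G0: "finite \<Gamma>0 \<and> \<Gamma>0 \<subseteq> \<Gamma>"
      define F where "F = (\<Union>\<phi>\<in>\<Gamma>0. fv \<phi>)"
      have "finite F" using G0 by (auto simp: F_def finite_fv)
      \<comment> \<open>\<open>\<Gamma>0\<close> sees only the finitely many variables in
        \<open>F\<close>, and the finite part of \<open>\<Union>C\<close> above \<open>F\<close>
        lies in a single member of the chain.\<close>
      have "finite {p \<in> \<Union>C. fst p \<in> F}"
      proof (rule finite_imageD)
        show "finite (fst ` {p \<in> \<Union>C. fst p \<in> F})"
          using \<open>finite F\<close> by (rule rev_finite_subset) auto
        show "inj_on fst {p \<in> \<Union>C. fst p \<in> F}"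
          using fun_C by (auto simp: inj_on_def)
      qed
      then obtain G where G: "G \<in> C" "{p \<in> \<Union>C. fst p \<in> F} \<subseteq> G"
        using C finite_subset_Union_chain[of "{p \<in> \<Union>C. fst p \<in> F}" C P] by auto
      then have "fs G" using CP by (auto simp: P_def)
      from fsD[OF this conjunct1[OF G0] conjunct2[OF G0]] obtain e
        where e: "range e \<subseteq> univ M" "\<forall>v x. (v, x) \<in> G \<longrightarrow> e v = x" "\<forall>\<phi>\<in>\<Gamma>0. sat M e \<phi>"
        by (elim exE conjE)
      define e' where "e' v = (if v \<in> Domain (\<Union>C) then (THE x. (v, x) \<in> \<Union>C) else e v)" for v
      have e'C: "e' v = x" if "(v, x) \<in> \<Union>C" for v x
      proof -
        have "(THE x. (v, x) \<in> \<Union>C) = x"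
          using that fun_C by (intro the_equality) blast+
        then show ?thesis using that by (auto simp: e'_def)
      qed
      have "e' v = e v" if "v \<in> F" for v
      proof (cases "v \<in> Domain (\<Union>C)")
        case True
        then obtain x where x: "(v, x) \<in> \<Union>C" by blast
        then have "(v, x) \<in> G" using G(2) that by auto
        then show ?thesis using e(2) e'C[OF x] by auto
      qed (simp add: e'_def)
      then have "sat M e' \<phi> \<longleftrightarrow> sat M e \<phi>" if "\<phi> \<in> \<Gamma>0" for \<phi>
        using that by (intro sat_cong) (auto simp: F_def)
      moreover have "e' v \<in> univ M" for v
      proof (cases "v \<in> Domain (\<Union>C)")
        case True
        then obtain x where x: "(v, x) \<in> \<Union>C" by blast
        then show ?thesis using e'C val_C by metis
      next
        case False
        then show ?thesis using e(1) by (auto simp: e'_def)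
      qed
      ultimately show "\<exists>e. range e \<subseteq> univ M \<and> (\<forall>v x. (v, x) \<in> \<Union>C \<longrightarrow> e v = x) \<and> (\<forall>\<phi>\<in>\<Gamma>0. sat M e \<phi>)"
        using e(3) e'C by (intro exI[of _ e']) auto
    qed
    then show "\<Union>C \<in> P" using dom by (simp add: P_def)
  qed
  then obtain G where G: "fs G" "Domain G \<subseteq> V" and max: "\<And>X. X \<in> P \<Longrightarrow> G \<subseteq> X \<Longrightarrow> X = G"
    by (auto simp: P_def)
  obtain e0 where e0: "range e0 \<subseteq> univ M" "\<forall>v x. (v, x) \<in> G \<longrightarrow> e0 v = x"
    using fsD[OF G(1) finite.emptyI empty_subsetI] by (elim exE conjE)
  have "V \<subseteq> Domain G"
  proof
    fix w assume w: "w \<in> V"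
    have "\<exists>x\<in>univ M. \<forall>\<Gamma>0. finite \<Gamma>0 \<and> \<Gamma>0 \<subseteq> \<Gamma> \<longrightarrow>
      (\<exists>e'. range e' \<subseteq> univ M \<and> e' w = x \<and> (\<forall>v\<in>Domain G-{w}. e' v = e0 v) \<and> (\<forall>\<phi>\<in>\<Gamma>0. sat M e' \<phi>))"
    proof (rule saturated_realises_one[OF M sat wf])
      show "|Domain G| <o \<kappa>" using small G(2) card_of_mono1 ordLeq_ordLess_trans by blast
      show "e0 ` Domain G \<subseteq> univ M" using e0 by blast
      fix \<Gamma>0 assume "finite \<Gamma>0" "\<Gamma>0 \<subseteq> \<Gamma>"
      from fsD[OF G(1) this] obtain e where "range e \<subseteq> univ M" "\<forall>v x. (v, x) \<in> G \<longrightarrow> e v = x"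
        "\<forall>\<phi>\<in>\<Gamma>0. sat M e \<phi>" by (elim exE conjE)
      moreover then have "\<forall>v\<in>Domain G. e v = e0 v" using e0(2) by auto
      ultimately show "\<exists>e'. range e' \<subseteq> univ M \<and> (\<forall>v\<in>Domain G. e' v = e0 v) \<and> (\<forall>\<phi>\<in>\<Gamma>0. sat M e' \<phi>)"
        by blast
    qed
    then obtain x where x: "\<forall>\<Gamma>0. finite \<Gamma>0 \<and> \<Gamma>0 \<subseteq> \<Gamma> \<longrightarrow>
      (\<exists>e'. range e' \<subseteq> univ M \<and> e' w = x \<and> (\<forall>v\<in>Domain G-{w}. e' v = e0 v) \<and> (\<forall>\<phi>\<in>\<Gamma>0. sat M e' \<phi>))"
      by (elim bexE)
    show "w \<in> Domain G"
    proof (rule ccontr)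
      assume nw: "w \<notin> Domain G"
      have "fs (insert (w, x) G)"
        unfolding fs_def
      proof (intro allI impI)
        fix \<Gamma>0 assume "finite \<Gamma>0 \<and> \<Gamma>0 \<subseteq> \<Gamma>"
        from x[rule_format, OF this] obtain e' where e': "range e' \<subseteq> univ M" "e' w = x"
          "\<forall>v\<in>Domain G-{w}. e' v = e0 v" "\<forall>\<phi>\<in>\<Gamma>0. sat M e' \<phi>" by (elim exE conjE)
        have "e' v = y" if "(v, y) \<in> G" for v y
        proof -
          have "v \<in> Domain G - {w}" using that nw by blast
          then have "e' v = e0 v" using e'(3) by blast
          then show ?thesis using that e0(2) by auto
        qed
        then show "\<exists>e. range e \<subseteq> univ M \<and> (\<forall>v y. (v, y) \<in> insert (w, x) G \<longrightarrow> e v = y) \<and> (\<forall>\<phi>\<in>\<Gamma>0. sat M e \<phi>)"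
          using e' by (intro exI[of _ e']) auto
      qed
      then have "insert (w, x) G = G" using G(2) w by (intro max) (auto simp: P_def)
      then show False using nw by blast
    qed
  qed
  have "sat M e0 \<phi>" if "\<phi> \<in> \<Gamma>" for \<phi>
  proof -
    have "finite {\<phi>}" "{\<phi>} \<subseteq> \<Gamma>" using that by simp_all
    from fsD[OF G(1) this] obtain e where e: "\<forall>v x. (v, x) \<in> G \<longrightarrow> e v = x" "sat M e \<phi>"
      by auto
    have "e0 v = e v" if "v \<in> fv \<phi>" for v
    proof -
      obtain x where "(v, x) \<in> G"
        using \<open>v \<in> fv \<phi>\<close> fvV[OF \<open>\<phi> \<in> \<Gamma>\<close>] \<open>V \<subseteq> Domain G\<close> by blast
      then show ?thesis using e(1) e0(2) by auto
    qed
    then have "sat M e0 \<phi> \<longleftrightarrow> sat M e \<phi>" by (rule sat_cong)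
    then show ?thesis using e(2) by simp
  qed
  then show ?thesis using e0 by blast
qed

section \<open>Embeddings and ages\<close>

lemma embeddingD:
  assumes "embedding L A B h"
  shows "x \<in> univ A \<Longrightarrow> h x \<in> univ B" "inj_on h (univ A)"
    "f \<in> funs L \<Longrightarrow> set xs \<subseteq> univ A \<Longrightarrow> length xs = farity L f \<Longrightarrow> h (fint A f xs) = fint B f (map h xs)"
    "r \<in> rels L \<Longrightarrow> set xs \<subseteq> univ A \<Longrightarrow> length xs = rarity L r \<Longrightarrow> rint A r xs = rint B r (map h xs)"
  using assms unfolding embedding_def by auto

lemma is_structD:
  assumes "is_struct L A"
  shows "univ A \<noteq> {}"
    "f \<in> funs L \<Longrightarrow> set xs \<subseteq> univ A \<Longrightarrow> length xs = farity L f \<Longrightarrow> fint A f xs \<in> univ A"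
  using assms unfolding is_struct_def by auto

lemma embedding_comp:
  assumes g: "embedding L A B g" and h: "embedding L B C h"
  shows "embedding L A C (h \<circ> g)"
  unfolding embedding_def
proof (intro conjI ballI allI impI)
  show "(h \<circ> g) ` univ A \<subseteq> univ C" using embeddingD(1)[OF g] embeddingD(1)[OF h] by auto
  have "inj_on h (g ` univ A)"
    using embeddingD(2)[OF h] embeddingD(1)[OF g] by (auto intro: inj_on_subset)
  then show "inj_on (h \<circ> g) (univ A)" using embeddingD(2)[OF g] by (simp add: comp_inj_on)
  have gB: "set (map g xs) \<subseteq> univ B" if "set xs \<subseteq> univ A" for xs
    using that embeddingD(1)[OF g] by auto
  show "(h \<circ> g) (fint A f xs) = fint C f (map (h \<circ> g) xs)"
    if "f \<in> funs L" "set xs \<subseteq> univ A \<and> length xs = farity L f" for f xs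
    using that gB embeddingD(3)[OF g, of f xs] embeddingD(3)[OF h, of f "map g xs"] by simp
  show "rint A r xs = rint C r (map (h \<circ> g) xs)"
    if "r \<in> rels L" "set xs \<subseteq> univ A \<and> length xs = rarity L r" for r xs
    using that gB embeddingD(4)[OF g, of r xs] embeddingD(4)[OF h, of r "map g xs"] by simp
qed

lemma embedding_cong:
  assumes A: "is_struct L A" and h: "embedding L A B h" and eq: "\<And>x. x \<in> univ A \<Longrightarrow> h' x = h x"
  shows "embedding L A B h'"
  unfolding embedding_def
proof (intro conjI ballI allI impI)
  show "h' ` univ A \<subseteq> univ B" using embeddingD(1)[OF h] eq by auto
  show "inj_on h' (univ A)" using embeddingD(2)[OF h] eq by (simp add: inj_on_def)
  have m: "map h' xs = map h xs" if "set xs \<subseteq> univ A" for xs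
    using that eq by auto
  show "h' (fint A f xs) = fint B f (map h' xs)"
    if "f \<in> funs L" "set xs \<subseteq> univ A \<and> length xs = farity L f" for f xs
    using that embeddingD(3)[OF h, of f xs] is_structD(2)[OF A, of f xs] by (simp add: eq m)
  show "rint A r xs = rint B r (map h' xs)"
    if "r \<in> rels L" "set xs \<subseteq> univ A \<and> length xs = rarity L r" for r xs
    using that embeddingD(4)[OF h, of r xs] by (simp add: m)
qed

lemma embedding_the_inv_into:
  assumes A: "is_struct L A" and h: "embedding L A B h" and surj: "h ` univ A = univ B"
  shows "embedding L B A (the_inv_into (univ A) h)"
    and "the_inv_into (univ A) h ` univ B = univ A"
proof -
  let ?k = "the_inv_into (univ A) h"
  have inj: "inj_on h (univ A)" using embeddingD(2)[OF h] .
  have kh: "?k (h x) = x" if "x \<in> univ A" for x using the_inv_into_f_f[OF inj that] .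
  have hk: "h (?k y) = y" "?k y \<in> univ A" if "y \<in> univ B" for y
    using that kh unfolding surj[symmetric] by auto
  show im: "?k ` univ B = univ A" unfolding surj[symmetric] image_image by (simp add: kh)
  have m: "map h (map ?k xs) = xs" if "set xs \<subseteq> univ B" for xs
    using that hk(1) by (induction xs) auto
  have s: "set (map ?k xs) \<subseteq> univ A" if "set xs \<subseteq> univ B" for xs
    using that hk(2) by auto
  show "embedding L B A ?k"
    unfolding embedding_def
  proof (intro conjI ballI allI impI)
    show "?k ` univ B \<subseteq> univ A" using im by simp
    show "inj_on ?k (univ B)" using hk(1) by (metis inj_onI)
    show "?k (fint B f xs) = fint A f (map ?k xs)"
      if "f \<in> funs L" "set xs \<subseteq> univ B \<and> length xs = farity L f" for f xs
    proof -
      have xs: "set xs \<subseteq> univ B" using that by simp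
      have "h (fint A f (map ?k xs)) = fint B f xs"
        using that embeddingD(3)[OF h, of f "map ?k xs"] s[OF xs] by (simp only: m[OF xs] length_map)
      moreover have "fint A f (map ?k xs) \<in> univ A"
        using that is_structD(2)[OF A, of f "map ?k xs"] s[of xs] by simp
      ultimately show ?thesis using kh by metis
    qed
    show "rint B r xs = rint A r (map ?k xs)"
      if "r \<in> rels L" "set xs \<subseteq> univ B \<and> length xs = rarity L r" for r xs
    proof -
      have xs: "set xs \<subseteq> univ B" using that by simp
      show ?thesis
        using that embeddingD(4)[OF h, of r "map ?k xs"] s[OF xs] by (simp only: m[OF xs] length_map)
    qed
  qed
qed

lemma embedding_substructure: "substructure L A B \<Longrightarrow> embedding L A B (\<lambda>x. x)"
  unfolding substructure_def embedding_def by auto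

lemma substructure_restrict:
  "is_struct L N \<Longrightarrow> is_struct L (N\<lparr>univ := S\<rparr>) \<Longrightarrow> S \<subseteq> univ N \<Longrightarrow> substructure L (N\<lparr>univ := S\<rparr>) N"
  unfolding substructure_def by auto

lemma embedding_restrict_codomain:
  "embedding L A N h \<Longrightarrow> h ` univ A \<subseteq> S \<Longrightarrow> embedding L A (N\<lparr>univ := S\<rparr>) h"
  unfolding embedding_def by auto

lemma embedding_into_substructure:
  assumes B: "substructure L B N" and h: "embedding L A N h" "h ` univ A \<subseteq> univ B"
  shows "embedding L A B h"
  unfolding embedding_def
proof (intro conjI ballI allI impI)
  show "h ` univ A \<subseteq> univ B" by fact
  show "inj_on h (univ A)" using embeddingD(2)[OF h(1)] .
  have s: "set (map h xs) \<subseteq> univ B" if "set xs \<subseteq> univ A" for xs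
    using that h(2) by auto
  show "h (fint A f xs) = fint B f (map h xs)"
    if "f \<in> funs L" "set xs \<subseteq> univ A \<and> length xs = farity L f" for f xs
  proof -
    have "fint B f (map h xs) = fint N f (map h xs)"
      using that s[of xs] B unfolding substructure_def by simp
    then show ?thesis using that embeddingD(3)[OF h(1), of f xs] by simp
  qed
  show "rint A r xs = rint B r (map h xs)"
    if "r \<in> rels L" "set xs \<subseteq> univ A \<and> length xs = rarity L r" for r xs
  proof -
    have "rint B r (map h xs) = rint N r (map h xs)"
      using that s[of xs] B unfolding substructure_def by simp
    then show ?thesis using that embeddingD(4)[OF h(1), of r xs] by simp
  qed
qed

lemma is_struct_image:
  assumes A: "is_struct L A" and h: "embedding L A N h"
  shows "is_struct L (N\<lparr>univ := h ` univ A\<rparr>)"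
  unfolding is_struct_def
proof (intro conjI ballI allI impI)
  show "univ (N\<lparr>univ := h ` univ A\<rparr>) \<noteq> {}" using is_structD(1)[OF A] by simp
  fix f xs assume f: "f \<in> funs L"
    and "set xs \<subseteq> univ (N\<lparr>univ := h ` univ A\<rparr>) \<and> length xs = farity L f"
  then have xs: "set xs \<subseteq> h ` univ A" "length xs = farity L f" by simp_all
  have "xs \<in> lists (h ` univ A)" using xs(1) by auto
  then obtain ys where ys: "set ys \<subseteq> univ A" "xs = map h ys"
    unfolding lists_image by auto
  have "fint N f xs = h (fint A f ys)"
    using embeddingD(3)[OF h f ys(1)] xs ys by simp
  moreover have "fint A f ys \<in> univ A" using is_structD(2)[OF A f ys(1)] xs ys by simp
  ultimately show "fint (N\<lparr>univ := h ` univ A\<rparr>) f xs \<in> univ (N\<lparr>univ := h ` univ A\<rparr>)" by simp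
qed

lemma generated_subset:
  assumes "is_struct L N" "S \<subseteq> univ N"
  shows "generated L N S \<subseteq> univ N"
proof
  fix x assume "x \<in> generated L N S"
  then show "x \<in> univ N"
  proof induction
    case (step f xs)
    then show ?case using is_structD(2)[OF assms(1), of f xs] by auto
  qed (use assms in auto)
qed

lemma is_struct_generated:
  assumes "S \<noteq> {}"
  shows "is_struct L (N\<lparr>univ := generated L N S\<rparr>)"
  using assms unfolding is_struct_def by (auto intro: generated.intros)

lemma generated_least:
  assumes B: "substructure L B N" and "S \<subseteq> univ B"
  shows "generated L N S \<subseteq> univ B"
proof
  fix x assume "x \<in> generated L N S"
  then show "x \<in> univ B"
  proof induction
    case (step f xs)
    then have s: "set xs \<subseteq> univ B" by auto
    then have "fint N f xs = fint B f xs" using step B unfolding substructure_def by simp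
    moreover have "is_struct L B" using B unfolding substructure_def by simp
    ultimately show ?case using is_structD(2)[of L B f xs] s step by simp
  qed (use assms in auto)
qed

text \<open>Elements generated inside \<open>B\<close> are generated inside \<open>N\<close> by the
  same finite set, so local finiteness makes finitely generated substructures finite. Conversely, a
  finite image of an embedding is generated by itself. Ages are used below in this form.\<close>

lemma Age_iff:
  assumes N: "is_struct L N" and lf: "locally_finite L N"
  shows "A \<in> Age L N \<longleftrightarrow> is_struct L A \<and> finite (univ A) \<and> (\<exists>h. embedding L A N h)"
proof
  assume "A \<in> Age L N"
  then obtain B h where A: "is_struct L A" and B: "substructure L B N" "finitely_generated L B"
    and h: "embedding L A B h" "h ` univ A = univ B"
    unfolding Age_def isomorphic_def by auto
  obtain S where S: "finite S" "S \<subseteq> univ B" "generated L B S = univ B"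
    using B(2) unfolding finitely_generated_def by auto
  have BN: "univ B \<subseteq> univ N" using B(1) unfolding substructure_def by simp
  have "univ B \<subseteq> generated L N S"
  proof
    fix x assume "x \<in> univ B"
    then have "x \<in> generated L B S" using S by simp
    then show "x \<in> generated L N S"
    proof induction
      case (step f xs)
      have "generated L B S \<subseteq> univ B" using S by simp
      then have "set xs \<subseteq> univ B" using step by auto
      then have "fint B f xs = fint N f xs" using step B(1) unfolding substructure_def by simp
      then show ?case using generated.step[of f L xs N S] step by auto
    qed (rule generated.base)
  qed
  then have "finite (univ B)"
    using lf S BN unfolding locally_finite_def by (meson finite_subset subset_trans)
  then have "finite (univ A)" using h embeddingD(2)[OF h(1)] by (metis finite_imageD)
  moreover have "embedding L A N ((\<lambda>x. x) \<circ> h)"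
    by (rule embedding_comp[OF h(1) embedding_substructure[OF B(1)]])
  ultimately show "is_struct L A \<and> finite (univ A) \<and> (\<exists>h. embedding L A N h)" using A by blast
next
  assume "is_struct L A \<and> finite (univ A) \<and> (\<exists>h. embedding L A N h)"
  then obtain h where A: "is_struct L A" "finite (univ A)" and h: "embedding L A N h" by auto
  let ?B = "N\<lparr>univ := h ` univ A\<rparr>"
  have B: "is_struct L ?B" by (rule is_struct_image[OF A(1) h])
  have "h ` univ A \<subseteq> univ N" using embeddingD(1)[OF h] by auto
  then have sub: "substructure L ?B N" by (rule substructure_restrict[OF N B])
  have "generated L ?B (univ ?B) = univ ?B"
    using generated_subset[OF B subset_refl] by (auto intro: generated.base)
  then have "finitely_generated L ?B"
    unfolding finitely_generated_def using A(2) by (intro exI[of _ "univ ?B"]) simp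
  moreover have "isomorphic L A ?B"
    unfolding isomorphic_def using embedding_restrict_codomain[OF h subset_refl]
    by (intro exI[of _ h]) simp
  ultimately show "A \<in> Age L N" unfolding Age_def using A sub by auto
qed

text \<open>Passage from substructures of \<open>N\<close> to members of the age, which live on
  another type: an infinite type has room for every finite structure.\<close>

lemma finite_struct_copy:
  fixes B :: "('f, 'r, 'i) struct"
  assumes B: "is_struct L B" "finite (univ B)"
  obtains B' :: "('f, 'r, 'c::infinite) struct" and k
  where "is_struct L B'" "embedding L B B' k" "k ` univ B = univ B'"
proof -
  obtain K :: "'c set" where K: "finite K" "card K = card (univ B)"
    using infinite_arbitrarily_large[OF infinite_UNIV] by blast
  then obtain k where k: "bij_betw k (univ B) K"
    using B(2) finite_same_card_bij by metis
  let ?ki = "the_inv_into (univ B) k"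
  have ki: "?ki (k x) = x" if "x \<in> univ B" for x
    using k that by (simp add: bij_betw_def the_inv_into_f_f)
  have mk: "map (?ki \<circ> k) xs = xs" if "set xs \<subseteq> univ B" for xs
    using that ki by (induction xs) auto
  define B' :: "('f, 'r, 'c) struct" where
    "B' = \<lparr>univ = K, fint = \<lambda>f xs. k (fint B f (map ?ki xs)), rint = \<lambda>r xs. rint B r (map ?ki xs)\<rparr>"
  have emb: "embedding L B B' k"
    using k by (auto simp: embedding_def B'_def bij_betw_def mk)
  have im: "k ` univ B = univ B'" using k by (simp add: B'_def bij_betw_def)
  have "is_struct L (B'\<lparr>univ := k ` univ B\<rparr>)" by (rule is_struct_image[OF B(1) emb])
  then have "is_struct L B'" using im by simp
  then show thesis using that emb im by blast
qed

lemma compose_embs: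
  assumes A: "is_struct L A" and f: "f \<in> embs L A B" and e: "embedding L B C e"
  shows "compose (univ A) e f \<in> embs L A C"
proof -
  have "embedding L A C (compose (univ A) e f)"
    using f by (intro embedding_cong[OF A embedding_comp[OF _ e, of A f]])
      (auto simp: embs_def compose_def)
  then show ?thesis by (simp add: embs_def)
qed

lemma restrict_embs:
  assumes "is_struct L A" "embedding L A B h"
  shows "restrict h (univ A) \<in> embs L A B"
  using embedding_cong[OF assms, of "restrict h (univ A)"] by (simp add: embs_def)

text \<open>A colouring on the side of \<open>A'\<close> and \<open>C'\<close> is pulled back along
  \<open>a\<close> and \<open>c\<close>, and a homogeneous \<open>e\<close> is carried to
  \<open>c \<circ> e \<circ> b\<close>. The map \<open>a\<close> must be onto: an embedding of
  \<open>A'\<close> into \<open>B'\<close> becomes one of \<open>A\<close> into \<open>B\<close>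
  through the inverse of \<open>a\<close>.\<close>

lemma ramsey_arrow_transfer:
  fixes A :: "('f, 'r, 'a) struct" and A' :: "('f, 'r, 'a') struct"
  assumes arrow: "ramsey_arrow L C B A"
    and str: "is_struct L A" "is_struct L B" "is_struct L A'" "is_struct L B'"
    and a: "embedding L A' A a" "a ` univ A' = univ A"
    and b: "embedding L B' B b" and c: "embedding L C C' c"
  shows "ramsey_arrow L C' B' A'"
  unfolding ramsey_arrow_def
proof (intro allI impI)
  fix \<chi> :: "('a' \<Rightarrow> _) \<Rightarrow> nat" assume \<chi>: "\<chi> ` embs L A' C' \<subseteq> {0, 1}"
  define \<xi> where "\<xi> f = \<chi> (restrict (c \<circ> f \<circ> a) (univ A'))" for f
  have "\<xi> ` embs L A C \<subseteq> {0, 1}"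
  proof (rule image_subsetI)
    fix f assume "f \<in> embs L A C"
    then have "embedding L A C f" by (simp add: embs_def)
    then have "embedding L A' C' (c \<circ> f \<circ> a)"
      using a(1) c by (intro embedding_comp) (auto intro: embedding_comp)
    then have "restrict (c \<circ> f \<circ> a) (univ A') \<in> embs L A' C'" by (rule restrict_embs[OF str(3)])
    then show "\<xi> f \<in> {0, 1}" using \<chi> unfolding \<xi>_def by blast
  qed
  then obtain e d where e: "e \<in> embs L B C" and d: "\<forall>f\<in>embs L A B. \<xi> (compose (univ A) e f) = d"
    using arrow unfolding ramsey_arrow_def by blast
  define e' where "e' = restrict (c \<circ> e \<circ> b) (univ B')"
  have "embedding L B C e" using e by (simp add: embs_def)
  then have "embedding L B' C' (c \<circ> e \<circ> b)"
    using b c by (intro embedding_comp) (auto intro: embedding_comp)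
  then have e': "e' \<in> embs L B' C'" unfolding e'_def by (rule restrict_embs[OF str(4)])
  have "\<chi> (compose (univ A') e' f') = d" if f': "f' \<in> embs L A' B'" for f'
  proof -
    let ?ai = "the_inv_into (univ A') a"
    define f where "f = restrict (b \<circ> f' \<circ> ?ai) (univ A)"
    have f'e: "embedding L A' B' f'" using f' by (simp add: embs_def)
    have ai: "embedding L A A' ?ai" by (rule embedding_the_inv_into(1)[OF str(3) a])
    have "embedding L A B (b \<circ> f' \<circ> ?ai)"
      using f'e ai b by (intro embedding_comp) (auto intro: embedding_comp)
    then have "f \<in> embs L A B" unfolding f_def by (rule restrict_embs[OF str(1)])
    then have "\<xi> (compose (univ A) e f) = d" using d by blast
    moreover have "restrict (c \<circ> compose (univ A) e f \<circ> a) (univ A') = compose (univ A') e' f'"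
    proof
      fix x
      show "restrict (c \<circ> compose (univ A) e f \<circ> a) (univ A') x = compose (univ A') e' f' x"
      proof (cases "x \<in> univ A'")
        case True
        have "a x \<in> univ A" using True a(2) by auto
        moreover have "f' x \<in> univ B'" using embeddingD(1)[OF f'e True] .
        moreover have "?ai (a x) = x" using the_inv_into_f_f[OF embeddingD(2)[OF a(1)] True] .
        ultimately show ?thesis using True by (simp add: compose_def e'_def f_def)
      qed (simp add: compose_def)
    qed
    ultimately show ?thesis unfolding \<xi>_def by simp
  qed
  then show "\<exists>e\<in>embs L B' C'. \<exists>c. \<forall>f\<in>embs L A' B'. \<chi> (compose (univ A') e f) = c"
    using e' by blast
qed

section \<open>Quantifier-free types\<close>

lemma eval_tm_embedding:
  assumes A: "is_struct L A" and h: "embedding L A B h"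
  shows "wf_tm L t \<Longrightarrow> e ` fv_tm t \<subseteq> univ A \<Longrightarrow>
    eval_tm A e t \<in> univ A \<and> eval_tm B (\<lambda>v. h (e v)) t = h (eval_tm A e t)"
proof (induction t)
  case (Fn f ts)
  have IH: "eval_tm A e t \<in> univ A \<and> eval_tm B (\<lambda>v. h (e v)) t = h (eval_tm A e t)" if "t \<in> set ts" for t
    using Fn.prems that by (intro Fn.IH) auto
  have s: "set (map (eval_tm A e) ts) \<subseteq> univ A" using IH by auto
  have l: "length (map (eval_tm A e) ts) = farity L f" "f \<in> funs L" using Fn.prems by auto
  have m: "map (eval_tm B (\<lambda>v. h (e v))) ts = map h (map (eval_tm A e) ts)" using IH by simp
  show ?case
    using is_structD(2)[OF A l(2) s l(1)] embeddingD(3)[OF h l(2) s l(1)]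
    by (simp only: eval_tm.simps m)
qed simp

lemma sat_qfree_embedding:
  assumes A: "is_struct L A" and h: "embedding L A B h"
  shows "wf_fm L \<phi> \<Longrightarrow> qfree \<phi> \<Longrightarrow> e ` fv \<phi> \<subseteq> univ A \<Longrightarrow> sat B (\<lambda>v. h (e v)) \<phi> \<longleftrightarrow> sat A e \<phi>"
proof (induction \<phi>)
  case (Eq s t)
  have "e ` fv_tm s \<subseteq> univ A" "e ` fv_tm t \<subseteq> univ A" using Eq.prems(3) by auto
  then show ?case
    using Eq.prems(1) eval_tm_embedding[OF A h, of s e] eval_tm_embedding[OF A h, of t e]
      embeddingD(2)[OF h] by (auto simp: inj_on_def)
next
  case (Rel r ts)
  have IH: "eval_tm A e t \<in> univ A \<and> eval_tm B (\<lambda>v. h (e v)) t = h (eval_tm A e t)" if "t \<in> set ts" for t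
    using eval_tm_embedding[OF A h, of t e] Rel.prems that by auto
  have s: "set (map (eval_tm A e) ts) \<subseteq> univ A" using IH by auto
  have l: "length (map (eval_tm A e) ts) = rarity L r" "r \<in> rels L" using Rel.prems by auto
  have m: "map (eval_tm B (\<lambda>v. h (e v))) ts = map h (map (eval_tm A e) ts)" using IH by simp
  show ?case
    using embeddingD(4)[OF h l(2) s l(1)] by (simp only: sat.simps m)
next
  case (Conj \<phi> \<psi>)
  have "e ` fv \<phi> \<subseteq> univ A" "e ` fv \<psi> \<subseteq> univ A" using Conj.prems(3) by auto
  then show ?case using Conj by simp
qed simp_all

lemma qftp_embedding:
  assumes A: "is_struct L A" and h: "embedding L A B h" and xs: "set xs \<subseteq> univ A"
  shows "qftp L B (map h xs) = qftp L A xs"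
proof -
  have "sat B (\<lambda>k. map h xs ! k) \<phi> \<longleftrightarrow> sat A (\<lambda>k. xs ! k) \<phi>"
    if "wf_fm L \<phi>" "qfree \<phi>" "fv \<phi> \<subseteq> {..<length xs}" for \<phi>
  proof -
    have "sat B (\<lambda>k. map h xs ! k) \<phi> \<longleftrightarrow> sat B (\<lambda>k. h (xs ! k)) \<phi>"
    proof (rule sat_cong)
      fix v assume "v \<in> fv \<phi>"
      then have "v < length xs" using that(3) by auto
      then show "map h xs ! v = h (xs ! v)" by simp
    qed
    moreover have "xs ! v \<in> univ A" if "v \<in> fv \<phi>" for v
    proof -
      have "v < length xs" using that \<open>fv \<phi> \<subseteq> {..<length xs}\<close> by auto
      then show ?thesis using xs nth_mem by blast
    qed
    then have "(\<lambda>k. xs ! k) ` fv \<phi> \<subseteq> univ A" by blast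
    ultimately show ?thesis using sat_qfree_embedding[OF A h that(1,2)] by simp
  qed
  then show ?thesis unfolding qftp_def tp_def formulas_def by auto
qed

lemma qftp_substructure:
  "substructure L B N \<Longrightarrow> set xs \<subseteq> univ B \<Longrightarrow> qftp L N xs = qftp L B xs"
  using qftp_embedding[of L B N "\<lambda>x. x" xs] embedding_substructure[of L B N]
  by (simp add: substructure_def)

lemma generated_eval_tm:
  assumes "x \<in> generated L N (set xs)"
  shows "\<exists>t. wf_tm L t \<and> fv_tm t \<subseteq> {..<length xs} \<and> eval_tm N (\<lambda>k. xs ! k) t = x"
  using assms
proof induction
  case (base x)
  then obtain k where "k < length xs" "xs ! k = x" by (auto simp: in_set_conv_nth)
  then show ?case by (intro exI[of _ "Var k"]) simp
next
  case (step f ys)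
  then have "\<forall>y\<in>set ys. \<exists>t. wf_tm L t \<and> fv_tm t \<subseteq> {..<length xs} \<and> eval_tm N (\<lambda>k. xs ! k) t = y"
    by blast
  from bchoice[OF this] obtain t where
    t: "\<forall>y\<in>set ys. wf_tm L (t y) \<and> fv_tm (t y) \<subseteq> {..<length xs} \<and> eval_tm N (\<lambda>k. xs ! k) (t y) = y" ..
  have "map (eval_tm N (\<lambda>k. xs ! k) \<circ> t) ys = ys"
    using t by (induction ys) auto
  then show ?case
    using step t by (intro exI[of _ "Fn f (map t ys)"]) auto
qed

lemma eval_tm_generated:
  "wf_tm L t \<Longrightarrow> fv_tm t \<subseteq> {..<length xs} \<Longrightarrow> eval_tm N (\<lambda>k. xs ! k) t \<in> generated L N (set xs)"
proof (induction t)
  case (Fn f ts)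
  then have "\<forall>x\<in>set (map (eval_tm N (\<lambda>k. xs ! k)) ts). x \<in> generated L N (set xs)" by auto
  then have "fint N f (map (eval_tm N (\<lambda>k. xs ! k)) ts) \<in> generated L N (set xs)"
    using Fn.prems by (intro generated.step) simp_all
  then show ?case by simp
qed (auto intro: generated.base)

text \<open>The embedding sends the value of a term at \<open>xs\<close> to its value at \<open>ys\<close>.\<close>

lemma qftp_eq_embedding:
  assumes N: "is_struct L N" and ys: "set ys \<subseteq> univ N"
    and len: "length ys = length xs" and eq: "qftp L N xs = qftp L N ys"
  obtains f where "embedding L (N\<lparr>univ := generated L N (set xs)\<rparr>) N f" "map f xs = ys"
    "f ` generated L N (set xs) \<subseteq> generated L N (set ys)"
proof -
  let ?G = "generated L N (set xs)"
  let ?X = "\<lambda>k. xs ! k" and ?Y = "\<lambda>k. ys ! k"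
  have tr: "sat N ?X \<phi> \<longleftrightarrow> sat N ?Y \<phi>" if "wf_fm L \<phi>" "qfree \<phi>" "fv \<phi> \<subseteq> {..<length xs}" for \<phi>
  proof -
    have "\<phi> \<in> qftp L N xs \<longleftrightarrow> sat N ?X \<phi>" "\<phi> \<in> qftp L N ys \<longleftrightarrow> sat N ?Y \<phi>"
      using that len by (simp_all add: qftp_def tp_def formulas_def)
    then show ?thesis using eq by simp
  qed
  define ok where "ok t \<longleftrightarrow> wf_tm L t \<and> fv_tm t \<subseteq> {..<length xs}" for t
  have treq: "eval_tm N ?X s = eval_tm N ?X t \<longleftrightarrow> eval_tm N ?Y s = eval_tm N ?Y t"
    if "ok s" "ok t" for s t
    using tr[of "Eq s t"] that by (simp add: ok_def)
  have trrel: "rint N r (map (eval_tm N ?X) ts) \<longleftrightarrow> rint N r (map (eval_tm N ?Y) ts)"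
    if "r \<in> rels L" "length ts = rarity L r" "\<forall>t\<in>set ts. ok t" for r ts
  proof -
    have "fv (Rel r ts :: (_, _, nat) fm) \<subseteq> {..<length xs}" using that by (auto simp: ok_def)
    then show ?thesis using tr[of "Rel r ts"] that by (simp add: ok_def)
  qed
  have "\<forall>x\<in>?G. \<exists>t. ok t \<and> eval_tm N ?X t = x"
  proof
    fix x assume "x \<in> ?G"
    from generated_eval_tm[OF this] show "\<exists>t. ok t \<and> eval_tm N ?X t = x"
      by (auto simp: ok_def)
  qed
  from bchoice[OF this] obtain T where T0: "\<forall>x\<in>?G. ok (T x) \<and> eval_tm N ?X (T x) = x" ..
  have T: "ok (T x)" "eval_tm N ?X (T x) = x" if "x \<in> ?G" for x
    using T0 that by simp_all
  define f where "f x = eval_tm N ?Y (T x)" for x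
  \<comment> \<open>The choice of \<open>T\<close> does not matter: that two terms agree at
    \<open>xs\<close> is a quantifier-free fact, hence shared by \<open>ys\<close>.\<close>
  have fe: "f (eval_tm N ?X t) = eval_tm N ?Y t" if "ok t" for t
  proof -
    have g: "eval_tm N ?X t \<in> ?G" using that eval_tm_generated unfolding ok_def by blast
    show ?thesis unfolding f_def using treq[OF T(1)[OF g] that] T(2)[OF g] by simp
  qed
  have mX: "map (eval_tm N ?X) (map T zs) = zs" if "set zs \<subseteq> ?G" for zs
    using that T(2) by (induction zs) auto
  have mY: "map (eval_tm N ?Y) (map T zs) = map f zs" for zs
    by (simp add: f_def)
  have im: "f ` ?G \<subseteq> generated L N (set ys)"
    using T(1) eval_tm_generated[of L _ ys N] len by (auto simp: f_def ok_def)
  have "embedding L (N\<lparr>univ := ?G\<rparr>) N f"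
    unfolding embedding_def
  proof (intro conjI ballI allI impI)
    show "f ` univ (N\<lparr>univ := ?G\<rparr>) \<subseteq> univ N"
      using im generated_subset[OF N ys] by auto
    show "inj_on f (univ (N\<lparr>univ := ?G\<rparr>))"
    proof (rule inj_onI)
      fix x y assume "x \<in> univ (N\<lparr>univ := ?G\<rparr>)" "y \<in> univ (N\<lparr>univ := ?G\<rparr>)" and e: "f x = f y"
      then have "x \<in> ?G" "y \<in> ?G" by simp_all
      then show "x = y" using treq[OF T(1) T(1), of x y] e T(2) by (simp add: f_def)
    qed
    fix g zs assume g: "g \<in> funs L" and "set zs \<subseteq> univ (N\<lparr>univ := ?G\<rparr>) \<and> length zs = farity L g"
    then have zs: "set zs \<subseteq> ?G" "length zs = farity L g" by simp_all
    have "ok (Fn g (map T zs))" using g zs T(1) by (auto simp: ok_def)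
    from fe[OF this] show "f (fint (N\<lparr>univ := ?G\<rparr>) g zs) = fint N g (map f zs)"
      by (simp only: eval_tm.simps mX[OF zs(1)] mY) simp
  next
    fix r zs assume r: "r \<in> rels L" and "set zs \<subseteq> univ (N\<lparr>univ := ?G\<rparr>) \<and> length zs = rarity L r"
    then have zs: "set zs \<subseteq> ?G" "length zs = rarity L r" by simp_all
    have "\<forall>t\<in>set (map T zs). ok t" using zs T(1) by auto
    from trrel[OF r _ this] show "rint (N\<lparr>univ := ?G\<rparr>) r zs = rint N r (map f zs)"
      using zs(2) by (simp only: mX[OF zs(1)] mY length_map) simp
  qed
  moreover have "map f xs = ys"
  proof (rule nth_equalityI)
    fix k assume "k < length (map f xs)"
    then show "map f xs ! k = ys ! k" using fe[of "Var k"] by (simp add: ok_def)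
  qed (simp add: len)
  ultimately show thesis using that im by blast
qed

section \<open>Ultrafilters\<close>

text \<open>\<open>W\<close> is taken maximal with the finite intersection property. A set outside
  \<open>W\<close> is then disjoint from some finite intersection from \<open>W\<close>; were both
  \<open>X\<close> and its complement outside, the two finite families together would have empty
  intersection. The result serves twice: for saturation of the generic relation and for the limit of
  colourings.\<close>

lemma ultrafilter_exists:
  fixes F :: "'a set set"
  assumes fip: "\<forall>G. finite G \<and> G \<subseteq> F \<longrightarrow> \<Inter>G \<noteq> {}"
  shows "\<exists>W. F \<subseteq> W \<and> (\<forall>G. finite G \<and> G \<subseteq> W \<longrightarrow> \<Inter>G \<noteq> {}) \<and> (\<forall>X. X \<in> W \<or> - X \<in> W)"
proof -
  define P where "P = {W. F \<subseteq> W \<and> (\<forall>G. finite G \<and> G \<subseteq> W \<longrightarrow> \<Inter>G \<noteq> {})}"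
  have "\<exists>W\<in>P. \<forall>X\<in>P. W \<subseteq> X \<longrightarrow> X = W"
  proof (rule subset_Zorn_nonempty)
    have "F \<in> P" using fip by (simp add: P_def)
    then show "P \<noteq> {}" by blast
  next
    fix C assume C: "C \<noteq> {}" "subset.chain P C"
    have CP: "C \<subseteq> P" using C by (simp add: subset.chain_def)
    have "\<Inter>G \<noteq> {}" if G: "finite G" "G \<subseteq> \<Union>C" for G
    proof -
      obtain W where "W \<in> C" "G \<subseteq> W"
        using finite_subset_Union_chain[OF G C] by blast
      then show ?thesis using CP G(1) by (auto simp: P_def)
    qed
    moreover have "F \<subseteq> \<Union>C" using C(1) CP by (auto simp: P_def)
    ultimately show "\<Union>C \<in> P" by (simp add: P_def)
  qed
  then obtain W where W: "W \<in> P" and max: "\<forall>X\<in>P. W \<subseteq> X \<longrightarrow> X = W" by (elim bexE)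
  have fipW: "\<Inter>G \<noteq> {}" if "finite G" "G \<subseteq> W" for G
    using W that by (simp add: P_def)
  have key: "\<exists>G. finite G \<and> G \<subseteq> W \<and> \<Inter>G \<inter> X = {}" if X: "X \<notin> W" for X
  proof -
    have "insert X W \<notin> P" using max X by blast
    moreover have "F \<subseteq> insert X W" using W by (auto simp: P_def)
    ultimately obtain G where G: "finite G" "G \<subseteq> insert X W" "\<Inter>G = {}"
      by (auto simp: P_def)
    then have "\<Inter>(G - {X}) \<inter> X = {}" by blast
    then show ?thesis using G by (intro exI[of _ "G - {X}"]) auto
  qed
  have "X \<in> W \<or> - X \<in> W" for X
  proof (rule ccontr)
    assume "\<not> (X \<in> W \<or> - X \<in> W)"
    then have "X \<notin> W" "- X \<notin> W" by simp_all
    from key[OF this(1)] key[OF this(2)] obtain G H where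
      G: "finite G" "G \<subseteq> W" "\<Inter>G \<inter> X = {}" and H: "finite H" "H \<subseteq> W" "\<Inter>H \<inter> - X = {}"
      by (elim exE conjE)
    then have "\<Inter>(G \<union> H) = {}" by blast
    then show False using fipW[of "G \<union> H"] G H by simp
  qed
  then show ?thesis using W by (auto simp: P_def)
qed

section \<open>Generic relations\<close>

lemma card_of_finite_ordLeq: "infinite I \<Longrightarrow> finite A \<Longrightarrow> |A| \<le>o |I|"
  using ordLeq_total card_of_Well_order card_of_ordLeq_finite by metis

lemma card_of_lists_length:
  assumes I: "infinite I" and S: "|S| \<le>o |I|"
  shows "|{xs. set xs \<subseteq> S \<and> length xs = n}| \<le>o |I|"
proof (induction n)
  case 0
  have "{xs. set xs \<subseteq> S \<and> length xs = 0} \<subseteq> {[]}" by auto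
  then have "finite {xs. set xs \<subseteq> S \<and> length xs = 0}" by (rule finite_subset) simp
  then show ?case by (rule card_of_finite_ordLeq[OF I])
next
  case (Suc n)
  let ?X = "{xs. set xs \<subseteq> S \<and> length xs = n}"
  have "{xs. set xs \<subseteq> S \<and> length xs = Suc n} \<subseteq> (\<lambda>(x, xs). x # xs) ` (S \<times> ?X)"
  proof
    fix xs assume "xs \<in> {xs. set xs \<subseteq> S \<and> length xs = Suc n}"
    then show "xs \<in> (\<lambda>(x, xs). x # xs) ` (S \<times> ?X)" by (cases xs) auto
  qed
  then have "|{xs. set xs \<subseteq> S \<and> length xs = Suc n}| \<le>o |(\<lambda>(x, xs). x # xs) ` (S \<times> ?X)|"
    by (rule card_of_mono1)
  also have "|(\<lambda>(x, xs). x # xs) ` (S \<times> ?X)| \<le>o |S \<times> ?X|" by (rule card_of_image)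
  also have "|S \<times> ?X| \<le>o |I|"
    using I S Suc by (intro card_of_Times_ordLeq_infinite_Field) (simp_all add: Field_card_of card_of_card_order_on)
  finally show ?case .
qed

lemma card_of_Un_ordLeq:
  "infinite I \<Longrightarrow> |A| \<le>o |I| \<Longrightarrow> |B| \<le>o |I| \<Longrightarrow> |A \<union> B| \<le>o |I|"
  by (intro card_of_Un_ordLeq_infinite_Field) (simp_all add: Field_card_of card_of_card_order_on)

lemma card_of_insert_None:
  assumes I: "infinite I" and S: "|S| \<le>o |I|"
  shows "|insert None (Some ` S)| \<le>o |I|"
proof -
  have "|Some ` S| \<le>o |I|" using card_of_image S ordLeq_transitive by blast
  then have "|{None} \<union> Some ` S| \<le>o |I|"
    by (intro card_of_Un_ordLeq[OF I] card_of_finite_ordLeq[OF I, of "{None}"]) simp_all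
  then show ?thesis by simp
qed

text \<open>Every nonempty set of at most \<open>|I|\<close> words is the value of \<open>c\<close> at more than \<open>|I|\<close> points;
  this rests on \<open>(2\<^bsup>|I|\<^esup>)\<^bsup>|I|\<^esup> = 2\<^bsup>|I|\<^esup>\<close>.\<close>

lemma coding_exists:
  fixes I :: "'i set"
  assumes I: "infinite I" and big: "|Pow I| \<le>o |UNIV :: 'm set|"
  obtains V :: "'m set" and j :: "'i \<Rightarrow> 'm" and c :: "'m \<Rightarrow> 'm option list set"
  where "infinite V" "j ` I \<subseteq> V" "inj_on j I" "\<And>y. |c y| \<le>o |I|"
    "\<And>D. D \<subseteq> {ds. set ds \<subseteq> insert None (Some ` V) \<and> length ds = n} \<Longrightarrow> |D| \<le>o |I| \<Longrightarrow>
      \<not> |{y \<in> V. c y = insert [] D}| \<le>o |I|"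
proof -
  obtain h :: "'i set \<Rightarrow> 'm" where h: "inj_on h (Pow I)"
    using big card_of_ordLeq[of "Pow I" "UNIV :: 'm set"] by blast
  \<comment> \<open>\<open>V\<close> gets exactly 2^|I| points even when \<open>'m\<close> is
    larger, so that points of \<open>V\<close> can code all functions from \<open>I\<close> to words
    over \<open>V\<close>.\<close>
  define V where "V = h ` Pow I"
  define j where "j i = h {i}" for i
  have Viso: "|Pow I| =o |V|"
    using h by (intro card_of_ordIsoI[of h]) (simp add: bij_betw_def V_def)
  have infV: "infinite V"
    using I h by (simp add: V_def finite_image_iff)
  have jV: "j ` I \<subseteq> V" by (auto simp: j_def V_def)
  have jinj: "inj_on j I"
    using h by (auto simp: j_def inj_on_def)
  define Ls where "Ls = {[]} \<union> {ds. set ds \<subseteq> insert None (Some ` V) \<and> length ds = n}"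
  have "|insert None (Some ` V)| \<le>o |V|"
    by (intro card_of_insert_None infV ordIso_imp_ordLeq card_of_refl)
  then have LsV: "|Ls| \<le>o |V|"
    unfolding Ls_def
    by (intro card_of_Un_ordLeq[OF infV] card_of_finite_ordLeq[OF infV, of "{[]}"]
      card_of_lists_length[OF infV]) simp_all
  have cI: "Cinfinite |I|" using I by (simp add: cinfinite_def Field_card_of card_of_card_order_on)
  have two: "|Pow I| =o ctwo ^c |I|"
    unfolding ctwo_def cexp_def Field_card_of by (rule card_of_Pow_Func)
  have "|Ls| \<le>o ctwo ^c |I|"
    using LsV ordIso_symmetric[OF Viso] two by (meson ordLeq_ordIso_trans)
  then have "|Ls| ^c |I| \<le>o (ctwo ^c |I| ) ^c |I|"
    by (intro cexp_mono1) (simp_all add: card_of_Card_order)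
  also have "(ctwo ^c |I| ) ^c |I| =o ctwo ^c |I|"
    using cI by (intro cexp_cprod_ordLeq)
      (simp_all add: Card_order_ctwo Cinfinite_Cnotzero ordLeq_refl)
  also have "ctwo ^c |I| =o |V|" using two Viso ordIso_symmetric ordIso_transitive by blast
  finally have "|Func I Ls| \<le>o |V|" by (simp add: cexp_def Field_card_of)
  then have "|V \<times> Func I Ls| \<le>o |V|"
    using infV by (intro card_of_Times_ordLeq_infinite_Field)
      (simp_all add: Field_card_of card_of_card_order_on card_of_mono1)
  then obtain k where k: "inj_on k (V \<times> Func I Ls)" "k ` (V \<times> Func I Ls) \<subseteq> V"
    using card_of_ordLeq[of "V \<times> Func I Ls" V] by blast
  \<comment> \<open>The point \<open>k (t, g)\<close> codes the range of \<open>g\<close>. The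
    component \<open>t\<close> is a dummy that gives each range as many codes as \<open>V\<close>
    has points.\<close>
  define c where "c y = {d. \<exists>t\<in>V. \<exists>g\<in>Func I Ls. y = k (t, g) \<and> d \<in> g ` I}" for y
  have ck: "c (k (t, g)) = g ` I" if "t \<in> V" "g \<in> Func I Ls" for t g
  proof -
    have "g' = g" if "k (t, g) = k (t', g')" "t' \<in> V" "g' \<in> Func I Ls" for t' g'
      using inj_onD[OF k(1) that(1)] that \<open>t \<in> V\<close> \<open>g \<in> Func I Ls\<close> by simp
    then show ?thesis using that unfolding c_def by auto
  qed
  have "|c y| \<le>o |I|" for y
  proof (cases "\<exists>t\<in>V. \<exists>g\<in>Func I Ls. y = k (t, g)")
    case True
    then obtain t g where tg: "t \<in> V" "g \<in> Func I Ls" "y = k (t, g)" by blast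
    show ?thesis unfolding tg(3) ck[OF tg(1,2)] by (rule card_of_image)
  next
    case False
    then have "c y = {}" unfolding c_def by blast
    then show ?thesis by (intro card_of_finite_ordLeq[OF I]) simp
  qed
  moreover have "\<not> |{y \<in> V. c y = insert [] D}| \<le>o |I|"
    if D: "D \<subseteq> {ds. set ds \<subseteq> insert None (Some ` V) \<and> length ds = n}" "|D| \<le>o |I|" for D
  proof
    assume le: "|{y \<in> V. c y = insert [] D}| \<le>o |I|"
    have "|{[]} \<union> D| \<le>o |I|" 
      by (intro card_of_Un_ordLeq[OF I] D(2) card_of_finite_ordLeq[OF I, of "{[]}"]) simp
    \<comment> \<open>The word \<open>[]\<close> makes the set nonempty, hence the range of a
      function on \<open>I\<close> even when \<open>D\<close> is empty.\<close>
    then obtain g where g: "g ` I = insert [] D"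
      using card_of_ordLeq2[of "insert [] D" I] by auto
    define g' where "g' i = (if i \<in> I then g i else undefined)" for i
    have g'I: "g' ` I = insert [] D" using g by (simp add: g'_def)
    have "insert [] D \<subseteq> Ls" using D(1) by (auto simp: Ls_def)
    then have "g' i \<in> Ls" if "i \<in> I" for i using g'I that by blast
    then have g': "g' \<in> Func I Ls" by (simp add: Func_def g'_def)
    have "inj_on (\<lambda>t. k (t, g')) V"
      using k(1) g' by (auto simp: inj_on_def)
    moreover have "(\<lambda>t. k (t, g')) ` V \<subseteq> {y \<in> V. c y = insert [] D}"
      using k(2) g' ck[OF _ g'] g'I by auto
    ultimately have "|V| \<le>o |{y \<in> V. c y = insert [] D}|"
      using card_of_ordLeq[of V] by blast
    then have "|Pow I| \<le>o |I|"
      using le Viso by (meson ordIso_ordLeq_trans ordLeq_transitive)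
    then show False using card_of_Pow[of I] not_ordLess_ordLeq by blast
  qed
  ultimately show thesis using that[OF infV jV jinj] by blast
qed

text \<open>Tuples through a new point \<open>y\<close> are coded with \<open>None\<close> in place of \<open>y\<close>, so that a set of
  codes can prescribe the relation at \<open>y\<close> before \<open>y\<close> is chosen.\<close>

definition mark :: "'m \<Rightarrow> 'm list \<Rightarrow> 'm option list" where
  "mark y xs = map (\<lambda>x. if x = y then None else Some x) xs"

text \<open>The extension axioms of a random \<open>n\<close>-ary relation, over sets of size up to
  |I| instead of finite sets. \<open>D\<close> prescribes all tuples through the new point
  \<open>y\<close>, including those in which \<open>y\<close> is repeated.\<close>

locale generic_rel =
  fixes I :: "'i set" and V :: "'m set" and n :: nat and R :: "'m list \<Rightarrow> bool"
  assumes inf_I: "infinite I" and inf_V: "infinite V"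
    and ext: "A \<subseteq> V \<Longrightarrow> |A| \<le>o |I| \<Longrightarrow> \<exists>y\<in>V - A. \<forall>xs. set xs \<subseteq> insert y A \<and> y \<in> set xs \<and>
      length xs = n \<longrightarrow> (R xs \<longleftrightarrow> mark y xs \<in> D)"

text \<open>On the copy of \<open>I\<close> the relation is \<open>P\<close>; any other tuple is
  decided by its own entries, each of which carries in \<open>c\<close> a set of tuples to be
  accepted. A prescription over \<open>A\<close> is realised by a point that has it as code and that
  no point of \<open>A\<close> mentions: at most |I| points are excluded, but more than |I| points
  have the code.\<close>

lemma generic_rel_exists:
  fixes I :: "'i set" and P :: "'i list \<Rightarrow> bool"
  assumes I: "infinite I" and big: "|Pow I| \<le>o |UNIV :: 'm set|" and n: "n > 0"
  obtains V :: "'m set" and j :: "'i \<Rightarrow> 'm" and R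
  where "generic_rel I V n R" "j ` I \<subseteq> V" "\<And>is. set is \<subseteq> I \<Longrightarrow> R (map j is) \<longleftrightarrow> P is"
proof -
  obtain V :: "'m set" and j :: "'i \<Rightarrow> 'm" and c :: "'m \<Rightarrow> 'm option list set"
    where V: "infinite V" and j: "j ` I \<subseteq> V" "inj_on j I" and c: "\<And>y. |c y| \<le>o |I|"
    and cD: "\<And>D. D \<subseteq> {ds. set ds \<subseteq> insert None (Some ` V) \<and> length ds = n} \<Longrightarrow> |D| \<le>o |I| \<Longrightarrow>
      \<not> |{y \<in> V. c y = insert [] D}| \<le>o |I|"
    by (rule coding_exists[OF I big, of n]) blast
  define R where "R xs \<longleftrightarrow> (if set xs \<subseteq> j ` I then P (map (the_inv_into I j) xs)
    else \<exists>y\<in>set xs. mark y xs \<in> c y)" for xs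
  have "generic_rel I V n R"
  proof
    fix A E assume A: "A \<subseteq> V" "|A| \<le>o |I|"
    \<comment> \<open>Only codes of length \<open>n\<close> over \<open>A\<close> can occur; cutting
      \<open>E\<close> down to them leaves a set small enough to be coded.\<close>
    define D where "D = {ds. set ds \<subseteq> insert None (Some ` A) \<and> length ds = n} \<inter> E"
    have "D \<subseteq> {ds. set ds \<subseteq> insert None (Some ` A) \<and> length ds = n}" by (simp add: D_def)
    moreover have "|{ds. set ds \<subseteq> insert None (Some ` A) \<and> length ds = n}| \<le>o |I|"
      using A I by (intro card_of_lists_length card_of_insert_None)
    ultimately have "|D| \<le>o |I|" using card_of_mono1 ordLeq_transitive by blast
    moreover have "D \<subseteq> {ds. set ds \<subseteq> insert None (Some ` V) \<and> length ds = n}"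
      using A(1) by (fastforce simp: D_def)
    ultimately have large: "\<not> |{y \<in> V. c y = insert [] D}| \<le>o |I|" 
      by (intro cD)
    \<comment> \<open>Outside \<open>Bad\<close>, \<open>y\<close> avoids the copy of
      \<open>I\<close>, where \<open>P\<close> decides, and is named in no code of a point of
      \<open>A\<close>, so that no other entry of a tuple through \<open>y\<close> can accept that
      tuple.\<close>
    define Bad where "Bad = j ` I \<union> A \<union> (\<Union>a\<in>A. \<Union>ds\<in>c a. {z. Some z \<in> set ds})"
    have "|{z. Some z \<in> set ds}| \<le>o |I|" for ds :: "'m option list"
    proof -
      have "{z. Some z \<in> set ds} \<subseteq> the ` set ds" by force
      then have "finite {z. Some z \<in> set ds}" by (rule finite_subset) simp
      then show ?thesis by (rule card_of_finite_ordLeq[OF I])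
    qed
    then have "|\<Union>a\<in>A. \<Union>ds\<in>c a. {z. Some z \<in> set ds}| \<le>o |I|"
      using A c I by (intro card_of_UNION_ordLeq_infinite ballI) auto
    then have "|Bad| \<le>o |I|"
      unfolding Bad_def using A(2) I by (intro card_of_Un_ordLeq card_of_image)
    then have "\<not> {y \<in> V. c y = insert [] D} \<subseteq> Bad"
      using large card_of_mono1 ordLeq_transitive by blast
    then obtain y where y: "y \<in> V" "c y = insert [] D" "y \<notin> Bad" by blast
    have "R xs \<longleftrightarrow> mark y xs \<in> E"
      if xs: "set xs \<subseteq> insert y A" "y \<in> set xs" "length xs = n" for xs
    proof -
      have "y \<notin> j ` I" using y(3) by (simp add: Bad_def)
      then have "R xs \<longleftrightarrow> (\<exists>z\<in>set xs. mark z xs \<in> c z)" using xs(2) by (auto simp: R_def)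
      also have "\<dots> \<longleftrightarrow> mark y xs \<in> c y"
      proof -
        have "mark z xs \<notin> c z" if z: "z \<in> set xs" "z \<noteq> y" for z
        proof
          assume "mark z xs \<in> c z"
          moreover have "Some y \<in> set (mark z xs)" using xs(2) z by (auto simp: mark_def)
          moreover have "z \<in> A" using z xs(1) by auto
          ultimately show False using y(3) by (auto simp: Bad_def)
        qed
        then show ?thesis using xs(2) by blast
      qed
      also have "\<dots> \<longleftrightarrow> mark y xs \<in> E"
      proof -
        \<comment> \<open>Since \<open>n > 0\<close>, the extra word \<open>[]\<close> in
          \<open>c y\<close> never matches a tuple.\<close>
        have "mark y xs \<noteq> []" using xs(3) n by (auto simp: mark_def)
        moreover have "set (mark y xs) \<subseteq> insert None (Some ` A)" "length (mark y xs) = n"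
          using xs by (auto simp: mark_def)
        ultimately show ?thesis by (simp add: y(2) D_def)
      qed
      finally show ?thesis .
    qed
    moreover have "y \<notin> A" using y(3) by (simp add: Bad_def)
    ultimately show "\<exists>y\<in>V - A. \<forall>xs. set xs \<subseteq> insert y A \<and> y \<in> set xs \<and> length xs = n \<longrightarrow>
        (R xs \<longleftrightarrow> mark y xs \<in> E)"
      using y(1) by (intro bexI[of _ y]) simp_all
  qed (use I V in auto)
  moreover have "R (map j is) \<longleftrightarrow> P is" if "set is \<subseteq> I" for "is"
  proof -
    have "map (the_inv_into I j) (map j is) = is"
      using that the_inv_into_f_f[OF j(2)] by (induction "is") auto
    moreover have "set (map j is) \<subseteq> j ` I" using that by auto
    ultimately show ?thesis unfolding R_def by (simp only: if_True)
  qed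
  ultimately show thesis using that j(1) by blast
qed

section \<open>Quantifier elimination, saturation and homogeneity of the generic relation\<close>

context generic_rel
begin

text \<open>The two assignments have the same quantifier-free type in the language of one
  \<open>n\<close>-ary relation. Indexing by variables instead of points allows repeated values, and
  \<open>S\<close> may be infinite, as homogeneity requires.\<close>

definition agree :: "'v set \<Rightarrow> ('v \<Rightarrow> 'm) \<Rightarrow> ('v \<Rightarrow> 'm) \<Rightarrow> bool" where
  "agree S e e' \<longleftrightarrow> e ` S \<subseteq> V \<and> e' ` S \<subseteq> V \<and> (\<forall>v\<in>S. \<forall>w\<in>S. e v = e w \<longleftrightarrow> e' v = e' w) \<and>
     (\<forall>vs. set vs \<subseteq> S \<and> length vs = n \<longrightarrow> (R (map e vs) \<longleftrightarrow> R (map e' vs)))"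

lemma agree_sym: "agree S e e' \<Longrightarrow> agree S e' e"
  unfolding agree_def by auto

lemma agreeD:
  assumes "agree S e e'"
  shows "v \<in> S \<Longrightarrow> e v \<in> V" "v \<in> S \<Longrightarrow> e' v \<in> V"
    "v \<in> S \<Longrightarrow> w \<in> S \<Longrightarrow> e v = e w \<longleftrightarrow> e' v = e' w"
    "set vs \<subseteq> S \<Longrightarrow> length vs = n \<Longrightarrow> R (map e vs) \<longleftrightarrow> R (map e' vs)"
  using assms unfolding agree_def by auto

lemma agree_mono:
  assumes "agree S e e'" "S' \<subseteq> S"
  shows "agree S' e e'"
  unfolding agree_def
proof (intro conjI ballI allI impI)
  show "e ` S' \<subseteq> V" "e' ` S' \<subseteq> V" using assms unfolding agree_def by blast+
  show "e v = e w \<longleftrightarrow> e' v = e' w" if "v \<in> S'" "w \<in> S'" for v w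
    using assms that unfolding agree_def by blast
  show "R (map e vs) \<longleftrightarrow> R (map e' vs)" if "set vs \<subseteq> S' \<and> length vs = n" for vs
    using assms(2) that by (intro agreeD(4)[OF assms(1)]) auto
qed

text \<open>The forth step of a back-and-forth system. If \<open>x\<close> is already a value,
  \<open>v\<close> imitates the variable that has it; otherwise the position of \<open>x\<close>
  among the values of \<open>e\<close> is written as a set of codes over the values of
  \<open>e'\<close> and realised by a new point.\<close>

lemma agree_ext:
  assumes ag: "agree S e e'" and S: "|S| \<le>o |I|" and v: "v \<notin> S" and x: "x \<in> V"
  shows "\<exists>y\<in>V. agree (insert v S) (e(v := x)) (e'(v := y))"
proof (cases "x \<in> e ` S")
  case True
  then obtain w where w: "w \<in> S" "x = e w" by blast
  define \<sigma> where "\<sigma> u = (if u = v then w else u)" for u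
  have \<sigma>: "\<sigma> u \<in> S" if "u \<in> insert v S" for u using that w by (auto simp: \<sigma>_def)
  have e: "e(v := x) = e \<circ> \<sigma>" "e'(v := e' w) = e' \<circ> \<sigma>" using w by (auto simp: \<sigma>_def fun_eq_iff)
  have "agree (insert v S) (e \<circ> \<sigma>) (e' \<circ> \<sigma>)"
    unfolding agree_def
  proof (intro conjI allI impI ballI)
    show "(e \<circ> \<sigma>) ` insert v S \<subseteq> V" "(e' \<circ> \<sigma>) ` insert v S \<subseteq> V"
      using agreeD(1,2)[OF ag \<sigma>] by auto
    show "(e \<circ> \<sigma>) u = (e \<circ> \<sigma>) t \<longleftrightarrow> (e' \<circ> \<sigma>) u = (e' \<circ> \<sigma>) t"
      if "u \<in> insert v S" "t \<in> insert v S" for u t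
      using agreeD(3)[OF ag \<sigma>[OF that(1)] \<sigma>[OF that(2)]] by simp
    fix vs assume vs: "set vs \<subseteq> insert v S \<and> length vs = n"
    then have "set (map \<sigma> vs) \<subseteq> S" "length (map \<sigma> vs) = n" using \<sigma> by auto
    then have "R (map e (map \<sigma> vs)) \<longleftrightarrow> R (map e' (map \<sigma> vs))"
      by (rule agreeD(4)[OF ag])
    then show "R (map (e \<circ> \<sigma>) vs) \<longleftrightarrow> R (map (e' \<circ> \<sigma>) vs)" by simp
  qed
  moreover have "e' w \<in> V" by (rule agreeD(2)[OF ag w(1)])
  ultimately show ?thesis unfolding e[symmetric] by blast
next
  case False
  define m where "m vs = map (\<lambda>w. if w = v then None else Some (e' w)) vs" for vs
  define D where "D = {m vs |vs. set vs \<subseteq> insert v S \<and> length vs = n \<and> R (map (e(v := x)) vs)}"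
  have "e' ` S \<subseteq> V" using ag unfolding agree_def by simp
  moreover have "|e' ` S| \<le>o |I|" using S card_of_image ordLeq_transitive by blast
  ultimately have "\<exists>y\<in>V - e' ` S. \<forall>xs. set xs \<subseteq> insert y (e' ` S) \<and>
      y \<in> set xs \<and> length xs = n \<longrightarrow> (R xs \<longleftrightarrow> mark y xs \<in> D)"
    by (rule ext)
  then obtain y where y: "y \<in> V - e' ` S" and Ry: "\<forall>xs. set xs \<subseteq> insert y (e' ` S) \<and>
      y \<in> set xs \<and> length xs = n \<longrightarrow> (R xs \<longleftrightarrow> mark y xs \<in> D)"
    by (elim bexE)
  have "agree (insert v S) (e(v := x)) (e'(v := y))"
    unfolding agree_def
  proof (intro conjI allI impI ballI)
    show "e(v := x) ` insert v S \<subseteq> V" "e'(v := y) ` insert v S \<subseteq> V"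
      using agreeD(1,2)[OF ag] x y v by auto
    show "(e(v := x)) u = (e(v := x)) t \<longleftrightarrow> (e'(v := y)) u = (e'(v := y)) t"
      if "u \<in> insert v S" "t \<in> insert v S" for u t
      using that agreeD(3)[OF ag, of u t] False y v by (auto simp: image_iff)
    fix vs assume vs: "set vs \<subseteq> insert v S \<and> length vs = n"
    show "R (map (e(v := x)) vs) \<longleftrightarrow> R (map (e'(v := y)) vs)"
    proof (cases "v \<in> set vs")
      case False
      then have m: "map (e(v := x)) vs = map e vs" "map (e'(v := y)) vs = map e' vs" by auto
      show ?thesis unfolding m using vs False by (intro agreeD(4)[OF ag]) auto
    next
      case True
      have "mark y (map (e'(v := y)) vs) = m vs"
        using vs y by (auto simp: mark_def m_def)
      moreover have "set (map (e'(v := y)) vs) \<subseteq> insert y (e' ` S)" "y \<in> set (map (e'(v := y)) vs)"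
        using vs True by (auto simp: image_iff)
      ultimately have "R (map (e'(v := y)) vs) \<longleftrightarrow> m vs \<in> D"
        using Ry vs by (metis length_map)
      also have "\<dots> \<longleftrightarrow> R (map (e(v := x)) vs)"
      proof
        assume "m vs \<in> D"
        then obtain us where us: "m us = m vs" "set us \<subseteq> insert v S" "length us = n"
          "R (map (e(v := x)) us)" unfolding D_def by auto
        \<comment> \<open>Tuples of variables with the same code have the same values under
          \<open>e'\<close>, hence under \<open>e\<close>: membership in \<open>D\<close> does not
          depend on the representative.\<close>
        have "map (e(v := x)) us = map (e(v := x)) vs"
        proof (rule nth_equalityI)
          fix i assume i: "i < length (map (e(v := x)) us)"
          then have i': "i < length us" "i < length vs" using us vs by simp_all
          have "m us ! i = m vs ! i" using us(1) by simp
          moreover have "us ! i \<in> insert v S" "vs ! i \<in> insert v S"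
            using i' us(2) vs nth_mem by blast+
          ultimately show "map (e(v := x)) us ! i = map (e(v := x)) vs ! i"
            using i' agreeD(3)[OF ag, of "us ! i" "vs ! i"] unfolding m_def by (auto split: if_splits)
        qed (use us vs in simp)
        then show "R (map (e(v := x)) vs)" using us(4) by simp
      next
        assume "R (map (e(v := x)) vs)"
        then show "m vs \<in> D" using vs unfolding D_def by blast
      qed
      finally show ?thesis by blast
    qed
  qed
  then show ?thesis using y by blast
qed

definition lang :: "'s \<Rightarrow> ('g, 's) language" where
  "lang r = \<lparr>funs = {}, rels = {r}, farity = (\<lambda>_. 0), rarity = (\<lambda>_. n)\<rparr>"

definition struc :: "('g, 's, 'm) struct" where
  "struc = \<lparr>univ = V, fint = (\<lambda>_ _. undefined), rint = (\<lambda>_. R)\<rparr>"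

lemma is_struct_struc: "is_struct (lang r) struc"
  using inf_V by (auto simp: is_struct_def lang_def struc_def)

lemma wf_tm_lang: "wf_tm (lang r) t \<longleftrightarrow> (\<exists>v. t = Var v)"
  by (cases t) (auto simp: lang_def)

lemma wf_tms_lang: "\<forall>t\<in>set ts. wf_tm (lang r) t \<Longrightarrow> \<exists>vs. ts = map Var vs"
proof (induction ts)
  case (Cons t ts)
  then obtain v vs where "t = Var v" "ts = map Var vs" by (auto simp: wf_tm_lang)
  then show ?case by (intro exI[of _ "v # vs"]) simp
qed simp

lemma finite_ordLeq_I: "finite A \<Longrightarrow> |A| \<le>o |I|"
  by (rule card_of_finite_ordLeq[OF inf_I])

text \<open>Quantifier elimination by back-and-forth: \<open>agree_ext\<close> moves a witness of
  the quantifier to the other side, and the set of free variables is finite, hence small enough for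
  it.\<close>

lemma agree_sat:
  "wf_fm (lang r) \<phi> \<Longrightarrow> agree (fv \<phi>) e e' \<Longrightarrow> sat struc e \<phi> \<longleftrightarrow> sat struc e' \<phi>"
proof (induction \<phi> arbitrary: e e')
  case (Eq s t)
  then obtain v w where "s = Var v" "t = Var w" by (auto simp: wf_tm_lang)
  then show ?case using Eq.prems(2) by (simp add: agree_def)
next
  case (Rel q ts)
  then obtain vs where vs: "ts = map Var vs" using wf_tms_lang[of ts r] by auto
  have "length vs = n" "set vs \<subseteq> fv (Rel q ts)" using Rel.prems(1) vs by (auto simp: lang_def)
  then have "R (map e vs) \<longleftrightarrow> R (map e' vs)" by (intro agreeD(4)[OF Rel.prems(2)])
  then show ?case by (simp add: vs struc_def comp_def)
next
  case (Neg \<phi>)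
  then show ?case by simp
next
  case (Conj \<phi> \<psi>)
  have "agree (fv \<phi>) e e'" "agree (fv \<psi>) e e'" using Conj.prems(2) by (auto intro: agree_mono)
  then show ?case using Conj by simp
next
  case (Ex v \<phi>)
  have small: "|fv \<phi> - {v}| \<le>o |I|" by (rule finite_ordLeq_I) (simp add: finite_fv)
  have half: "\<exists>y\<in>V. sat struc (f'(v := y)) \<phi>"
    if ag: "agree (fv \<phi> - {v}) f f'" and x: "x \<in> V" "sat struc (f(v := x)) \<phi>" for f f' x
  proof -
    have "v \<notin> fv \<phi> - {v}" by simp
    from agree_ext[OF ag small this x(1)] obtain y where
      y: "y \<in> V" "agree (insert v (fv \<phi> - {v})) (f(v := x)) (f'(v := y))" ..
    have "agree (fv \<phi>) (f(v := x)) (f'(v := y))" by (rule agree_mono[OF y(2)]) auto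
    moreover have "wf_fm (lang r) \<phi>" using Ex.prems(1) by simp
    ultimately have "sat struc (f(v := x)) \<phi> \<longleftrightarrow> sat struc (f'(v := y)) \<phi>"
      by (intro Ex.IH)
    then show ?thesis using x(2) y(1) by blast
  qed
  have ag: "agree (fv \<phi> - {v}) e e'" using Ex.prems(2) by simp
  have "(\<exists>x\<in>V. sat struc (e(v := x)) \<phi>) \<longleftrightarrow> (\<exists>y\<in>V. sat struc (e'(v := y)) \<phi>)"
    using half[OF ag] half[OF agree_sym[OF ag]] by (meson bexE)
  then show ?case by (simp add: struc_def)
qed

text \<open>The solution sets of the formulas in \<open>p\<close> are extended to an ultrafilter
  \<open>W\<close>. If \<open>W\<close> contains \<open>{a}\<close> for some \<open>a\<close> in
  \<open>A\<close>, then \<open>a\<close> realises \<open>p\<close>. Otherwise \<open>y\<close> is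
  chosen so that a tuple through \<open>y\<close> holds iff it holds for \<open>W\<close>-almost all
  points in place of \<open>y\<close>. For each single formula, some solution \<open>x\<close> has
  the quantifier-free type of \<open>y\<close> over the parameters, and \<open>agree_sat\<close>
  concludes.\<close>

lemma saturated_struc:
  assumes \<kappa>: "\<And>A :: 'm set. |A| <o \<kappa> \<Longrightarrow> |A| \<le>o |I|"
  shows "saturated \<kappa> (lang r) (struc :: ('g, 's, 'm) struct)"
  unfolding saturated_def
proof (intro allI impI)
  let ?M = "struc :: ('g, 's, 'm) struct"
  fix A and p :: "(('g, 's, nat) fm \<times> (nat \<Rightarrow> 'm)) set"
  assume "A \<subseteq> univ ?M \<and> |A| <o \<kappa> \<and> one_type_over (lang r) ?M A p"
  then have AV: "A \<subseteq> V" and AI: "|A| \<le>o |I|" and p: "one_type_over (lang r) ?M A p"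
    using \<kappa> by (simp_all add: struc_def)
  have wf: "wf_fm (lang r) \<phi>" and par: "e ` (fv \<phi> - {0}) \<subseteq> A" if "(\<phi>, e) \<in> p" for \<phi> e
  proof -
    have "case (\<phi>, e) of (\<phi>, e) \<Rightarrow> \<phi> \<in> formulas (lang r) \<and> e ` (fv \<phi> - {0}) \<subseteq> A"
      using p that unfolding one_type_over_def by blast
    then show "wf_fm (lang r) \<phi>" "e ` (fv \<phi> - {0}) \<subseteq> A" by (simp_all add: formulas_def)
  qed
  define X where "X pe = {x \<in> V. sat ?M ((snd pe)(0 := x)) (fst pe)}"
    for pe :: "('g, 's, nat) fm \<times> (nat \<Rightarrow> 'm)"
  have "\<Inter>G \<noteq> {}" if G: "finite G" "G \<subseteq> insert V (X ` p)" for G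
  proof -
    have "finite (G - {V})" "G - {V} \<subseteq> X ` p" using G by auto
    then obtain q where q: "finite q" "q \<subseteq> p" "G - {V} = X ` q" by (meson finite_subset_image)
    then obtain x where x: "x \<in> univ ?M" "\<forall>(\<phi>, e)\<in>q. sat ?M (e(0 := x)) \<phi>"
      using p unfolding one_type_over_def by meson
    have "x \<in> Y" if "Y \<in> G" for Y
    proof (cases "Y = V")
      case True
      then show ?thesis using x(1) by (simp add: struc_def)
    next
      case False
      then obtain pe where "pe \<in> q" "Y = X pe" using \<open>Y \<in> G\<close> q(3) by blast
      then show ?thesis using x by (auto simp: X_def struc_def)
    qed
    then show ?thesis by blast
  qed
  then have "\<forall>G. finite G \<and> G \<subseteq> insert V (X ` p) \<longrightarrow> \<Inter>G \<noteq> {}" by blast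
  from ultrafilter_exists[OF this] obtain W where W: "insert V (X ` p) \<subseteq> W" and
    fip: "\<forall>G. finite G \<and> G \<subseteq> W \<longrightarrow> \<Inter>G \<noteq> {}" and um: "\<forall>Y. Y \<in> W \<or> - Y \<in> W"
    by (elim exE conjE)
  show "\<exists>x\<in>univ ?M. \<forall>(\<phi>, e)\<in>p. sat ?M (e(0 := x)) \<phi>"
  proof (cases "\<exists>a\<in>A. {a} \<in> W")
    case True
    then obtain a where a: "a \<in> A" "{a} \<in> W" by blast
    have "sat ?M (e(0 := a)) \<phi>" if "(\<phi>, e) \<in> p" for \<phi> e
    proof -
      have "X (\<phi>, e) \<in> W" using W that by auto
      then have "\<Inter>{X (\<phi>, e), {a}} \<noteq> {}" using a by (intro fip[rule_format]) auto
      then show ?thesis by (auto simp: X_def)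
    qed
    then show ?thesis using a AV by (intro bexI[of _ a]) (auto simp: struc_def)
  next
    case False
    define fill where "fill x ds = map (\<lambda>d. case d of None \<Rightarrow> x | Some a \<Rightarrow> a) ds"
      for x :: 'm and ds
    define D where "D = {ds. {x. R (fill x ds)} \<in> W}"
    obtain y where y: "y \<in> V - A" and Ry: "\<forall>xs. set xs \<subseteq> insert y A \<and> y \<in> set xs \<and>
      length xs = n \<longrightarrow> (R xs \<longleftrightarrow> mark y xs \<in> D)"
      using ext[OF AV AI, of D] by (elim bexE)
    have "sat ?M (e(0 := y)) \<phi>" if pe: "(\<phi>, e) \<in> p" for \<phi> e
    proof -
      define F where "F = e ` (fv \<phi> - {0})"
      have F: "finite F" "F \<subseteq> A" using par[OF pe] by (simp_all add: F_def finite_fv)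
      define Ls where "Ls = {ds. set ds \<subseteq> insert None (Some ` F) \<and> length ds = n}"
      have "finite Ls" unfolding Ls_def using F(1) by (intro finite_lists_length_eq) simp
      define Y where "Y ds = {x. R (fill x ds) \<longleftrightarrow> ds \<in> D}" for ds
      have YW: "Y ds \<in> W" for ds
      proof (cases "ds \<in> D")
        case True
        then show ?thesis by (simp add: Y_def D_def)
      next
        case False
        then have "- {x. R (fill x ds)} \<in> W" using um unfolding D_def by blast
        then show ?thesis using False by (simp add: Y_def Compl_eq)
      qed
      have aW: "- {a} \<in> W" if "a \<in> F" for a using False um that F(2) by blast
      \<comment> \<open>These are finitely many members of \<open>W\<close>: a common point solves
        the formula, differs from its parameters and follows \<open>D\<close> on the finitely many
        codes over them.\<close>
      have "\<Inter>({V, X (\<phi>, e)} \<union> (\<lambda>a. - {a}) ` F \<union> Y ` Ls) \<noteq> {}"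
        using W pe aW YW F(1) \<open>finite Ls\<close> by (intro fip[rule_format]) auto
      then obtain x where x: "x \<in> V" "x \<in> X (\<phi>, e)" "\<forall>a\<in>F. x \<noteq> a" "\<forall>ds\<in>Ls. x \<in> Y ds" by auto
      have eF: "e v \<in> F" if "v \<in> fv \<phi>" "v \<noteq> 0" for v using that by (simp add: F_def)
      have yF: "y \<notin> F" using y F by auto
      have "agree (fv \<phi>) (e(0 := x)) (e(0 := y))"
        unfolding agree_def
      proof (intro conjI allI impI ballI)
        show "e(0 := x) ` fv \<phi> \<subseteq> V" "e(0 := y) ` fv \<phi> \<subseteq> V"
          using x(1) y eF F(2) AV by auto
        show "(e(0 := x)) v = (e(0 := x)) w \<longleftrightarrow> (e(0 := y)) v = (e(0 := y)) w"
          if "v \<in> fv \<phi>" "w \<in> fv \<phi>" for v w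
          using eF[OF that(1)] eF[OF that(2)] x(3) yF by auto
        fix vs assume vs: "set vs \<subseteq> fv \<phi> \<and> length vs = n"
        show "R (map (e(0 := x)) vs) \<longleftrightarrow> R (map (e(0 := y)) vs)"
        proof (cases "0 \<in> set vs")
          case False
          then have "map (e(0 := x)) vs = map (e(0 := y)) vs" by auto
          then show ?thesis by (simp only:)
        next
          case True
          define ds where "ds = map (\<lambda>v. if v = 0 then None else Some (e v)) vs"
          have e_in: "e v \<in> F" if "v \<in> set vs" "v \<noteq> 0" for v using vs eF that by blast
          have "ds \<in> Ls" using vs e_in by (auto simp: ds_def Ls_def)
          then have "R (fill x ds) \<longleftrightarrow> ds \<in> D" using x(4) by (auto simp: Y_def)
          moreover have "fill x ds = map (e(0 := x)) vs" by (auto simp: fill_def ds_def)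
          moreover have "mark y (map (e(0 := y)) vs) = ds"
            using e_in yF by (auto simp: mark_def ds_def)
          moreover have "set (map (e(0 := y)) vs) \<subseteq> insert y A" "y \<in> set (map (e(0 := y)) vs)"
            using e_in F(2) True by (auto simp: image_iff)
          ultimately show ?thesis using Ry vs by (metis length_map)
        qed
      qed
      from agree_sat[OF wf[OF pe] this] have "sat ?M (e(0 := x)) \<phi> \<longleftrightarrow> sat ?M (e(0 := y)) \<phi>" .
      moreover have "sat ?M (e(0 := x)) \<phi>" using x(2) unfolding X_def by simp
      ultimately show ?thesis by blast
    qed
    then show ?thesis using y by (intro bexI[of _ y]) (auto simp: struc_def)
  qed
qed

text \<open>A partial elementary map preserves equality and \<open>R\<close>, so it is an instance
  of \<open>agree\<close> with the points of \<open>A\<close> as their own variables. One use of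
  \<open>agree_ext\<close> adds \<open>x\<close>, and \<open>agree_sat\<close> turns the result back
  into a partial elementary map.\<close>

lemma homogeneous_struc:
  assumes \<kappa>: "\<And>A :: 'm set. |A| <o \<kappa> \<Longrightarrow> |A| \<le>o |I|"
  shows "homogeneous \<kappa> (lang r) (struc :: ('g, 's, 'm) struct)"
  unfolding homogeneous_def
proof (intro allI impI ballI)
  let ?M = "struc :: ('g, 's, 'm) struct"
  fix A g x
  assume "A \<subseteq> univ ?M \<and> |A| <o \<kappa> \<and> partial_elementary (lang r) ?M A g" and "x \<in> univ ?M"
  then have AV: "A \<subseteq> V" and AI: "|A| \<le>o |I|" and g: "partial_elementary (lang r) ?M A g"
    and x: "x \<in> V"
    using \<kappa> by (simp_all add: struc_def)
  have gV: "g ` A \<subseteq> V"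
    using g unfolding partial_elementary_def by (simp add: struc_def)
  have gsat: "sat ?M e \<phi> \<longleftrightarrow> sat ?M (g \<circ> e) \<phi>"
    if "wf_fm (lang r) \<phi>" "e ` fv \<phi> \<subseteq> A" for \<phi> and e :: "nat \<Rightarrow> 'm"
    using g that unfolding partial_elementary_def formulas_def by blast
  show "\<exists>y. partial_elementary (lang r) ?M (insert x A) (g(x := y)) \<and> (\<forall>a\<in>A. (g(x := y)) a = g a)"
  proof (cases "x \<in> A")
    case True
    then have "insert x A = A" "g(x := g x) = g" by auto
    then show ?thesis using g by (intro exI[of _ "g x"]) simp
  next
    case False
    have "agree A (\<lambda>v. v) g"
      unfolding agree_def
    proof (intro conjI allI impI ballI)
      show "(\<lambda>v. v) ` A \<subseteq> V" using AV by simp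
      show "g ` A \<subseteq> V" by fact
      show "v = w \<longleftrightarrow> g v = g w" if "v \<in> A" "w \<in> A" for v w
        using gsat[of "Eq (Var 0) (Var 1)" "\<lambda>k. if k = 0 then v else w"] that by auto
      fix vs assume vs: "set vs \<subseteq> A \<and> length vs = n"
      have m: "map (\<lambda>k. vs ! k) [0..<n] = vs" "map (\<lambda>k. g (vs ! k)) [0..<n] = map g vs"
        using vs by (auto intro: nth_equalityI)
      have "sat ?M (\<lambda>k. vs ! k) (Rel r (map Var [0..<n])) \<longleftrightarrow>
          sat ?M (g \<circ> (\<lambda>k. vs ! k)) (Rel r (map Var [0..<n]))"
        using vs by (intro gsat) (auto simp: lang_def)
      then show "R (map (\<lambda>v. v) vs) \<longleftrightarrow> R (map g vs)" by (simp add: struc_def comp_def m)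
    qed
    from agree_ext[OF this AI False x] obtain y
      where "agree (insert x A) ((\<lambda>v. v)(x := x)) (g(x := y))" by blast
    moreover have "(\<lambda>v. v)(x := x) = (\<lambda>v. v)" by auto
    ultimately have ag: "agree (insert x A) (\<lambda>v. v) (g(x := y))" by simp
    have "partial_elementary (lang r) ?M (insert x A) (g(x := y))"
      unfolding partial_elementary_def
    proof (intro conjI ballI allI impI)
      show "(g(x := y)) ` insert x A \<subseteq> univ ?M" using ag unfolding agree_def by (simp add: struc_def)
      fix \<phi> :: "('g, 's, nat) fm" and e :: "nat \<Rightarrow> 'm"
      assume \<phi>: "\<phi> \<in> formulas (lang r)" and e: "e ` fv \<phi> \<subseteq> insert x A"
      have "agree (fv \<phi>) e (g(x := y) \<circ> e)"
        unfolding agree_def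
      proof (intro conjI allI impI ballI)
        show "e ` fv \<phi> \<subseteq> V" using e AV x by blast
        show "(g(x := y) \<circ> e) ` fv \<phi> \<subseteq> V"
        proof (rule image_subsetI)
          fix v assume "v \<in> fv \<phi>"
          then have "e v \<in> insert x A" using e by blast
          from agreeD(2)[OF ag this] show "(g(x := y) \<circ> e) v \<in> V" by (simp only: comp_def)
        qed
        show "e v = e w \<longleftrightarrow> (g(x := y) \<circ> e) v = (g(x := y) \<circ> e) w"
          if "v \<in> fv \<phi>" "w \<in> fv \<phi>" for v w
        proof -
          have "e v \<in> insert x A" "e w \<in> insert x A" using e that by blast+
          from agreeD(3)[OF ag this] show ?thesis by (simp only: comp_def)
        qed
        fix vs assume vs: "set vs \<subseteq> fv \<phi> \<and> length vs = n"
        then have "set (map e vs) \<subseteq> insert x A" "length (map e vs) = n" using e by auto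
        then have "R (map (\<lambda>v. v) (map e vs)) \<longleftrightarrow> R (map (g(x := y)) (map e vs))"
          by (rule agreeD(4)[OF ag])
        then show "R (map e vs) \<longleftrightarrow> R (map (g(x := y) \<circ> e) vs)" by (simp only: map_map list.map_ident)
      qed
      then show "sat ?M e \<phi> \<longleftrightarrow> sat ?M (g(x := y) \<circ> e) \<phi>"
        using \<phi> by (intro agree_sat) (simp_all add: formulas_def)
    qed
    then show ?thesis using False by (intro exI[of _ y]) auto
  qed
qed

end

section \<open>From the Ramsey property to indiscernibles\<close>

text \<open>The embedding Ramsey property read inside \<open>N\<close>, on the type of
  \<open>N\<close>, so that iterating it involves no copies between types.\<close>

definition arrows_in :: "('f, 'r) language \<Rightarrow> ('f, 'r, 'i) struct \<Rightarrow> bool" where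
  "arrows_in L N \<longleftrightarrow> (\<forall>A B. substructure L A B \<and> substructure L B N \<and> finite (univ B) \<longrightarrow>
     (\<exists>C. substructure L C N \<and> finite (univ C) \<and> ramsey_arrow L C B A))"

lemma ERP_imp_arrows_in:
  fixes N :: "('f, 'r, 'i) struct"
  assumes N: "is_struct L N" and lf: "locally_finite L N"
    and ERP: "ERP L (Age L N :: ('f, 'r, 'c::infinite) struct set)"
  shows "arrows_in L N"
  unfolding arrows_in_def
proof (intro allI impI)
  fix A B assume "substructure L A B \<and> substructure L B N \<and> finite (univ B)"
  then have AB: "substructure L A B" and BN: "substructure L B N" and fin: "finite (univ B)" by simp_all
  have A: "is_struct L A" and B: "is_struct L B" using AB by (simp_all add: substructure_def)
  obtain B' :: "('f, 'r, 'c) struct" and k where B': "is_struct L B'" and k: "embedding L B B' k"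
    "k ` univ B = univ B'" by (rule finite_struct_copy[OF B fin])
  have kA: "embedding L A B' k"
    using embedding_comp[OF embedding_substructure[OF AB] k(1)] by (simp add: comp_def)
  \<comment> \<open>\<open>ERP\<close> speaks of substructures, so the copy of \<open>A\<close> is
    taken as its image inside the copy of \<open>B\<close>.\<close>
  define A' where "A' = B'\<lparr>univ := k ` univ A\<rparr>"
  have A': "is_struct L A'" unfolding A'_def by (rule is_struct_image[OF A kA])
  have "k ` univ A \<subseteq> univ B'" using embeddingD(1)[OF kA] by blast
  then have A'B': "substructure L A' B'"
    using substructure_restrict[OF B' A'[unfolded A'_def]] by (simp add: A'_def)
  have kA': "embedding L A A' k"
    unfolding A'_def by (rule embedding_restrict_codomain[OF kA subset_refl])
  have B'N: "embedding L B' N ((\<lambda>x. x) \<circ> the_inv_into (univ B) k)"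
    by (rule embedding_comp[OF embedding_the_inv_into(1)[OF B k] embedding_substructure[OF BN]])
  have A'N: "embedding L A' N (((\<lambda>x. x) \<circ> the_inv_into (univ B) k) \<circ> (\<lambda>x. x))"
    by (rule embedding_comp[OF embedding_substructure[OF A'B'] B'N])
  have "finite (univ B')" using fin k(2) by (metis finite_imageI)
  moreover from this have "finite (univ A')"
    using A'B' by (auto simp: substructure_def intro: finite_subset)
  ultimately have "A' \<in> Age L N" "B' \<in> Age L N"
    using A' B' B'N A'N by (auto simp: Age_iff[OF N lf])
  then obtain C' :: "('f, 'r, 'c) struct" where C': "C' \<in> Age L N" "ramsey_arrow L C' B' A'"
    using ERP A'B' unfolding ERP_def by blast
  obtain m where C'1: "is_struct L C'" "finite (univ C')" and m: "embedding L C' N m"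
    using C'(1) by (auto simp: Age_iff[OF N lf])
  define C where "C = N\<lparr>univ := m ` univ C'\<rparr>"
  have C: "is_struct L C" unfolding C_def by (rule is_struct_image[OF C'1(1) m])
  have "m ` univ C' \<subseteq> univ N" using embeddingD(1)[OF m] by blast
  then have CN: "substructure L C N"
    using substructure_restrict[OF N C[unfolded C_def]] by (simp add: C_def)
  have mC: "embedding L C' C m"
    unfolding C_def by (rule embedding_restrict_codomain[OF m subset_refl])
  have "ramsey_arrow L C B A"
    by (rule ramsey_arrow_transfer[OF C'(2) A' B' A B kA' _ k(1) mC]) (simp add: A'_def)
  moreover have "finite (univ C)" using C'1(2) by (simp add: C_def)
  ultimately show "\<exists>C. substructure L C N \<and> finite (univ C) \<and> ramsey_arrow L C B A"
    using CN by blast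
qed

text \<open>Induction on \<open>Q\<close>. Let \<open>A\<close> be generated by one tuple of the
  type of \<open>is\<close>; the tuples of that type in \<open>B\<close> are its images under
  embeddings of \<open>A\<close>, so \<open>P\<close> colours these embeddings. The arrow first
  provides \<open>C\<close>, the induction hypothesis is applied to \<open>C\<close> instead of
  \<open>B\<close>, and a copy of \<open>B\<close> inside the resulting copy of \<open>C\<close>
  inherits homogeneity for the rest of \<open>Q\<close>.\<close>

lemma homogeneous_copy:
  fixes N :: "('f, 'r, 'i) struct" and Q :: "('i list \<times> ('i list \<Rightarrow> bool)) set"
  assumes N: "is_struct L N" and arrows: "arrows_in L N" and Q: "finite Q"
    and B: "substructure L B N" "finite (univ B)"
  shows "\<exists>e. embedding L B N e \<and> (\<forall>is P js js'. (is, P) \<in> Q \<longrightarrow>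
    set js \<subseteq> univ B \<longrightarrow> set js' \<subseteq> univ B \<longrightarrow> length js = length is \<longrightarrow> length js' = length is \<longrightarrow>
    qftp L N js = qftp L N is \<longrightarrow> qftp L N js' = qftp L N is \<longrightarrow> P (map e js) = P (map e js'))"
  using Q B
proof (induction arbitrary: B)
  case empty
  then show ?case using embedding_substructure by blast
next
  case (insert q Q)
  obtain "is" P where q: "q = (is, P)" by (cases q)
  define typed where "typed js \<longleftrightarrow> set js \<subseteq> univ B \<and> length js = length is \<and> qftp L N js = qftp L N is" for js
  have Bs: "is_struct L B" and BsubN: "univ B \<subseteq> univ N"
    using insert.prems(1) by (simp_all add: substructure_def)
  \<comment> \<open>The empty tuple is set aside because it may generate nothing, while structures
    are nonempty. If it is the only tuple of the type, or there is none, \<open>P\<close> has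
    nothing to separate.\<close>
  show ?case
  proof (cases "\<exists>js. typed js \<and> js \<noteq> []")
    case False
    from insert.IH[OF insert.prems] obtain e where e: "embedding L B N e"
      and hom: "\<forall>is P js js'. (is, P) \<in> Q \<longrightarrow>
    set js \<subseteq> univ B \<longrightarrow> set js' \<subseteq> univ B \<longrightarrow> length js = length is \<longrightarrow> length js' = length is \<longrightarrow>
    qftp L N js = qftp L N is \<longrightarrow> qftp L N js' = qftp L N is \<longrightarrow> P (map e js) = P (map e js')"
      by (elim exE conjE)
    have "js = []" if "set js \<subseteq> univ B" "length js = length is" "qftp L N js = qftp L N is" for js
      using False that by (auto simp: typed_def)
    then show ?thesis using e hom unfolding q
      by (intro exI[of _ e] conjI allI impI) (simp, metis (no_types, lifting) insert_iff prod.inject)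
  next
    case True
    then obtain js0 where js0: "typed js0" "js0 \<noteq> []" by blast
    have js0B: "set js0 \<subseteq> univ B" using js0 by (simp add: typed_def)
    define A where "A = N\<lparr>univ := generated L N (set js0)\<rparr>"
    have A: "is_struct L A" unfolding A_def using js0(2) by (intro is_struct_generated) simp
    have AB: "univ A \<subseteq> univ B" unfolding A_def using generated_least[OF insert.prems(1) js0B] by simp
    have "substructure L A N"
      using substructure_restrict[OF N A[unfolded A_def]] AB BsubN by (simp add: A_def)
    then have AsubB: "substructure L A B"
      using insert.prems(1) A AB unfolding substructure_def by (metis subset_trans)
    obtain C where C: "substructure L C N" "finite (univ C)" "ramsey_arrow L C B A"
      using arrows AsubB insert.prems unfolding arrows_in_def by blast
    from insert.IH[OF C(1,2)] obtain e' where e': "embedding L C N e'"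
      and hom: "\<forall>is P js js'. (is, P) \<in> Q \<longrightarrow>
    set js \<subseteq> univ C \<longrightarrow> set js' \<subseteq> univ C \<longrightarrow> length js = length is \<longrightarrow> length js' = length is \<longrightarrow>
    qftp L N js = qftp L N is \<longrightarrow> qftp L N js' = qftp L N is \<longrightarrow> P (map e' js) = P (map e' js')"
      by (elim exE conjE)
    \<comment> \<open>An embedding is coloured by \<open>P\<close> at the final position of the
      tuple in \<open>N\<close>, after the copy \<open>e'\<close> of \<open>C\<close> has been
      fixed.\<close>
    define \<chi> where "\<chi> f = (if P (map (e' \<circ> f) js0) then 1 else 0 :: nat)" for f
    have "\<chi> ` embs L A C \<subseteq> {0, 1}" by (auto simp: \<chi>_def)
    then obtain e c where e: "e \<in> embs L B C" and c: "\<forall>f\<in>embs L A B. \<chi> (compose (univ A) e f) = c"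
      using C(3) unfolding ramsey_arrow_def by blast
    have eBC: "embedding L B C e" using e by (simp add: embs_def)
    have eBN: "embedding L B N e"
      using embedding_comp[OF eBC embedding_substructure[OF C(1)]] by (simp add: comp_def)
    have col: "(if P (map (e' \<circ> e) js) then 1 else 0) = c" if "typed js" for js
    proof -
      have js: "set js \<subseteq> univ B" "length js = length js0" "qftp L N js0 = qftp L N js"
        using that js0(1) by (simp_all add: typed_def)
      have jsN: "set js \<subseteq> univ N" using js(1) BsubN by blast
      obtain f where f: "embedding L A N f" "map f js0 = js"
        "f ` generated L N (set js0) \<subseteq> generated L N (set js)"
        using qftp_eq_embedding[OF N jsN js(2,3)] unfolding A_def by blast
      have "f ` univ A \<subseteq> univ B"
        using f(3) generated_least[OF insert.prems(1) js(1)] unfolding A_def by simp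
      then have "embedding L A B f" by (rule embedding_into_substructure[OF insert.prems(1) f(1)])
      then have "restrict f (univ A) \<in> embs L A B" by (rule restrict_embs[OF A])
      then have "\<chi> (compose (univ A) e (restrict f (univ A))) = c" using c by blast
      moreover have "map (e' \<circ> compose (univ A) e (restrict f (univ A))) js0 = map (e' \<circ> e) js"
      proof -
        have "x \<in> univ A" if "x \<in> set js0" for x
          using that by (simp add: A_def generated.base)
        then show ?thesis unfolding f(2)[symmetric] by (simp add: compose_def)
      qed
      ultimately show ?thesis by (simp only: \<chi>_def)
    qed
    have "embedding L B N (e' \<circ> e)" by (rule embedding_comp[OF eBC e'])
    moreover have "P' (map (e' \<circ> e) js) = P' (map (e' \<circ> e) js')"
      if a: "(is', P') \<in> insert q Q" "set js \<subseteq> univ B" "set js' \<subseteq> univ B" "length js = length is'"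
        "length js' = length is'" "qftp L N js = qftp L N is'" "qftp L N js' = qftp L N is'" for is' P' js js'
    proof (cases "(is', P') = q")
      case True
      then have "typed js" "typed js'" "P' = P" using a by (simp_all add: typed_def q)
      then show ?thesis using col[of js] col[of js'] by (auto split: if_splits)
    next
      case False
      then have "(is', P') \<in> Q" using a(1) by simp
      moreover have "set (map e xs) \<subseteq> univ C" if "set xs \<subseteq> univ B" for xs
        using that embeddingD(1)[OF eBC] by auto
      moreover have "qftp L N (map e xs) = qftp L N xs" if "set xs \<subseteq> univ B" for xs
        using qftp_embedding[OF Bs eBN that] qftp_substructure[OF insert.prems(1) that] by simp
      ultimately have "P' (map e' (map e js)) = P' (map e' (map e js'))"
        using hom[rule_format, of is' P' "map e js" "map e js'"] a by simp
      then show ?thesis by simp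
    qed
    ultimately show ?thesis by (intro exI[of _ "e' \<circ> e"]) blast
  qed
qed

definition fiff :: "('f, 'r, 'v) fm \<Rightarrow> ('f, 'r, 'v) fm \<Rightarrow> ('f, 'r, 'v) fm" where
  "fiff \<phi> \<psi> = Conj (Neg (Conj \<phi> (Neg \<psi>))) (Neg (Conj \<psi> (Neg \<phi>)))"

lemma fiff_simps:
  "wf_fm L (fiff \<phi> \<psi>) \<longleftrightarrow> wf_fm L \<phi> \<and> wf_fm L \<psi>"
  "fv (fiff \<phi> \<psi>) = fv \<phi> \<union> fv \<psi>"
  "sat M e (fiff \<phi> \<psi>) \<longleftrightarrow> (sat M e \<phi> \<longleftrightarrow> sat M e \<psi>)"
  by (auto simp: fiff_def)

section \<open>The type of an indiscernible sequence based on \<open>a\<close>\<close>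

lemma modelling_instance:
  fixes N :: "('f, 'r, 'i) struct" and M :: "('g, 's, 'm) struct" and X :: "'x set"
  assumes N: "is_struct L N" and infN: "infinite (univ N)" and lf: "locally_finite L N"
    and arrows: "arrows_in L N"
    and \<kappa>: "Card_order \<kappa>" "|univ N| <o \<kappa>" "|X| <o \<kappa>"
    and M: "is_struct LT M" and sat: "saturated \<kappa> LT M"
    and a: "\<forall>i\<in>univ N. \<forall>\<xi>\<in>X. a i \<xi> \<in> univ M"
  shows "\<exists>b. (\<forall>i\<in>univ N. \<forall>\<xi>\<in>X. b i \<xi> \<in> univ M) \<and>
           indiscernible L N LT M X b \<and> based_on L N LT M X b a"
proof -
  have infty: "infinite (UNIV :: ('i \<times> 'x) set)"
    using infN by (simp add: finite_prod) (metis finite_subset subset_UNIV)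
  have neM: "univ M \<noteq> {}" by (rule is_structD(1)[OF M])
  define V where "V = univ N \<times> X"
  \<comment> \<open>The entries of the sequence become global variables \<open>(i, \<xi>)\<close>.
    The map is not injective when \<open>is\<close> repeats an index, which is why
    \<open>ren\<close> has to avoid capture.\<close>
  define \<sigma> :: "'i list \<Rightarrow> nat \<times> 'x \<Rightarrow> 'i \<times> 'x" where "\<sigma> is = (\<lambda>(k, \<xi>). (is ! k, \<xi>))" for "is"
  have \<sigma>V: "\<sigma> is v \<in> V" if "v \<in> seq_vars (length is) X" "set is \<subseteq> univ N" for "is" v
    using that nth_mem by (fastforce simp: \<sigma>_def V_def seq_vars_def)
  have sat\<sigma>: "sat M e (ren (\<sigma> is) \<phi>) \<longleftrightarrow> sat M (seq_val (\<lambda>i \<xi>. e (i, \<xi>)) is) \<phi>" for e "is" and \<phi> :: "('g, 's, nat \<times> 'x) fm"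
  proof -
    have "e \<circ> \<sigma> is = seq_val (\<lambda>i \<xi>. e (i, \<xi>)) is" by (auto simp: \<sigma>_def seq_val_def fun_eq_iff)
    then show ?thesis by (simp only: sat_ren[OF infty])
  qed
  define T1 where "T1 = {(\<phi>, is, js). \<phi> \<in> formulas LT \<and> fv \<phi> \<subseteq> seq_vars (length is) X \<and>
    set is \<subseteq> univ N \<and> set js \<subseteq> univ N \<and> length js = length is \<and> qftp L N is = qftp L N js}"
  define \<gamma>1 where "\<gamma>1 = (\<lambda>(\<phi> :: ('g, 's, nat \<times> 'x) fm, is, js). fiff (ren (\<sigma> is) \<phi>) (ren (\<sigma> js) \<phi>))"
  \<comment> \<open>The Ehrenfeucht-Mostowski type of \<open>a\<close>.\<close>
  define T2 where "T2 = {(\<psi>, is). \<psi> \<in> formulas LT \<and> fv \<psi> \<subseteq> seq_vars (length is) X \<and> set is \<subseteq> univ N \<and>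
    (\<forall>js. set js \<subseteq> univ N \<and> length js = length is \<and> qftp L N js = qftp L N is \<longrightarrow> sat M (seq_val a js) \<psi>)}"
  define \<gamma>2 where "\<gamma>2 = (\<lambda>(\<psi> :: ('g, 's, nat \<times> 'x) fm, is). ren (\<sigma> is) \<psi>)"
  have "\<exists>E. range E \<subseteq> univ M \<and> (\<forall>\<phi>\<in>\<gamma>1 ` T1 \<union> \<gamma>2 ` T2. sat M E \<phi>)"
  proof (rule saturated_realises[OF neM sat])
    show "\<gamma>1 ` T1 \<union> \<gamma>2 ` T2 \<subseteq> formulas LT"
      by (auto simp: \<gamma>1_def \<gamma>2_def T1_def T2_def formulas_def fiff_simps wf_ren)
    show "fv \<phi> \<subseteq> V" if "\<phi> \<in> \<gamma>1 ` T1 \<union> \<gamma>2 ` T2" for \<phi>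
    proof -
      have im: "\<sigma> is ` fv \<psi> \<subseteq> V" if "fv \<psi> \<subseteq> seq_vars (length is) X" "set is \<subseteq> univ N" for "is" and \<psi> :: "('g, 's, nat \<times> 'x) fm"
        using \<sigma>V that by blast
      from \<open>\<phi> \<in> \<gamma>1 ` T1 \<union> \<gamma>2 ` T2\<close> show ?thesis
      proof
        assume "\<phi> \<in> \<gamma>1 ` T1"
        then obtain \<psi> "is" js where t: "(\<psi>, is, js) \<in> T1" "\<phi> = \<gamma>1 (\<psi>, is, js)" by auto
        then have "fv \<phi> = \<sigma> is ` fv \<psi> \<union> \<sigma> js ` fv \<psi>" by (simp add: \<gamma>1_def fiff_simps fv_ren[OF infty])
        moreover have "\<sigma> is ` fv \<psi> \<subseteq> V" "\<sigma> js ` fv \<psi> \<subseteq> V"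
          using t(1) by (intro im; simp add: T1_def)+
        ultimately show ?thesis by simp
      next
        assume "\<phi> \<in> \<gamma>2 ` T2"
        then obtain \<psi> "is" where t: "(\<psi>, is) \<in> T2" "\<phi> = \<gamma>2 (\<psi>, is)" by auto
        then have "fv \<phi> = \<sigma> is ` fv \<psi>" by (simp add: \<gamma>2_def fv_ren[OF infty])
        moreover have "\<sigma> is ` fv \<psi> \<subseteq> V" using t(1) by (intro im) (simp_all add: T2_def)
        ultimately show ?thesis by simp
      qed
    qed
    show "|V| <o \<kappa>"
    proof -
      have inf\<kappa>: "infinite (Field \<kappa>)"
      proof -
        have "|univ N| \<le>o |Field \<kappa>|"
          using ordLess_imp_ordLeq[OF \<kappa>(2)] ordIso_symmetric[OF card_of_Field_ordIso[OF \<kappa>(1)]]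
          by (rule ordLeq_ordIso_trans)
        then show ?thesis using infN card_of_ordLeq_infinite by blast
      qed
      have "|univ N <+> X| <o \<kappa>" by (rule card_of_Plus_ordLess_infinite_Field[OF inf\<kappa> \<kappa>])
      moreover have "|V| \<le>o |univ N <+> X|"
      proof -
        have "infinite (univ N <+> X)" using infN by simp
        then show ?thesis
          unfolding V_def by (intro card_of_Times_ordLeq_infinite_Field)
            (simp_all add: Field_card_of card_of_card_order_on card_of_Plus1 card_of_Plus2)
      qed
      ultimately show ?thesis using ordLeq_ordLess_trans by blast
    qed
    fix \<Gamma>0 assume \<Gamma>0: "finite \<Gamma>0" "\<Gamma>0 \<subseteq> \<gamma>1 ` T1 \<union> \<gamma>2 ` T2"
    obtain S1 where S1: "finite S1" "S1 \<subseteq> T1" "\<Gamma>0 \<inter> \<gamma>1 ` T1 = \<gamma>1 ` S1"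
      using \<Gamma>0(1) finite_subset_image[of "\<Gamma>0 \<inter> \<gamma>1 ` T1" \<gamma>1 T1] by auto
    obtain S2 where S2: "finite S2" "S2 \<subseteq> T2" "\<Gamma>0 \<inter> \<gamma>2 ` T2 = \<gamma>2 ` S2"
      using \<Gamma>0(1) finite_subset_image[of "\<Gamma>0 \<inter> \<gamma>2 ` T2" \<gamma>2 T2] by auto
    \<comment> \<open>\<open>i0\<close> keeps \<open>F\<close> nonempty, so that \<open>B\<close> is
      a structure even if no index occurs in \<open>\<Gamma>0\<close>.\<close>
    obtain i0 where i0: "i0 \<in> univ N" using is_structD(1)[OF N] by blast
    define F where "F = {i0} \<union> (\<Union>(\<phi>, is, js)\<in>S1. set is \<union> set js) \<union> (\<Union>(\<psi>, is)\<in>S2. set is)"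
    have "finite F" unfolding F_def using S1(1) S2(1) by auto
    have FN: "F \<subseteq> univ N" unfolding F_def using i0 S1(2) S2(2) by (auto simp: T1_def T2_def)
    define B where "B = N\<lparr>univ := generated L N F\<rparr>"
    have "is_struct L B" unfolding B_def by (rule is_struct_generated) (simp add: F_def)
    then have B: "substructure L B N"
      using substructure_restrict[OF N] generated_subset[OF N FN] by (simp add: B_def)
    have finB: "finite (univ B)" using lf \<open>finite F\<close> FN by (simp add: B_def locally_finite_def)
    have FB: "F \<subseteq> univ B" by (auto simp: B_def intro: generated.base)
    \<comment> \<open>Homogeneity is demanded for the instances of indiscernibility; the instances
      of \<open>T2\<close> survive under every embedding, since it preserves quantifier-free
      types.\<close>
    define Q where "Q = (\<lambda>(\<phi>, is, js). (is, \<lambda>ks. sat M (seq_val a ks) \<phi>)) ` S1"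
    have "finite Q" using S1(1) by (simp add: Q_def)
    from homogeneous_copy[OF N arrows this B finB] obtain e where e: "embedding L B N e"
      and hom: "\<forall>is P js js'. (is, P) \<in> Q \<longrightarrow>
    set js \<subseteq> univ B \<longrightarrow> set js' \<subseteq> univ B \<longrightarrow> length js = length is \<longrightarrow> length js' = length is \<longrightarrow>
    qftp L N js = qftp L N is \<longrightarrow> qftp L N js' = qftp L N is \<longrightarrow> P (map e js) = P (map e js')"
      by (elim exE conjE)
    obtain d where d: "d \<in> univ M" using neM by blast
    define E where "E = (\<lambda>(i, \<xi>). if i \<in> univ B \<and> \<xi> \<in> X then a (e i) \<xi> else d)"
    have "E (i, \<xi>) \<in> univ M" for i \<xi>
      using a d embeddingD(1)[OF e] by (simp add: E_def)
    then have EM: "range E \<subseteq> univ M" by auto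
    have satE: "sat M E (ren (\<sigma> is) \<phi>) \<longleftrightarrow> sat M (seq_val a (map e is)) \<phi>"
      if in_B: "fv \<phi> \<subseteq> seq_vars (length is) X" "set is \<subseteq> univ B" for "is" and \<phi> :: "('g, 's, nat \<times> 'x) fm"
      unfolding sat\<sigma>
    proof (rule sat_cong)
      fix v assume "v \<in> fv \<phi>"
      then obtain k \<xi> where "v = (k, \<xi>)" "k < length is" "\<xi> \<in> X"
        using in_B(1) by (auto simp: seq_vars_def)
      moreover from this have "is ! k \<in> univ B" using in_B(2) nth_mem by blast
      ultimately show "seq_val (\<lambda>i \<xi>. E (i, \<xi>)) is v = seq_val a (map e is) v"
        by (simp add: seq_val_def E_def)
    qed
    have "sat M E \<phi>" if "\<phi> \<in> \<Gamma>0" for \<phi>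
    proof -
      have "\<phi> \<in> \<gamma>1 ` S1 \<or> \<phi> \<in> \<gamma>2 ` S2" using that \<Gamma>0(2) S1(3) S2(3) by blast
      then show ?thesis
      proof
        assume "\<phi> \<in> \<gamma>1 ` S1"
        then obtain \<psi> "is" js where t: "(\<psi>, is, js) \<in> S1" "\<phi> = \<gamma>1 (\<psi>, is, js)" by auto
        then have T: "(\<psi>, is, js) \<in> T1" using S1(2) by blast
        have "set is \<union> set js \<subseteq> F" using t(1) by (force simp: F_def)
        then have B': "set is \<subseteq> univ B" "set js \<subseteq> univ B" using FB by auto
        have "(is, \<lambda>ks. sat M (seq_val a ks) \<psi>) \<in> Q" using t(1) by (force simp: Q_def)
        from hom[rule_format, OF this, of "is" js] have
          "sat M (seq_val a (map e is)) \<psi> \<longleftrightarrow> sat M (seq_val a (map e js)) \<psi>"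
          using B' T by (simp add: T1_def)
        then show ?thesis using T B' satE[of \<psi> "is"] satE[of \<psi> js]
          by (simp add: t(2) \<gamma>1_def fiff_simps T1_def)
      next
        assume "\<phi> \<in> \<gamma>2 ` S2"
        then obtain \<psi> "is" where t: "(\<psi>, is) \<in> S2" "\<phi> = \<gamma>2 (\<psi>, is)" by auto
        then have T: "(\<psi>, is) \<in> T2" using S2(2) by blast
        have "set is \<subseteq> F" using t(1) by (force simp: F_def)
        then have B': "set is \<subseteq> univ B" using FB by auto
        have "set (map e is) \<subseteq> univ N" using B' embeddingD(1)[OF e] by auto
        moreover have "qftp L N (map e is) = qftp L N is"
          using qftp_embedding[OF _ e B'] qftp_substructure[OF B B'] B by (simp add: substructure_def)
        ultimately have "sat M (seq_val a (map e is)) \<psi>"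
          using T unfolding T2_def by simp
        then show ?thesis using T B' satE[of \<psi> "is"] by (simp add: t(2) \<gamma>2_def T2_def)
      qed
    qed
    then show "\<exists>e. range e \<subseteq> univ M \<and> (\<forall>\<phi>\<in>\<Gamma>0. sat M e \<phi>)" using EM by blast
  qed
  then obtain E where E: "range E \<subseteq> univ M" "\<forall>\<phi>\<in>\<gamma>1 ` T1 \<union> \<gamma>2 ` T2. sat M E \<phi>" by (elim exE conjE)
  define b where "b i \<xi> = E (i, \<xi>)" for i \<xi>
  have satb: "sat M E (ren (\<sigma> is) \<phi>) \<longleftrightarrow> sat M (seq_val b is) \<phi>" for "is" and \<phi> :: "('g, 's, nat \<times> 'x) fm"
    unfolding sat\<sigma> b_def ..
  have "indiscernible L N LT M X b"
    unfolding indiscernible_def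
  proof (intro allI impI)
    fix n "is" js assume h: "is \<in> lists (univ N) \<and> js \<in> lists (univ N) \<and> length is = n \<and> length js = n \<and>
        qftp L N is = qftp L N js"
    have "sat M (seq_val b is) \<phi> \<longleftrightarrow> sat M (seq_val b js) \<phi>"
      if \<phi>: "\<phi> \<in> formulas LT" "fv \<phi> \<subseteq> seq_vars n X" for \<phi>
    proof -
      have "(\<phi>, is, js) \<in> T1" using h \<phi> by (auto simp: T1_def)
      then have "sat M E (\<gamma>1 (\<phi>, is, js))" using E(2) by blast
      then show ?thesis by (simp add: \<gamma>1_def fiff_simps satb)
    qed
    then show "tp LT M (seq_vars n X) (seq_val b is) = tp LT M (seq_vars n X) (seq_val b js)"
      unfolding tp_def by blast
  qed
  moreover have "based_on L N LT M X b a"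
    unfolding based_on_def
  proof (intro allI impI)
    fix \<Delta> :: "('g, 's, nat \<times> 'x) fm set" and n "is"
    assume h: "finite \<Delta> \<and> \<Delta> \<subseteq> formulas LT \<and> is \<in> lists (univ N) \<and> length is = n"
    obtain ds where ds: "set ds = {\<phi> \<in> \<Delta>. fv \<phi> \<subseteq> seq_vars n X}"
      using h finite_list[of "{\<phi> \<in> \<Delta>. fv \<phi> \<subseteq> seq_vars n X}"] by auto
    define lit where "lit \<phi> = (if sat M (seq_val b is) \<phi> then \<phi> else Neg \<phi>)" for \<phi>
    \<comment> \<open>\<open>\<theta>\<close> denies that all formulas of \<open>ds\<close> have the
      truth values they have for \<open>b\<close> at \<open>is\<close>. Were it true of
      \<open>a\<close> at every \<open>js\<close> of the right type, it would lie in
      \<open>T2\<close> and hold for \<open>b\<close> at \<open>is\<close>, which is absurd.\<close>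
    define \<theta> where "\<theta> = Neg (conjs (0, undefined) (map lit ds))"
    have lit: "wf_fm LT (lit \<phi>) \<longleftrightarrow> wf_fm LT \<phi>" "fv (lit \<phi>) = fv \<phi>"
      "sat M e (lit \<phi>) \<longleftrightarrow> (sat M e \<phi> \<longleftrightarrow> sat M (seq_val b is) \<phi>)" for \<phi> e
      by (simp_all add: lit_def)
    have \<theta>: "\<theta> \<in> formulas LT" "fv \<theta> \<subseteq> seq_vars n X"
      using h ds by (auto simp: \<theta>_def formulas_def wf_conjs fv_conjs lit)
    have sat\<theta>: "sat M e \<theta> \<longleftrightarrow> (\<exists>\<phi>\<in>set ds. sat M e \<phi> \<noteq> sat M (seq_val b is) \<phi>)" for e
      by (auto simp: \<theta>_def sat_conjs[OF neM] lit)
    have "\<exists>js. set js \<subseteq> univ N \<and> length js = n \<and> qftp L N js = qftp L N is \<and> \<not> sat M (seq_val a js) \<theta>"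
    proof (rule ccontr)
      assume "\<not> ?thesis"
      then have "(\<theta>, is) \<in> T2" using h \<theta> by (auto simp: T2_def)
      then have "sat M E (\<gamma>2 (\<theta>, is))" using E(2) by blast
      then have "sat M (seq_val b is) \<theta>" by (simp add: \<gamma>2_def satb)
      then show False by (simp add: sat\<theta>)
    qed
    then obtain js where js: "set js \<subseteq> univ N" "length js = n" "qftp L N js = qftp L N is"
      "\<not> sat M (seq_val a js) \<theta>" by (elim exE conjE)
    have eq: "sat M (seq_val a js) \<phi> \<longleftrightarrow> sat M (seq_val b is) \<phi>"
      if "\<phi> \<in> \<Delta>" "fv \<phi> \<subseteq> seq_vars n X" for \<phi>
      using js(4) ds that by (auto simp: sat\<theta>)
    have "tp_restrict \<Delta> LT M (seq_vars n X) (seq_val b is) = tp_restrict \<Delta> LT M (seq_vars n X) (seq_val a js)"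
      unfolding tp_restrict_def tp_def using eq by auto
    then show "\<exists>js\<in>lists (univ N). length js = n \<and> qftp L N is = qftp L N js \<and>
      tp_restrict \<Delta> LT M (seq_vars n X) (seq_val b is) = tp_restrict \<Delta> LT M (seq_vars n X) (seq_val a js)"
      using js by (intro bexI[of _ js]) auto
  qed
  moreover have "\<forall>i\<in>univ N. \<forall>\<xi>\<in>X. b i \<xi> \<in> univ M" using E(1) by (auto simp: b_def)
  ultimately show ?thesis by blast
qed

section \<open>From indiscernibles to the Ramsey property\<close>

text \<open>Compactness: bad colourings of the finite substructures are glued along an ultrafilter
  on the finite subsets of \<open>N\<close>.\<close>

lemma bad_colouring_exists:
  fixes N :: "('f, 'r, 'i) struct" and A :: "('f, 'r, 'a) struct" and B :: "('f, 'r, 'b) struct"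
  assumes N: "is_struct L N" and lf: "locally_finite L N"
    and A: "is_struct L A" "finite (univ A)" and B: "is_struct L B" "finite (univ B)"
    and no: "\<And>C. substructure L C N \<Longrightarrow> finite (univ C) \<Longrightarrow> \<not> ramsey_arrow L C B A"
  shows "\<exists>K. \<forall>e. embedding L B N e \<longrightarrow>
    (\<exists>f\<in>embs L A B. \<exists>f'\<in>embs L A B. compose (univ A) e f \<in> K \<and> compose (univ A) e f' \<notin> K)"
proof -
  define G where "G S = N\<lparr>univ := generated L N S\<rparr>" for S
  define bad where "bad \<chi> S \<longleftrightarrow> \<chi> ` embs L A (G S) \<subseteq> {0, 1 :: nat} \<and>
      (\<forall>e\<in>embs L B (G S). \<forall>c. \<exists>f\<in>embs L A B. \<chi> (compose (univ A) e f) \<noteq> c)" for \<chi> S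
  have ex_bad: "\<exists>\<chi>. bad \<chi> S"
    if S: "finite S" "S \<subseteq> univ N" "S \<noteq> {}" for S
  proof -
    have "is_struct L (G S)" unfolding G_def using S(3) by (rule is_struct_generated)
    then have "substructure L (G S) N"
      using substructure_restrict[OF N] generated_subset[OF N S(2)] by (simp add: G_def)
    moreover have "finite (univ (G S))" using lf S by (simp add: G_def locally_finite_def)
    ultimately have "\<not> ramsey_arrow L (G S) B A" by (rule no)
    then show ?thesis unfolding ramsey_arrow_def bad_def by simp
  qed
  define \<chi> where "\<chi> S = (SOME \<chi>. bad \<chi> S)" for S
  have \<chi>: "\<chi> S ` embs L A (G S) \<subseteq> {0, 1}"
      "e \<in> embs L B (G S) \<Longrightarrow> \<exists>f\<in>embs L A B. \<chi> S (compose (univ A) e f) \<noteq> c"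
    if "finite S" "S \<subseteq> univ N" "S \<noteq> {}" for S e c
  proof -
    have b: "bad (\<chi> S) S" unfolding \<chi>_def by (rule someI_ex[OF ex_bad[OF that]])
    show "\<chi> S ` embs L A (G S) \<subseteq> {0, 1}" by (rule conjunct1[OF b[unfolded bad_def]])
    show "\<exists>f\<in>embs L A B. \<chi> S (compose (univ A) e f) \<noteq> c" if "e \<in> embs L B (G S)"
      using conjunct2[OF b[unfolded bad_def]] that by simp
  qed
  \<comment> \<open>These sets ensure that any given finite part of \<open>N\<close> is contained in
    \<open>W\<close>-almost every \<open>S\<close>.\<close>
  define up where "up x = {S. finite S \<and> S \<subseteq> univ N \<and> x \<in> S}" for x
  have "\<Inter>H \<noteq> {}" if H: "finite H \<and> H \<subseteq> up ` univ N" for H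
  proof -
    obtain S where S: "finite S" "S \<subseteq> univ N" "H = up ` S" using H by (meson finite_subset_image)
    then have "S \<in> \<Inter>H" by (auto simp: up_def)
    then show ?thesis by blast
  qed
  then have "\<forall>H. finite H \<and> H \<subseteq> up ` univ N \<longrightarrow> \<Inter>H \<noteq> {}" by blast
  from ultrafilter_exists[OF this] obtain W where W: "up ` univ N \<subseteq> W"
    and fip: "\<forall>H. finite H \<and> H \<subseteq> W \<longrightarrow> \<Inter>H \<noteq> {}" and um: "\<forall>Y. Y \<in> W \<or> - Y \<in> W"
    by (elim exE conjE)
  \<comment> \<open>The limit of the colourings \<open>\<chi> S\<close> along \<open>W\<close>, kept
    as the set of maps of colour 1.\<close>
  define K where "K = {g. {S. \<chi> S g = 1} \<in> W}"
  have "\<exists>f\<in>embs L A B. \<exists>f'\<in>embs L A B. compose (univ A) e f \<in> K \<and> compose (univ A) e f' \<notin> K"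
    if e: "embedding L B N e" for e
  proof (rule ccontr)
    assume "\<not> ?thesis"
    then have const: "compose (univ A) e f \<in> K \<longleftrightarrow> compose (univ A) e f' \<in> K"
      if "f \<in> embs L A B" "f' \<in> embs L A B" for f f' using that by blast
    have "embs L A B \<subseteq> univ A \<rightarrow>\<^sub>E univ B"
      by (auto simp: embs_def PiE_def embeddingD(1))
    then have finE: "finite (embs L A B)"
      using finite_PiE[of "univ A" "\<lambda>_. univ B"] A(2) B(2) by (meson finite_subset)
    define Y where "Y f = {S. \<chi> S (compose (univ A) e f) = 1 \<longleftrightarrow> compose (univ A) e f \<in> K}" for f
    have YW: "Y f \<in> W" for f
    proof (cases "compose (univ A) e f \<in> K")
      case True
      then show ?thesis by (simp add: Y_def K_def)
    next
      case False
      then have "- {S. \<chi> S (compose (univ A) e f) = 1} \<in> W" using um by (auto simp: K_def)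
      then show ?thesis using False by (simp add: Y_def Compl_eq)
    qed
    have eN: "e ` univ B \<subseteq> univ N" using embeddingD(1)[OF e] by blast
    then have "up ` e ` univ B \<subseteq> W" using W by blast
    then have "\<Inter>(up ` e ` univ B \<union> Y ` embs L A B) \<noteq> {}"
      using YW B(2) finE by (intro fip[rule_format]) auto
    then obtain S where "S \<in> \<Inter>(up ` e ` univ B \<union> Y ` embs L A B)" by blast
    then have S: "\<forall>x\<in>univ B. S \<in> up (e x)" "\<forall>f\<in>embs L A B. S \<in> Y f" by simp_all
    obtain x0 where "x0 \<in> univ B" using is_structD(1)[OF B(1)] by blast
    then have S1: "finite S" "S \<subseteq> univ N" "S \<noteq> {}" using S(1) by (auto simp: up_def)
    have "e ` univ B \<subseteq> generated L N S" using S(1) by (auto simp: up_def intro: generated.base)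
    then have eG: "embedding L B (G S) e" unfolding G_def by (rule embedding_restrict_codomain[OF e])
    define e1 where "e1 = restrict e (univ B)"
    have e1: "e1 \<in> embs L B (G S)" unfolding e1_def by (rule restrict_embs[OF B(1) eG])
    have e1c: "compose (univ A) e1 f = compose (univ A) e f" if "f \<in> embs L A B" for f
      using that by (auto simp: compose_def e1_def embs_def embeddingD(1) fun_eq_iff)
    have v01: "\<chi> S (compose (univ A) e f) \<in> {0, 1}" if "f \<in> embs L A B" for f
      using \<chi>(1)[OF S1] compose_embs[OF A(1) that eG] by blast
    have vK: "\<chi> S (compose (univ A) e f) = 1 \<longleftrightarrow> compose (univ A) e f \<in> K" if "f \<in> embs L A B" for f
      using S(2) that by (simp add: Y_def)
    \<comment> \<open>Badness excludes every constant: excluding 0 yields a composite of colour 1,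
      excluding 1 yields one of the other colour.\<close>
    obtain f0 where f0: "f0 \<in> embs L A B" "\<chi> S (compose (univ A) e1 f0) \<noteq> 0"
      using \<chi>(2)[OF S1 e1, of 0] by (elim bexE)
    obtain f1 where f1: "f1 \<in> embs L A B" "\<chi> S (compose (univ A) e1 f1) \<noteq> 1"
      using \<chi>(2)[OF S1 e1, of 1] by (elim bexE)
    have "\<chi> S (compose (univ A) e f0) = 1" using v01[OF f0(1)] f0 by (simp add: e1c)
    moreover have "\<chi> S (compose (univ A) e f1) \<noteq> 1" using f1 by (simp add: e1c)
    ultimately show False using vK[OF f0(1)] vK[OF f1(1)] const[OF f0(1) f1(1)] by blast
  qed
  then show ?thesis by blast
qed

lemma theory_of_struct:
  fixes M :: "('g, 's, 'm) struct"
  assumes M: "is_struct L M" and inf: "infinite (univ M)"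
  defines "T \<equiv> {\<phi> \<in> sentences L. \<forall>e. sat M e \<phi>}"
  shows "models L M T" "complete_theory TYPE('m) L T" "has_infinite_models TYPE('m) L T"
proof -
  show mod: "models L M T" using M by (simp add: models_def T_def)
  then show "has_infinite_models TYPE('m) L T" using inf unfolding has_infinite_models_def by blast
  have dec: "\<phi> \<in> T \<or> Neg \<phi> \<in> T" if "\<phi> \<in> sentences L" for \<phi>
  proof -
    have "fv \<phi> = {}" using that by (simp add: sentences_def)
    then have "sat M e \<phi> \<longleftrightarrow> sat M e' \<phi>" for e e' by (intro sat_cong) simp
    then have "(\<forall>e. sat M e \<phi>) \<or> (\<forall>e. \<not> sat M e \<phi>)" by blast
    then show ?thesis using that by (auto simp: T_def sentences_def formulas_def)
  qed
  have mem: "models L M' {\<phi>}" if "\<phi> \<in> T" "models L M' T" for \<phi> and M' :: "('g, 's, 'm) struct"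
    using that by (simp add: models_def)
  show "complete_theory TYPE('m) L T"
    unfolding complete_theory_def
  proof (intro conjI ballI)
    show "T \<subseteq> sentences L" by (auto simp: T_def)
    show "\<exists>M :: ('g, 's, 'm) struct. models L M T" using mod by blast
    fix \<phi> :: "('g, 's, nat) fm" assume "\<phi> \<in> sentences L"
    then show "(\<forall>M :: ('g, 's, 'm) struct. models L M T \<longrightarrow> models L M {\<phi>}) \<or>
        (\<forall>M :: ('g, 's, 'm) struct. models L M T \<longrightarrow> models L M {Neg \<phi>})"
      using dec mem by meson
  qed
qed

text \<open>\<open>cardSuc |I|\<close> lives on another type and is copied into \<open>'m\<close>;
  there is room because the successor of |I| is at most 2^|I|.\<close>

lemma successor_cardinal_exists:
  assumes I: "infinite I" and big: "|Pow I| \<le>o |UNIV :: 'm set|"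
  obtains \<kappa> :: "'m rel" where "Card_order \<kappa>" "|I| <o \<kappa>"
    "\<And>A :: 'm set. |A| <o \<kappa> \<Longrightarrow> |A| \<le>o |I|"
proof -
  have cs: "Card_order (cardSuc |I| )" by (rule cardSuc_Card_order[OF card_of_Card_order])
  have "cardSuc |I| \<le>o |Pow I|"
    using cardSuc_ordLess_ordLeq[OF card_of_Card_order card_of_Card_order] card_of_Pow by blast
  then have "cardSuc |I| \<le>o |UNIV :: 'm set|" using big ordLeq_transitive by blast
  then have "|Field (cardSuc |I| )| \<le>o |UNIV :: 'm set|"
    using card_of_Field_ordIso[OF cs] ordIso_ordLeq_trans by blast
  then obtain h :: "_ \<Rightarrow> 'm" where h: "inj_on h (Field (cardSuc |I| ))"
    using card_of_ordLeq[of "Field (cardSuc |I| )" "UNIV :: 'm set"] by blast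
  define \<kappa> where "\<kappa> = |h ` Field (cardSuc |I| )|"
  have "|Field (cardSuc |I| )| =o \<kappa>"
    unfolding \<kappa>_def using h by (intro card_of_ordIsoI[of h]) (simp add: bij_betw_def)
  then have iso: "cardSuc |I| =o \<kappa>"
    using card_of_Field_ordIso[OF cs] ordIso_symmetric ordIso_transitive by blast
  show thesis
  proof (rule that)
    show "Card_order \<kappa>" unfolding \<kappa>_def by (rule card_of_Card_order)
    show "|I| <o \<kappa>"
      using cardSuc_greater[OF card_of_Card_order] iso ordLess_ordIso_trans by blast
    show "|A| \<le>o |I|" if "|A| <o \<kappa>" for A :: "'m set"
    proof -
      have "|A| <o cardSuc |I|" using that iso ordIso_symmetric ordLess_ordIso_trans by blast
      then show ?thesis
        using cardSuc_ordLeq_ordLess[OF card_of_Card_order card_of_Card_order] by blast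
    qed
  qed
qed

lemma embedding_enum_eqI:
  assumes "f \<in> extensional (set xs)" "g \<in> extensional (set xs)" "map f xs = map g xs"
  shows "f = g"
  using assms by (intro extensionalityI[of f "set xs" g]) auto

lemma modelling_imp_arrow:
  fixes N :: "('f, 'r, 'i) struct" and A B :: "('f, 'r, 'c) struct"
  assumes N: "is_struct L N" and infN: "infinite (univ N)" and lf: "locally_finite L N"
    and big: "|Pow (univ N)| \<le>o |UNIV :: 'm set|"
    and mp: "modelling_property TYPE('g \<times> 's \<times> 'x \<times> 'm) L N"
    and A: "is_struct L A" "finite (univ A)" and B: "is_struct L B" "finite (univ B)"
    and BN: "embedding L B N g"
  shows "\<exists>C. substructure L C N \<and> finite (univ C) \<and> ramsey_arrow L C B A"
proof (rule ccontr)
  assume neg: "\<not> ?thesis"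
  have "\<exists>K. \<forall>e. embedding L B N e \<longrightarrow>
    (\<exists>f\<in>embs L A B. \<exists>f'\<in>embs L A B. compose (univ A) e f \<in> K \<and> compose (univ A) e f' \<notin> K)"
    using neg by (intro bad_colouring_exists[OF N lf A B]) blast
  then obtain K where K: "\<forall>e. embedding L B N e \<longrightarrow>
    (\<exists>f\<in>embs L A B. \<exists>f'\<in>embs L A B. compose (univ A) e f \<in> K \<and> compose (univ A) e f' \<notin> K)"
    by (elim exE)
  obtain as where as: "set as = univ A" using finite_list[OF A(2)] by blast
  obtain bs where bs: "set bs = univ B" using finite_list[OF B(2)] by blast
  define n where "n = length as"
  define m where "m = length bs"
  have n: "n > 0" using as is_structD(1)[OF A(1)] by (auto simp: n_def)
  \<comment> \<open>The colouring becomes an \<open>n\<close>-ary relation on \<open>N\<close> by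
    listing values along \<open>as\<close>; extensionality lets the list determine the map.\<close>
  define P where "P is \<longleftrightarrow> (\<exists>f\<in>K. f \<in> extensional (univ A) \<and> map f as = is)" for "is"
  have P: "P (map h as) \<longleftrightarrow> h \<in> K" if "h \<in> extensional (univ A)" for h
    using that embedding_enum_eqI[of _ as h] by (auto simp: P_def as)
  obtain V :: "'m set" and j :: "'i \<Rightarrow> 'm" and R where gen: "generic_rel (univ N) V n R"
    and j: "j ` univ N \<subseteq> V" and R: "\<forall>is. set is \<subseteq> univ N \<longrightarrow> (R (map j is) \<longleftrightarrow> P is)"
    by (rule generic_rel_exists[OF infN big n, of P]) blast
  interpret generic_rel "univ N" V n R by (rule gen)
  obtain \<kappa> :: "'m rel" where \<kappa>: "Card_order \<kappa>" "|univ N| <o \<kappa>"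
    and \<kappa>le: "\<And>A :: 'm set. |A| <o \<kappa> \<Longrightarrow> |A| \<le>o |univ N|"
    using successor_cardinal_exists[OF infN big] by metis
  have fin\<kappa>: "|S| <o \<kappa>" if "finite S" for S
    using card_of_finite_ordLeq[OF infN that] \<kappa>(2) ordLeq_ordLess_trans by blast
  define r0 where "r0 = (undefined :: 's)"
  define x0 where "x0 = (undefined :: 'x)"
  define M where "M = (struc :: ('g, 's, 'm) struct)"
  define LT where "LT = (lang r0 :: ('g, 's) language)"
  define T :: "('g, 's, nat) fm set" where "T = {\<phi> \<in> sentences LT. \<forall>e. sat M e \<phi>}"
  have M: "is_struct LT M" unfolding M_def LT_def by (rule is_struct_struc)
  have infM: "infinite (univ M)" using inf_V by (simp add: M_def struc_def)
  have "complete_theory TYPE('m) LT T \<and> has_infinite_models TYPE('m) LT T \<and>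
        Card_order \<kappa> \<and> |funs LT <+> rels LT| <o \<kappa> \<and> |univ N| <o \<kappa> \<and> |{x0}| <o \<kappa> \<and>
        models LT M T \<and> saturated \<kappa> LT M \<and> homogeneous \<kappa> LT M \<and>
        (\<forall>i\<in>univ N. \<forall>\<xi>\<in>{x0}. j i \<in> univ M)"
  proof (intro conjI)
    show "complete_theory TYPE('m) LT T" "has_infinite_models TYPE('m) LT T" "models LT M T"
      unfolding T_def by (rule theory_of_struct[OF M infM])+
    show "|funs LT <+> rels LT| <o \<kappa>" by (rule fin\<kappa>) (simp add: LT_def lang_def)
    show "|{x0}| <o \<kappa>" by (rule fin\<kappa>) simp
    show "saturated \<kappa> LT M" unfolding M_def LT_def by (rule saturated_struc[OF \<kappa>le])
    show "homogeneous \<kappa> LT M" unfolding M_def LT_def by (rule homogeneous_struc[OF \<kappa>le])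
    show "\<forall>i\<in>univ N. \<forall>\<xi>\<in>{x0}. j i \<in> univ M" using j by (auto simp: M_def struc_def)
  qed (use \<kappa> in auto)
  from mp[unfolded modelling_property_def, rule_format, OF this]
  obtain b where ind: "indiscernible L N LT M {x0} b" and base: "based_on L N LT M {x0} b (\<lambda>i _. j i)"
    by (elim exE conjE)
  define rel where "rel ks = (Rel r0 (map (\<lambda>k. Var (k, x0)) ks) :: ('g, 's, nat \<times> 'x) fm)" for ks
  have sat_rel: "sat M (seq_val a is) (rel ks) \<longleftrightarrow> R (map (\<lambda>k. a (is ! k) x0) ks)" for a "is" ks
    by (simp add: rel_def M_def struc_def seq_val_def comp_def)
  have rel_form: "rel ks \<in> formulas LT \<and> fv (rel ks) \<subseteq> seq_vars l {x0}"
    if "set ks \<subseteq> {..<l}" "length ks = n" for ks l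
    using that by (auto simp: rel_def formulas_def LT_def lang_def seq_vars_def)
  define "is" where "is = map g bs"
  have isN: "set is \<subseteq> univ N" using embeddingD(1)[OF BN] by (auto simp: is_def bs)
  \<comment> \<open>One atomic formula for each choice of \<open>n\<close> entries from the
    enumeration of \<open>B\<close>. There are finitely many, as basing requires.\<close>
  define \<Delta> where "\<Delta> = rel ` {ks. set ks \<subseteq> {..<m} \<and> length ks = n}"
  have "finite \<Delta>" unfolding \<Delta>_def by (intro finite_imageI finite_lists_length_eq) simp
  moreover have "\<Delta> \<subseteq> formulas LT" using rel_form by (auto simp: \<Delta>_def)
  ultimately obtain js where js: "js \<in> lists (univ N)" "length js = m" "qftp L N is = qftp L N js"
    and tpeq: "tp_restrict \<Delta> LT M (seq_vars m {x0}) (seq_val b is) =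
      tp_restrict \<Delta> LT M (seq_vars m {x0}) (seq_val (\<lambda>i _. j i) js)"
    using base isN unfolding based_on_def
    by (metis (no_types, lifting) in_listsI is_def length_map m_def subset_code(1))
  have transfer: "R (map (\<lambda>k. b (is ! k) x0) ks) \<longleftrightarrow> R (map (\<lambda>k. j (js ! k)) ks)"
    if ks: "set ks \<subseteq> {..<m}" "length ks = n" for ks
  proof -
    have "rel ks \<in> \<Delta>" using ks by (simp add: \<Delta>_def)
    then have mem: "rel ks \<in> tp_restrict \<Delta> LT M (seq_vars m {x0}) (seq_val a zs) \<longleftrightarrow>
        R (map (\<lambda>k. a (zs ! k) x0) ks)" for a zs
      using rel_form[OF ks] by (simp add: tp_restrict_def tp_def sat_rel)
    show ?thesis using mem[of b "is"] mem[of "\<lambda>i _. j i" js] unfolding tpeq by simp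
  qed
  have jsN: "set js \<subseteq> univ N" using js(1) by auto
  have len: "length js = length is" using js(2) by (simp add: is_def m_def)
  \<comment> \<open>Basing supplies merely a tuple with the quantifier-free type of
    \<open>is\<close>; this step makes it a second copy of \<open>B\<close> in \<open>N\<close>, on
    which the original colouring is evaluated.\<close>
  obtain e0 where e0: "embedding L (N\<lparr>univ := generated L N (set is)\<rparr>) N e0" "map e0 is = js"
    by (rule qftp_eq_embedding[OF N jsN len js(3)])
  have "g ` univ B \<subseteq> generated L N (set is)" by (auto simp: is_def bs[symmetric] intro: generated.base)
  then have "embedding L B (N\<lparr>univ := generated L N (set is)\<rparr>) g"
    by (rule embedding_restrict_codomain[OF BN])
  then have e: "embedding L B N (e0 \<circ> g)" using e0(1) by (rule embedding_comp)
  define e where "e = e0 \<circ> g"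
  have js_e: "js = map e bs" using e0(2) by (simp add: is_def e_def)
  have eB: "embedding L B N e" using e by (simp add: e_def)
  \<comment> \<open>Basing links the colour of a composite with the new copy \<open>e\<close> to the
    relation on the indiscernible sequence at the old copy \<open>g\<close>.\<close>
  have colour: "compose (univ A) e f \<in> K \<longleftrightarrow> R (map (\<lambda>x. b (g (f x)) x0) as)"
    if f: "f \<in> embs L A B" for f
  proof -
    have fB: "f x \<in> univ B" if "x \<in> univ A" for x
      using f that embeddingD(1)[of L A B f x] by (simp add: embs_def)
    have "\<forall>x\<in>univ A. \<exists>k. k < m \<and> bs ! k = f x"
      using fB by (metis bs in_set_conv_nth m_def)
    from bchoice[OF this] obtain k where k: "\<forall>x\<in>univ A. k x < m \<and> bs ! k x = f x" ..
    define ks where "ks = map k as"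
    have ks: "set ks \<subseteq> {..<m}" "length ks = n" using k by (auto simp: ks_def as n_def)
    have kb: "map (\<lambda>k. b (is ! k) x0) ks = map (\<lambda>x. b (g (f x)) x0) as"
      using k by (auto simp: ks_def is_def as m_def)
    have kj: "map (\<lambda>k. j (js ! k)) ks = map j (map (compose (univ A) e f) as)"
      using k by (auto simp: ks_def js_e as m_def compose_def)
    have "compose (univ A) e f \<in> embs L A N" by (rule compose_embs[OF A(1) f eB])
    then have ce: "compose (univ A) e f \<in> extensional (univ A)" "embedding L A N (compose (univ A) e f)"
      by (simp_all add: embs_def)
    have cN: "set (map (compose (univ A) e f) as) \<subseteq> univ N"
      using embeddingD(1)[OF ce(2)] by (auto simp: as)
    have "compose (univ A) e f \<in> K \<longleftrightarrow> P (map (compose (univ A) e f) as)" using P[OF ce(1)] by simp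
    also have "\<dots> \<longleftrightarrow> R (map j (map (compose (univ A) e f) as))" using R cN by blast
    also have "\<dots> \<longleftrightarrow> R (map (\<lambda>x. b (g (f x)) x0) as)"
      using transfer[OF ks] by (simp only: kb kj)
    finally show ?thesis .
  qed
  \<comment> \<open>All copies of \<open>A\<close> inside the image of \<open>g\<close> are listed
    with one and the same quantifier-free type, that of \<open>as\<close> in \<open>A\<close>, so
    indiscernibility cannot separate them.\<close>
  have indep: "R (map (\<lambda>x. b (g (f x)) x0) as) \<longleftrightarrow> R (map (\<lambda>x. b (g (f' x)) x0) as)"
    if f: "f \<in> embs L A B" "f' \<in> embs L A B" for f f'
  proof -
    have q: "qftp L N (map (g \<circ> h) as) = qftp L A as" "set (map (g \<circ> h) as) \<subseteq> univ N"
      if "h \<in> embs L A B" for h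
    proof -
      have h: "embedding L A N (g \<circ> h)"
        using that by (intro embedding_comp[OF _ BN]) (simp add: embs_def)
      show "qftp L N (map (g \<circ> h) as) = qftp L A as"
        by (rule qftp_embedding[OF A(1) h]) (simp add: as)
      show "set (map (g \<circ> h) as) \<subseteq> univ N" using embeddingD(1)[OF h] by (auto simp: as)
    qed
    have tp: "tp LT M (seq_vars n {x0}) (seq_val b (map (g \<circ> f) as)) =
        tp LT M (seq_vars n {x0}) (seq_val b (map (g \<circ> f') as))"
      using ind[unfolded indiscernible_def, rule_format, of "map (g \<circ> f) as" "map (g \<circ> f') as" n]
        q[OF f(1)] q[OF f(2)] by (simp add: n_def in_lists_conv_set subset_iff)
    have mem: "rel [0..<n] \<in> tp LT M (seq_vars n {x0}) (seq_val b (map (g \<circ> h) as)) \<longleftrightarrow>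
        R (map (\<lambda>x. b (g (h x)) x0) as)" for h
    proof -
      have "map (\<lambda>k. b (map (g \<circ> h) as ! k) x0) [0..<n] = map (\<lambda>x. b (g (h x)) x0) as"
        by (auto simp: n_def intro: nth_equalityI)
      moreover have "rel [0..<n] \<in> formulas LT \<and> fv (rel [0..<n]) \<subseteq> seq_vars n {x0}"
        by (rule rel_form) auto
      ultimately show ?thesis by (simp only: tp_def mem_Collect_eq sat_rel simp_thms)
    qed
    show ?thesis unfolding mem[symmetric] tp ..
  qed
  from K[rule_format, OF eB] obtain f f' where "f \<in> embs L A B" "f' \<in> embs L A B"
    "compose (univ A) e f \<in> K" "compose (univ A) e f' \<notin> K" by (elim bexE conjE)
  then show False using colour indep by metis
qed

section \<open>Closure properties of ages\<close>

lemma Age_iso_closed: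
  assumes N: "is_struct L N" and lf: "locally_finite L N"
  shows "iso_closed L (Age L N)"
  unfolding iso_closed_def
proof (intro ballI allI impI)
  fix A B assume "A \<in> Age L N" and "is_struct L B \<and> isomorphic L A B"
  then obtain g h where A: "is_struct L A" "finite (univ A)" "embedding L A N g" and B: "is_struct L B"
    and h: "embedding L A B h" "h ` univ A = univ B"
    by (auto simp: Age_iff[OF N lf] isomorphic_def)
  have "embedding L B N (g \<circ> the_inv_into (univ A) h)"
    by (rule embedding_comp[OF embedding_the_inv_into(1)[OF A(1) h] A(3)])
  moreover have "finite (univ B)" using A(2) h(2) by (metis finite_imageI)
  ultimately show "B \<in> Age L N" using B by (auto simp: Age_iff[OF N lf])
qed

lemma Age_HP:
  assumes N: "is_struct L N" and lf: "locally_finite L N"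
  shows "HP L (Age L N)"
  unfolding HP_def
proof (intro ballI allI impI)
  fix B A assume "B \<in> Age L N" and AB: "substructure L A B"
  then obtain g where B: "finite (univ B)" "embedding L B N g" by (auto simp: Age_iff[OF N lf])
  have "embedding L A N (g \<circ> (\<lambda>x. x))" by (rule embedding_comp[OF embedding_substructure[OF AB] B(2)])
  moreover have "is_struct L A" "finite (univ A)"
    using AB B(1) by (auto simp: substructure_def intro: finite_subset)
  ultimately show "A \<in> Age L N" by (auto simp: Age_iff[OF N lf])
qed

lemma substructure_copy_in_Age:
  fixes N :: "('f, 'r, 'i) struct"
  assumes N: "is_struct L N" and lf: "locally_finite L N"
    and C: "substructure L C N" "finite (univ C)"
  obtains C' :: "('f, 'r, 'c::infinite) struct" and k
  where "C' \<in> Age L N" "embedding L C C' k"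
proof -
  have Cs: "is_struct L C" using C(1) by (simp add: substructure_def)
  obtain C' :: "('f, 'r, 'c) struct" and k where C': "is_struct L C'" and k: "embedding L C C' k"
    "k ` univ C = univ C'" by (rule finite_struct_copy[OF Cs C(2)])
  have "embedding L C' N ((\<lambda>x. x) \<circ> the_inv_into (univ C) k)"
    by (rule embedding_comp[OF embedding_the_inv_into(1)[OF Cs k] embedding_substructure[OF C(1)]])
  moreover have "finite (univ C')" using C(2) k(2) by (metis finite_imageI)
  ultimately have "C' \<in> Age L N" using C' by (auto simp: Age_iff[OF N lf])
  then show thesis using k(1) by (rule that)
qed

text \<open>Both structures embed in \<open>N\<close>, and their images together generate a
  substructure that is finite by local finiteness.\<close>

lemma Age_JEP:
  fixes N :: "('f, 'r, 'i) struct"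
  assumes N: "is_struct L N" and lf: "locally_finite L N"
  shows "JEP L (Age L N :: ('f, 'r, 'c::infinite) struct set)"
  unfolding JEP_def
proof (intro ballI)
  fix A B :: "('f, 'r, 'c) struct" assume "A \<in> Age L N" "B \<in> Age L N"
  then obtain g h where A: "is_struct L A" "finite (univ A)" "embedding L A N g"
    and B: "finite (univ B)" "embedding L B N h" by (auto simp: Age_iff[OF N lf])
  define S where "S = g ` univ A \<union> h ` univ B"
  define C where "C = N\<lparr>univ := generated L N S\<rparr>"
  have SN: "S \<subseteq> univ N" using embeddingD(1)[OF A(3)] embeddingD(1)[OF B(2)] by (auto simp: S_def)
  have "is_struct L C" unfolding C_def
    by (rule is_struct_generated) (use is_structD(1)[OF A(1)] in \<open>simp add: S_def\<close>)
  then have CN: "substructure L C N"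
    using substructure_restrict[OF N] generated_subset[OF N SN] by (simp add: C_def)
  have "finite S" using A(2) B(1) by (simp add: S_def)
  then have "finite (univ C)" using lf SN by (simp add: C_def locally_finite_def)
  then obtain C' :: "('f, 'r, 'c) struct" and k where C': "C' \<in> Age L N" and k: "embedding L C C' k"
    using substructure_copy_in_Age[OF N lf CN] by blast
  have "embedding L A C g" "embedding L B C h" unfolding C_def
    by (auto simp: S_def intro!: embedding_restrict_codomain A(3) B(2) generated.base)
  then have "embedding L A C' (k \<circ> g)" "embedding L B C' (k \<circ> h)"
    using k by (auto intro: embedding_comp)
  then show "\<exists>C\<in>(Age L N :: ('f, 'r, 'c) struct set). (\<exists>g. embedding L A C g) \<and> (\<exists>h. embedding L B C h)"
    by (intro bexI[OF _ C'] conjI exI)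
qed

text \<open>Closure under isomorphism, \<open>HP\<close> and \<open>JEP\<close> hold for the age of
  any locally finite structure, so the equivalence is about \<open>ERP\<close>. The assumption
  \<open>universe_large\<close> gives \<open>'m\<close> room for the generic relation and keeps the
  modelling property from being vacuous.\<close>

theorem theorem1:
  fixes L :: "('f, 'r) language"
    and \<C> :: "('f, 'r, 'c::infinite) struct set"
    and N :: "('f, 'r, 'i) struct"
  assumes "\<forall>A\<in>\<C>. is_struct L A \<and> finite (univ A)"
    and "is_struct L N" and "infinite (univ N)" and "locally_finite L N"
    and "Age L N = \<C>"
    and universe_large: "|Pow (univ N)| \<le>o |UNIV :: 'm set|"
  shows "ramsey_class L \<C> \<longleftrightarrow> modelling_property TYPE('g \<times> 's \<times> 'x \<times> 'm) L N"
proof -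
  note N = assms(2) and infN = assms(3) and lf = assms(4) and Age = assms(5)
  show ?thesis
  proof
    assume "ramsey_class L \<C>"
    then have "ERP L (Age L N :: ('f, 'r, 'c) struct set)" by (simp add: ramsey_class_def Age)
    then have arrows: "arrows_in L N" by (rule ERP_imp_arrows_in[OF N lf])
    show "modelling_property TYPE('g \<times> 's \<times> 'x \<times> 'm) L N"
      unfolding modelling_property_def
    proof (intro allI impI, elim conjE)
      fix LT :: "('g, 's) language" and T and \<kappa> :: "'m rel" and M :: "('g, 's, 'm) struct"
        and X :: "'x set" and a
      assume "Card_order \<kappa>" "|univ N| <o \<kappa>" "|X| <o \<kappa>" "models LT M T" "saturated \<kappa> LT M"
        "\<forall>i\<in>univ N. \<forall>\<xi>\<in>X. a i \<xi> \<in> univ M"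
      then show "\<exists>b. (\<forall>i\<in>univ N. \<forall>\<xi>\<in>X. b i \<xi> \<in> univ M) \<and>
           indiscernible L N LT M X b \<and> based_on L N LT M X b a"
        by (intro modelling_instance[OF N infN lf arrows]) (simp_all add: models_def)
    qed
  next
    assume mp: "modelling_property TYPE('g \<times> 's \<times> 'x \<times> 'm) L N"
    have "ERP L (Age L N :: ('f, 'r, 'c) struct set)"
      unfolding ERP_def
    proof (intro ballI impI)
      fix A B :: "('f, 'r, 'c) struct"
      assume "A \<in> Age L N" "B \<in> Age L N"
      then obtain g where A: "is_struct L A" "finite (univ A)" and B: "is_struct L B" "finite (univ B)"
        and g: "embedding L B N g" by (auto simp: Age_iff[OF N lf])
      obtain C where C: "substructure L C N" "finite (univ C)" "ramsey_arrow L C B A"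
        using modelling_imp_arrow[OF N infN lf universe_large mp A B g] by blast
      obtain C' :: "('f, 'r, 'c) struct" and k where C': "C' \<in> Age L N" and k: "embedding L C C' k"
        using substructure_copy_in_Age[OF N lf C(1,2)] by blast
      \<comment> \<open>\<open>A\<close> and \<open>B\<close> already live on the type of the age;
        only \<open>C\<close> has to be moved there from \<open>N\<close>.\<close>
      have idA: "embedding L A A (\<lambda>x. x)" and idB: "embedding L B B (\<lambda>x. x)"
        using A B by (auto simp: embedding_def is_structD)
      have "ramsey_arrow L C' B A"
        by (rule ramsey_arrow_transfer[OF C(3) A(1) B(1) A(1) B(1) idA _ idB k]) simp
      then show "\<exists>C\<in>(Age L N :: ('f, 'r, 'c) struct set). ramsey_arrow L C B A" using C' by blast
    qed
    then show "ramsey_class L \<C>"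
      unfolding ramsey_class_def Age[symmetric]
      using assms(1)[folded Age] Age_iso_closed[OF N lf] Age_HP[OF N lf] Age_JEP[OF N lf] by blast
  qed
qed

end
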